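(* Let $-1\le q\le 1$ and let $\varepsilon:\mathbb{N}\times\mathbb{N}\to\{\pm1\}$ (with $\mathbb{N}=\{1,2,3,\dots\}$) be a fixed choice of sign function, i.e. $\varepsilon(i,j)=\varepsilon(j,i)$ and $\varepsilon(i,i)=-1$ for all $i,j$, such that, with $X_{n,k},Y_{n,k}\in\Gamma_n$ the operators built from $\varepsilon$ and $q$ as defined in the context, (a) $X_{n,1}\to G_q$ in distribution as $n\to\infty$, i.e. $\tau_n^\varepsilon(Q(X_{n,1}))\to\tau_q(Q(G_q))$ for every polynomial $Q$; and (b) $\|X_{n,k}-Y_{n,k}\|_p\to 0$ as $n\to\infty$ for all integers $k\ge1$ and all real $p\ge 1$. Then for every integer $k\ge 1$, $$(X_{n,1},\dots,X_{n,k},Y_{n,1},\dots,Y_{n,k-1})\longrightarrow (H^q_1(G_q),\dots,H^q_k(G_q),H^q_1(G_q),\dots,H^q_{k-1}(G_q))$$ in distribution as $n\to\infty$; that is, for every polynomial $P$ in $2k-1$ non-commuting variables, $$\tau_n^\varepsilon\big(P(X_{n,1},\dots,X_{n,k},Y_{n,1},\dots,Y_{n,k-1})\big)\to \tau_q\big(P(H^q_1(G_q),\dots,H^q_k(G_q),H^q_1(G_q),\dots,H^q_{k-1}(G_q))\big).$$ (For $k=1$ the lists of $Y$'s and of their limits are empty.)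
   Context: Baby Fock model. For $n\ge1$ let $I=\{1,\dots,n\}$ and restrict $\varepsilon$ to $I\times I$; write $\varepsilon_{i,j}=\varepsilon(i,j)$. Let $\mathcal{A}(I,\varepsilon)$ be the unital complex $*$-algebra with generators $x_i=x_i^*$, $i\in I$, and relations $x_ix_j-\varepsilon(i,j)x_jx_i=2\delta_{i,j}$ (so $x_i^2=1$). For $A=\{i_1<\dots<i_m\}\subseteq I$ put $x_A=x_{i_1}\cdots x_{i_m}$, $x_\emptyset=1$; the $x_A$ form a basis of $\mathcal{A}(I,\varepsilon)$. Let $\phi^\varepsilon$ be the tracial state with $\phi^\varepsilon(x_A)=\delta_{A,\emptyset}$, let $\langle x,y\rangle=\phi^\varepsilon(y^*x)$, and let $H=L^2(\mathcal{A}(I,\varepsilon),\phi^\varepsilon)$, with orthonormal basis $\{x_A\}$. Let $\gamma_i\in B(H)$ be left multiplication by $x_i$, let $\Gamma_n\subset B(H)$ be the von Neumann algebra generated by $\gamma_1,\dots,\gamma_n$, and let $\tau_n^\varepsilon(T)=\langle T1,1\rangle$, a faithful tracial state on $\Gamma_n$. Put $\|T\|_p=(\tau_n^\varepsilon(|T|^p))^{1/p}$. Operators. With $[k]_q=\frac{1-q^k}{1-q}$ (and $[k]_1=k$), for $k\ge1$ set $$X_{n,k}=\frac{1}{n^{k/2}}\sum_{i_1,\dots,i_k}\gamma_{i_1}\cdots\gamma_{i_k},\qquad Y_{n,k}=\frac1{n^{k/2}}\sum_{i_1,\dots,i_k}[k+1]_q^{-1}Z(i_1,\dots,i_k)\,\gamma_{i_1}\cdots\gamma_{i_k},$$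 both sums over $k$-tuples of pairwise distinct elements of $\{1,\dots,n\}$, where $$Z(i_1,\dots,i_k)=\frac1n\sum_{i\in\{1,\dots,n\}\setminus\{i_1,\dots,i_k\}}\big(\varepsilon_{i,i_1}\varepsilon_{i,i_2}\cdots\varepsilon_{i,i_k}+\varepsilon_{i,i_2}\cdots\varepsilon_{i,i_k}+\dots+\varepsilon_{i,i_k}+1\big).$$ Choice of $\varepsilon$. The $\{\varepsilon(i,j):i<j\}$ are taken to be i.i.d. random variables with $P(\varepsilon(i,j)=-1)=\frac{1-q}2$ and $P(\varepsilon(i,j)=1)=\frac{1+q}2$; almost every realization $\varepsilon$ satisfies (a) and (b), and the theorem concerns one such fixed $\varepsilon$. $q$-Hermite polynomials: $H^q_0(x)=1$, $H^q_1(x)=x$, $xH^q_k(x)=H^q_{k+1}(x)+[k]_qH^q_{k-1}(x)$ for $k\ge1$. $q$-gaussian variable $G_q$. For $-1<q<1$, let $\mathcal{H}$ be the complexification of a nonzero real Hilbert space $H_{\mathbb{R}}$ and let $\mathcal{F}_q(\mathcal{H})$ be the $q$-Fock space, i.e. $\mathbb{C}\Omega\oplus\bigoplus_{m\ge1}\mathcal{H}^{\otimes m}$ completed with respect to $\langle\xi,\eta\rangle_q=\langle\xi,P_m\eta\rangle$ on $\mathcal{H}^{\otimes m}$, where $P_m(f_1\otimes\cdots\otimes f_m)=\sum_{\pi\in S_m}q^{i(\pi)}f_{\pi(1)}\otimes\cdots\otimes f_{\pi(m)}$ and $i(\pi)$ is the number of inversions of $\pi$; $\Omega$ is the vacuum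 unit vector. The left creation operator is $\ell_q(h)\Omega=h$, $\ell_q(h)f_1\otimes\cdots\otimes f_m=h\otimes f_1\otimes\cdots\otimes f_m$. Then $G_q=\ell_q(h)+\ell_q(h)^*$ for a unit vector $h\in H_{\mathbb{R}}$, and $\tau_q(T)=\langle T\Omega,\Omega\rangle_q$ is the vacuum state. In the extreme cases $q=1$ and $q=-1$ one uses instead the Bosonic (symmetric) and Fermionic (antisymmetric) Fock spaces with their creation operators; in distribution, $G_1$ is a standard normal random variable and $G_{-1}$ is a random variable taking the values $\pm1$ with probability $\frac12$ each, $\tau_{\pm1}$ being expectation.
   Formalization: For q = -1 and odd k, [k+1]_q = 0, so Y_{n,k} is undefined as written; there the quotient Z/[k+1]_q is read as 1, that is Y_{n,k} = X_{n,k}. All other cases are as stated. *)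

theory Defs
  imports
    "HOL-Probability.Probability"
    "HOL-Combinatorics.Permutations"
    "HOL-Library.Poly_Mapping"
    "HOL-Computational_Algebra.Polynomial"
begin

section \<open>Operators on spaces of coefficient functions\<close>

text \<open>
  Hilbert spaces are subspaces \<^term>\<open>V :: ('b \<Rightarrow> complex) set\<close> with an inner product \<open>ip\<close>,
  linear in the first argument; operators are functions on \<^typ>\<open>'b \<Rightarrow> complex\<close>, of which only the
  restriction to \<open>V\<close> matters.
\<close>

type_synonym 'b vec = "'b \<Rightarrow> complex"
type_synonym 'b oper = "'b vec \<Rightarrow> 'b vec"

definition op_sum :: "'s set \<Rightarrow> ('s \<Rightarrow> complex) \<Rightarrow> ('s \<Rightarrow> 'b oper) \<Rightarrow> 'b oper" where
  "op_sum S c T = (\<lambda>\<xi> b. \<Sum>s\<in>S. c s * T s \<xi> b)"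

definition op_diff :: "'b oper \<Rightarrow> 'b oper \<Rightarrow> 'b oper" where
  "op_diff S T = (\<lambda>\<xi> b. S \<xi> b - T \<xi> b)"

definition op_prod :: "('i \<Rightarrow> 'b oper) \<Rightarrow> 'i list \<Rightarrow> 'b oper" where
  "op_prod T is = foldr (\<lambda>i S. T i \<circ> S) is id"

definition op_poly :: "complex poly \<Rightarrow> 'b oper \<Rightarrow> 'b oper" where
  "op_poly p T = op_sum {..degree p} (coeff p) (\<lambda>i. T ^^ i)"

definition adjoint_on ::
    "'b vec set \<Rightarrow> ('b vec \<Rightarrow> 'b vec \<Rightarrow> complex) \<Rightarrow> 'b oper \<Rightarrow> 'b oper" where
  "adjoint_on V ip T \<eta> = (THE \<zeta>. \<zeta> \<in> V \<and> (\<forall>\<xi>\<in>V. ip (T \<xi>) \<eta> = ip \<xi> \<zeta>))"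

definition orth_proj ::
    "('b vec \<Rightarrow> 'b vec \<Rightarrow> complex) \<Rightarrow> 'b vec set \<Rightarrow> 'b oper" where
  "orth_proj ip W \<xi> = (THE \<zeta>. \<zeta> \<in> W \<and> (\<forall>\<omega>\<in>W. ip (\<lambda>b. \<xi> b - \<zeta> b) \<omega> = 0))"

definition eigenspace_on :: "'b vec set \<Rightarrow> 'b oper \<Rightarrow> real \<Rightarrow> 'b vec set" where
  "eigenspace_on V S t = {\<xi>\<in>V. S \<xi> = (\<lambda>b. of_real t * \<xi> b)}"

text \<open>
  Functional calculus of a self-adjoint operator \<open>S\<close> on a finite-dimensional \<open>V\<close>: the sum of
  \<open>f(t) P\<^sub>t\<close> over the eigenvalues \<open>t\<close>, with \<open>P\<^sub>t\<close> the orthogonal projection onto the eigenspace.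
\<close>

definition fun_calc ::
    "'b vec set \<Rightarrow> ('b vec \<Rightarrow> 'b vec \<Rightarrow> complex) \<Rightarrow> (real \<Rightarrow> real) \<Rightarrow> 'b oper \<Rightarrow> 'b oper" where
  "fun_calc V ip f S =
     op_sum {t. eigenspace_on V S t \<noteq> {\<lambda>_. 0}} (\<lambda>t. of_real (f t))
       (\<lambda>t. orth_proj ip (eigenspace_on V S t))"

definition abs_op ::
    "'b vec set \<Rightarrow> ('b vec \<Rightarrow> 'b vec \<Rightarrow> complex) \<Rightarrow> 'b oper \<Rightarrow> 'b oper" where
  "abs_op V ip T = fun_calc V ip sqrt (adjoint_on V ip T \<circ> T)"


section \<open>Non-commutative polynomials\<close>

text \<open>
  A polynomial in \<open>N\<close> non-commuting variables is a finitely supported complex function on the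
  words over \<open>{..<N}\<close>.
\<close>

type_synonym nc_poly = "nat list \<Rightarrow>\<^sub>0 complex"

definition nc_polys :: "nat \<Rightarrow> nc_poly set" where
  "nc_polys N = {P. \<forall>w\<in>Poly_Mapping.keys P. set w \<subseteq> {..<N}}"

definition nc_eval_op :: "nc_poly \<Rightarrow> 'b oper list \<Rightarrow> 'b oper" where
  "nc_eval_op P Ts = op_sum (Poly_Mapping.keys P) (Poly_Mapping.lookup P) (op_prod (\<lambda>v. Ts ! v))"

definition nc_eval_scalar :: "nc_poly \<Rightarrow> complex list \<Rightarrow> complex" where
  "nc_eval_scalar P cs =
     (\<Sum>w\<in>Poly_Mapping.keys P. Poly_Mapping.lookup P w * prod_list (map (\<lambda>v. cs ! v) w))"


section \<open>The baby Fock model\<close>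

definition sign_function :: "(nat \<Rightarrow> nat \<Rightarrow> int) \<Rightarrow> bool" where
  "sign_function \<epsilon> \<longleftrightarrow>
     (\<forall>i\<ge>1. \<forall>j\<ge>1. \<epsilon> i j \<in> {-1, 1} \<and> \<epsilon> i j = \<epsilon> j i \<and> \<epsilon> i i = -1)"

text \<open>
  The algebra \<open>\<A>(I,\<epsilon>)\<close> is realised on its basis \<open>x\<^sub>A\<close>, \<open>A \<subseteq> I\<close>: an element is
  its coefficient function, supported on \<^term>\<open>Pow I\<close>. Sorting the word \<open>x\<^sub>A x\<^sub>B\<close> by means of
  \<open>x\<^sub>i x\<^sub>j = \<epsilon>(i,j) x\<^sub>j x\<^sub>i\<close> (\<open>i \<noteq> j\<close>) costs one factor \<open>\<epsilon>(a,b)\<close> for every pair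
  \<open>a \<in> A\<close>, \<open>b \<in> B\<close> with \<open>b < a\<close>, and \<open>x\<^sub>i\<^sup>2 = 1\<close> removes the indices occurring twice. Reversing
  the word \<open>x\<^sub>A\<close> costs one factor for each of its pairs. The lemmas below confirm that this is an
  associative unital algebra in which the defining relations hold and \<open>x\<^sub>A\<close> is the ordered product
  of its generators.
\<close>

definition reorder_sign :: "(nat \<Rightarrow> nat \<Rightarrow> int) \<Rightarrow> nat set \<Rightarrow> nat set \<Rightarrow> int" where
  "reorder_sign \<epsilon> A B = (\<Prod>a\<in>A. \<Prod>b\<in>{b\<in>B. b < a}. \<epsilon> a b)"

definition baby_space :: "nat set \<Rightarrow> nat set vec set" where
  "baby_space I = {x. \<forall>A. \<not> A \<subseteq> I \<longrightarrow> x A = 0}"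

definition baby_basis :: "nat set \<Rightarrow> nat set vec" where
  "baby_basis A = (\<lambda>B. if B = A then 1 else 0)"

definition baby_mult ::
    "nat set \<Rightarrow> (nat \<Rightarrow> nat \<Rightarrow> int) \<Rightarrow> nat set vec \<Rightarrow> nat set vec \<Rightarrow> nat set vec" where
  "baby_mult I \<epsilon> x y = (\<lambda>A. \<Sum>B\<in>Pow I. \<Sum>C\<in>Pow I.
     if sym_diff B C = A then of_int (reorder_sign \<epsilon> B C) * x B * y C else 0)"

definition baby_star :: "(nat \<Rightarrow> nat \<Rightarrow> int) \<Rightarrow> nat set vec \<Rightarrow> nat set vec" where
  "baby_star \<epsilon> x = (\<lambda>A. of_int (reorder_sign \<epsilon> A A) * cnj (x A))"

definition baby_phi :: "nat set vec \<Rightarrow> complex" where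
  "baby_phi x = x {}"

definition baby_inner ::
    "nat set \<Rightarrow> (nat \<Rightarrow> nat \<Rightarrow> int) \<Rightarrow> nat set vec \<Rightarrow> nat set vec \<Rightarrow> complex" where
  "baby_inner I \<epsilon> x y = baby_phi (baby_mult I \<epsilon> (baby_star \<epsilon> y) x)"

definition baby_gamma :: "nat set \<Rightarrow> (nat \<Rightarrow> nat \<Rightarrow> int) \<Rightarrow> nat \<Rightarrow> nat set oper" where
  "baby_gamma I \<epsilon> i = baby_mult I \<epsilon> (baby_basis {i})"

definition baby_tau :: "nat set \<Rightarrow> (nat \<Rightarrow> nat \<Rightarrow> int) \<Rightarrow> nat set oper \<Rightarrow> complex" where
  "baby_tau I \<epsilon> T = baby_inner I \<epsilon> (T (baby_basis {})) (baby_basis {})"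

text \<open>\<open>\<tau>(|T|\<^sup>p)\<close> is a non-negative real number for \<open>T\<close> in the von Neumann algebra of the \<open>\<gamma>\<^sub>i\<close>.\<close>

definition baby_norm :: "nat set \<Rightarrow> (nat \<Rightarrow> nat \<Rightarrow> int) \<Rightarrow> real \<Rightarrow> nat set oper \<Rightarrow> real" where
  "baby_norm I \<epsilon> p T =
     Re (baby_tau I \<epsilon> (fun_calc (baby_space I) (baby_inner I \<epsilon>) (\<lambda>t. t powr p)
           (abs_op (baby_space I) (baby_inner I \<epsilon>) T))) powr (1 / p)"

lemma sum_Pow_sym_diff:
  assumes "finite I"
  shows "(\<Sum>C\<in>Pow I. if sym_diff B C = A then f C else (0::complex)) =
    (if sym_diff A B \<subseteq> I then f (sym_diff A B) else 0)"
proof -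
  have *: "sym_diff B C = A \<longleftrightarrow> C = sym_diff A B" for C by blast
  show ?thesis
    unfolding * using assms by (auto simp: sum.delta)
qed

lemma baby_mult_apply:
  assumes "finite I"
  shows "baby_mult I \<epsilon> x y A =
    (if A \<subseteq> I then \<Sum>B\<in>Pow I. of_int (reorder_sign \<epsilon> B (sym_diff A B)) * x B * y (sym_diff A B)
     else 0)"
proof -
  have "baby_mult I \<epsilon> x y A = (\<Sum>B\<in>Pow I. if sym_diff A B \<subseteq> I then
      of_int (reorder_sign \<epsilon> B (sym_diff A B)) * x B * y (sym_diff A B) else 0)"
    unfolding baby_mult_def by (simp add: sum_Pow_sym_diff[OF assms])
  also have "\<dots> = (\<Sum>B\<in>Pow I. if A \<subseteq> I then
      of_int (reorder_sign \<epsilon> B (sym_diff A B)) * x B * y (sym_diff A B) else 0)"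
    by (intro sum.cong refl if_cong) auto
  finally show ?thesis by simp
qed

lemma baby_mult_basis:
  assumes "finite I" "B \<subseteq> I" "C \<subseteq> I"
  shows "baby_mult I \<epsilon> (baby_basis B) (baby_basis C) =
    (\<lambda>A. of_int (reorder_sign \<epsilon> B C) * baby_basis (sym_diff B C) A)"
proof
  fix A
  have "baby_mult I \<epsilon> (baby_basis B) (baby_basis C) A =
     (\<Sum>B'\<in>Pow I. if B' = B then \<Sum>C'\<in>Pow I. (if C' = C then
        (if sym_diff B C = A then of_int (reorder_sign \<epsilon> B C) else 0) else 0) else 0)"
    unfolding baby_mult_def baby_basis_def
  proof (rule sum.cong[OF refl])
    fix B' assume "B' \<in> Pow I"
    show "(\<Sum>C'\<in>Pow I. if sym_diff B' C' = A then of_int (reorder_sign \<epsilon> B' C') *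
        (if B' = B then 1 else 0) * (if C' = C then 1 else 0) else 0) =
      (if B' = B then \<Sum>C'\<in>Pow I. (if C' = C then
        (if sym_diff B C = A then of_int (reorder_sign \<epsilon> B C) else 0) else 0) else (0::complex))"
    proof (cases "B' = B")
      case True
      then show ?thesis by (simp only: True refl if_True) (rule sum.cong[OF refl], simp)
    next
      case False
      then show ?thesis by (simp only: False if_False) (rule sum.neutral, simp)
    qed
  qed
  also have "\<dots> = of_int (reorder_sign \<epsilon> B C) * baby_basis (sym_diff B C) A"
    using assms by (auto simp: baby_basis_def)
  finally show "baby_mult I \<epsilon> (baby_basis B) (baby_basis C) A = \<dots>" .
qed

lemma baby_unit:
  assumes "finite I" "x \<in> baby_space I"
  shows "baby_mult I \<epsilon> (baby_basis {}) x = x" "baby_mult I \<epsilon> x (baby_basis {}) = x"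
proof -
  have "baby_mult I \<epsilon> (baby_basis {}) x A = x A" for A
  proof -
    have "(\<Sum>B\<in>Pow I. of_int (reorder_sign \<epsilon> B (sym_diff A B)) * baby_basis {} B * x (sym_diff A B)) =
       (\<Sum>B\<in>Pow I. if B = {} then x A else 0)"
      by (intro sum.cong refl) (auto simp: baby_basis_def reorder_sign_def)
    then show ?thesis using assms by (auto simp: baby_mult_apply baby_space_def)
  qed
  moreover have "baby_mult I \<epsilon> x (baby_basis {}) A = x A" for A
  proof -
    have "(\<Sum>B\<in>Pow I. of_int (reorder_sign \<epsilon> B (sym_diff A B)) * x B * baby_basis {} (sym_diff A B)) =
       (\<Sum>B\<in>Pow I. if B = A then x A else 0)"
    proof (intro sum.cong refl)
      fix B
      have "sym_diff A B = {} \<longleftrightarrow> B = A" by blast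
      then show "of_int (reorder_sign \<epsilon> B (sym_diff A B)) * x B * baby_basis {} (sym_diff A B) =
        (if B = A then x A else 0)"
        by (auto simp: baby_basis_def reorder_sign_def)
    qed
    then show ?thesis using assms by (auto simp: baby_mult_apply baby_space_def)
  qed
  ultimately show "baby_mult I \<epsilon> (baby_basis {}) x = x" "baby_mult I \<epsilon> x (baby_basis {}) = x"
    by auto
qed

lemma baby_relations:
  assumes "sign_function \<epsilon>" "finite I" "0 \<notin> I" "i \<in> I" "j \<in> I"
  shows "baby_mult I \<epsilon> (baby_basis {i}) (baby_basis {j}) A
      - of_int (\<epsilon> i j) * baby_mult I \<epsilon> (baby_basis {j}) (baby_basis {i}) A
    = (if i = j then 2 * baby_basis {} A else 0)"
proof -
  have ij: "i \<ge> 1" "j \<ge> 1" using assms by (metis One_nat_def Suc_leI gr0I)+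
  have e: "\<epsilon> i j \<in> {-1,1}" "\<epsilon> i j = \<epsilon> j i" "\<epsilon> i i = -1"
    using assms(1) ij unfolding sign_function_def by blast+
  have s: "reorder_sign \<epsilon> {a} {b} = (if b < a then \<epsilon> a b else 1)" for a b
  proof -
    have "{b'. b' = b \<and> b' < a} = (if b < a then {b} else {})" by auto
    then show ?thesis by (simp add: reorder_sign_def)
  qed
  have sd: "sym_diff {i} {j} = (if i = j then {} else {i, j})"
    "sym_diff {j} {i} = (if i = j then {} else {i, j})" by auto
  have sq: "(of_int (\<epsilon> i j) :: complex) * of_int (\<epsilon> i j) = 1" using e(1) by auto
  have m: "baby_mult I \<epsilon> (baby_basis {i}) (baby_basis {j}) A =
      of_int (reorder_sign \<epsilon> {i} {j}) * baby_basis (sym_diff {i} {j}) A"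
    "baby_mult I \<epsilon> (baby_basis {j}) (baby_basis {i}) A =
      of_int (reorder_sign \<epsilon> {j} {i}) * baby_basis (sym_diff {j} {i}) A"
    using assms(2,4,5) by (simp_all only: baby_mult_basis empty_subsetI insert_subset simp_thms)
  consider "i = j" | "i < j" | "j < i" by linarith
  then show ?thesis
    unfolding m s sd using e(2,3) sq by cases (simp_all add: mult.assoc[symmetric])
qed

lemma baby_basis_insert:
  assumes "finite I" "A \<subseteq> I" "i \<in> I" "\<And>a. a \<in> A \<Longrightarrow> i < a"
  shows "baby_basis (insert i A) = baby_mult I \<epsilon> (baby_basis {i}) (baby_basis A)"
proof -
  have "reorder_sign \<epsilon> {i} A = 1"
    using assms(4) by (auto simp: reorder_sign_def intro!: prod.neutral dest: less_asym)
  moreover have "sym_diff {i} A = insert i A" using assms(4) by blast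
  ultimately show ?thesis using assms by (simp add: baby_mult_basis)
qed

lemma prod_sym_diff_int:
  fixes f :: "'a \<Rightarrow> int"
  assumes "finite A" "finite B" "\<And>a. a \<in> A \<union> B \<Longrightarrow> f a \<in> {-1, 1}"
  shows "(\<Prod>a\<in>sym_diff A B. f a) = (\<Prod>a\<in>A. f a) * (\<Prod>a\<in>B. f a)"
proof -
  have A: "(\<Prod>a\<in>A. f a) = (\<Prod>a\<in>A-B. f a) * (\<Prod>a\<in>A\<inter>B. f a)"
    using assms by (subst prod.union_disjoint[symmetric]) (auto intro: prod.cong)
  have B: "(\<Prod>a\<in>B. f a) = (\<Prod>a\<in>B-A. f a) * (\<Prod>a\<in>A\<inter>B. f a)"
    using assms by (subst prod.union_disjoint[symmetric]) (auto intro: prod.cong)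
  have "(\<Prod>a\<in>A\<inter>B. f a) * (\<Prod>a\<in>A\<inter>B. f a) = (\<Prod>a\<in>A\<inter>B. f a * f a)"
    by (simp add: prod.distrib)
  also have "\<dots> = 1" using assms(3) by (intro prod.neutral) force
  finally have "(\<Prod>a\<in>A. f a) * (\<Prod>a\<in>B. f a) = (\<Prod>a\<in>A-B. f a) * (\<Prod>a\<in>B-A. f a)"
    unfolding A B by (simp add: algebra_simps)
  also have "\<dots> = (\<Prod>a\<in>sym_diff A B. f a)"
    using assms by (subst prod.union_disjoint) auto
  finally show ?thesis ..
qed

lemma reorder_sign_pm1:
  assumes "sign_function \<epsilon>" "0 \<notin> A" "0 \<notin> B"
  shows "reorder_sign \<epsilon> A B \<in> {-1, 1}"
proof -
  have *: "(\<Prod>a\<in>S. f a) \<in> {-1, 1}" if "\<And>a. a \<in> S \<Longrightarrow> f a \<in> {-1, 1}" for S :: "nat set" and f :: "nat \<Rightarrow> int"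
  proof (cases "finite S")
    case True then show ?thesis using that by (induction S rule: finite_induct) fastforce+
  qed auto
  show ?thesis unfolding reorder_sign_def
    using assms by (intro * ) (auto simp: sign_function_def, metis One_nat_def Suc_leI gr0I)
qed

lemma reorder_sign_sym_diff:
  assumes "sign_function \<epsilon>" "finite A" "finite B" "finite C" "0 \<notin> A" "0 \<notin> B" "0 \<notin> C"
  shows "reorder_sign \<epsilon> (sym_diff A B) C = reorder_sign \<epsilon> A C * reorder_sign \<epsilon> B C"
    and "reorder_sign \<epsilon> C (sym_diff A B) = reorder_sign \<epsilon> C A * reorder_sign \<epsilon> C B"
proof -
  have e: "\<epsilon> a b \<in> {-1, 1}" if "a \<noteq> 0" "b \<noteq> 0" for a b
    using assms(1) that unfolding sign_function_def by (metis One_nat_def Suc_leI gr0I)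
  have p: "(\<Prod>b\<in>S. \<epsilon> a b) \<in> {-1, 1}" if "0 \<notin> S" "a \<noteq> 0" for S a
  proof (cases "finite S")
    case True
    then show ?thesis using that
    proof (induction S rule: finite_induct)
      case (insert b S)
      then show ?case using e[of a b] by fastforce
    qed auto
  qed auto
  show "reorder_sign \<epsilon> (sym_diff A B) C = reorder_sign \<epsilon> A C * reorder_sign \<epsilon> B C"
    unfolding reorder_sign_def
    by (rule prod_sym_diff_int[OF assms(2,3)], rule p)
      (use assms in \<open>(blast | metis (no_types, lifting) Un_iff mem_Collect_eq)+\<close>)
  have "{b\<in>sym_diff A B. b < c} = sym_diff {b\<in>A. b < c} {b\<in>B. b < c}" for c by blast
  moreover have "(\<Prod>b\<in>sym_diff {b\<in>A. b < c} {b\<in>B. b < c}. \<epsilon> c b) =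
     (\<Prod>b\<in>{b\<in>A. b < c}. \<epsilon> c b) * (\<Prod>b\<in>{b\<in>B. b < c}. \<epsilon> c b)" if "c \<in> C" for c
    by (rule prod_sym_diff_int) (use assms(2,3) that e in \<open>(simp_all, (metis (no_types, lifting) Un_iff assms(5-7) e mem_Collect_eq insert_iff empty_iff)?)\<close>)
  ultimately show "reorder_sign \<epsilon> C (sym_diff A B) = reorder_sign \<epsilon> C A * reorder_sign \<epsilon> C B"
    unfolding reorder_sign_def by (simp add: prod.distrib[symmetric])
qed

lemma baby_assoc:
  assumes "sign_function \<epsilon>" "finite I" "0 \<notin> I"
  shows "baby_mult I \<epsilon> (baby_mult I \<epsilon> x y) z = baby_mult I \<epsilon> x (baby_mult I \<epsilon> y z)"
proof
  fix A
  let ?s = "\<lambda>B C. of_int (reorder_sign \<epsilon> B C) :: complex"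
  show "baby_mult I \<epsilon> (baby_mult I \<epsilon> x y) z A = baby_mult I \<epsilon> x (baby_mult I \<epsilon> y z) A"
  proof (cases "A \<subseteq> I")
    case True
    have "baby_mult I \<epsilon> (baby_mult I \<epsilon> x y) z A =
      (\<Sum>D\<in>Pow I. \<Sum>B\<in>Pow I. ?s D (sym_diff A D) * ?s B (sym_diff D B) *
         x B * y (sym_diff D B) * z (sym_diff A D))"
    proof -
      have "baby_mult I \<epsilon> x y D = (\<Sum>B\<in>Pow I. ?s B (sym_diff D B) * x B * y (sym_diff D B))"
        if "D \<in> Pow I" for D
        using that by (simp add: baby_mult_apply[OF assms(2)])
      then show ?thesis
        unfolding baby_mult_apply[OF assms(2), of \<epsilon> "baby_mult I \<epsilon> x y"]
        using True by (simp add: sum_distrib_left sum_distrib_right mult.assoc)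
    qed
    also have "\<dots> = (\<Sum>B\<in>Pow I. \<Sum>D\<in>Pow I. ?s D (sym_diff A D) * ?s B (sym_diff D B) *
         x B * y (sym_diff D B) * z (sym_diff A D))"
      by (rule sum.swap)
    also have "\<dots> = (\<Sum>B\<in>Pow I. \<Sum>C\<in>Pow I. ?s B (sym_diff A B) * x B *
         (?s C (sym_diff (sym_diff A B) C) * y C * z (sym_diff (sym_diff A B) C)))"
    proof (rule sum.cong[OF refl])
      fix B assume B: "B \<in> Pow I"
      show "(\<Sum>D\<in>Pow I. ?s D (sym_diff A D) * ?s B (sym_diff D B) *
         x B * y (sym_diff D B) * z (sym_diff A D)) = (\<Sum>C\<in>Pow I. ?s B (sym_diff A B) * x B *
         (?s C (sym_diff (sym_diff A B) C) * y C * z (sym_diff (sym_diff A B) C)))"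
      proof (rule sum.reindex_bij_witness[where i = "\<lambda>C. sym_diff C B" and j = "\<lambda>D. sym_diff D B"])
        fix D assume D: "D \<in> Pow I"
        define C where "C = sym_diff D B"
        define E where "E = sym_diff A D"
        have DC: "D = sym_diff B C" and AB: "sym_diff A B = sym_diff C E"
          and E': "sym_diff (sym_diff A B) C = E"
          unfolding C_def E_def by blast+
        have fin: "finite B" "finite C" "finite E" "0 \<notin> B" "0 \<notin> C" "0 \<notin> E"
          using B D True assms finite_subset[of _ I] unfolding C_def E_def by auto
        have "reorder_sign \<epsilon> D E * reorder_sign \<epsilon> B C =
            reorder_sign \<epsilon> B (sym_diff A B) * reorder_sign \<epsilon> C E"
          unfolding AB unfolding DC using fin assms(1) by (simp add: reorder_sign_sym_diff)
        then have "?s D E * ?s B C = ?s B (sym_diff A B) * ?s C E"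
          by (metis of_int_mult)
        then show "?s B (sym_diff A B) * x B * (?s (sym_diff D B) (sym_diff (sym_diff A B) (sym_diff D B)) *
           y (sym_diff D B) * z (sym_diff (sym_diff A B) (sym_diff D B))) =
           ?s D (sym_diff A D) * ?s B (sym_diff D B) * x B * y (sym_diff D B) * z (sym_diff A D)"
          unfolding C_def[symmetric] E' E_def[symmetric] by (simp add: mult.assoc mult.left_commute)
      qed (use B in \<open>blast+\<close>)
    qed
    also have "\<dots> = (\<Sum>B\<in>Pow I. ?s B (sym_diff A B) * x B * baby_mult I \<epsilon> y z (sym_diff A B))"
    proof (rule sum.cong[OF refl])
      fix B assume "B \<in> Pow I"
      then have "sym_diff A B \<subseteq> I" using True by blast
      then show "(\<Sum>C\<in>Pow I. ?s B (sym_diff A B) * x B *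
         (?s C (sym_diff (sym_diff A B) C) * y C * z (sym_diff (sym_diff A B) C))) =
         ?s B (sym_diff A B) * x B * baby_mult I \<epsilon> y z (sym_diff A B)"
        unfolding baby_mult_apply[OF assms(2)] by (simp add: sum_distrib_left del: Un_subset_iff)
    qed
    also have "\<dots> = baby_mult I \<epsilon> x (baby_mult I \<epsilon> y z) A"
      using True by (subst (2) baby_mult_apply[OF assms(2)]) simp
    finally show ?thesis .
  qed (use assms(2) in \<open>simp add: baby_mult_apply\<close>)
qed

lemma baby_inner_orthonormal:
  assumes "sign_function \<epsilon>" "finite I" "0 \<notin> I"
  shows "baby_inner I \<epsilon> x y = (\<Sum>A\<in>Pow I. x A * cnj (y A))"
proof -
  have "(of_int (reorder_sign \<epsilon> A A) :: complex) * of_int (reorder_sign \<epsilon> A A) = 1"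
    if "A \<subseteq> I" for A
    proof -
    have "reorder_sign \<epsilon> A A \<in> {-1, 1}"
      using reorder_sign_pm1[OF assms(1)] that assms(3) by blast
    then show ?thesis by auto
  qed
  then have *: "(of_int (reorder_sign \<epsilon> A A) :: complex) *
      (of_int (reorder_sign \<epsilon> A A) * cnj (y A)) * x A = x A * cnj (y A)" if "A \<in> Pow I" for A
    using that by (metis (no_types, opaque_lifting) Pow_iff mult.assoc mult.commute mult_1)
  have "baby_inner I \<epsilon> x y = (\<Sum>A\<in>Pow I. of_int (reorder_sign \<epsilon> A A) *
      (of_int (reorder_sign \<epsilon> A A) * cnj (y A)) * x A)"
    by (simp add: baby_inner_def baby_phi_def baby_star_def baby_mult_apply[OF assms(2)])
  then show ?thesis by (simp only: * cong: sum.cong)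
qed


section \<open>The operators \<open>X\<^sub>n\<^sub>,\<^sub>k\<close> and \<open>Y\<^sub>n\<^sub>,\<^sub>k\<close>\<close>

definition qint :: "real \<Rightarrow> nat \<Rightarrow> real" where
  "qint q k = (if q = 1 then real k else (1 - q ^ k) / (1 - q))"

definition distinct_tuples :: "nat \<Rightarrow> nat \<Rightarrow> nat list set" where
  "distinct_tuples n k = {is. length is = k \<and> distinct is \<and> set is \<subseteq> {1..n}}"

definition baby_X :: "(nat \<Rightarrow> nat \<Rightarrow> int) \<Rightarrow> nat \<Rightarrow> nat \<Rightarrow> nat set oper" where
  "baby_X \<epsilon> n k =
     op_sum (distinct_tuples n k) (\<lambda>_. of_real (1 / real n powr (real k / 2)))
       (op_prod (baby_gamma {1..n} \<epsilon>))"

definition baby_Z :: "(nat \<Rightarrow> nat \<Rightarrow> int) \<Rightarrow> nat \<Rightarrow> nat list \<Rightarrow> real" where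
  "baby_Z \<epsilon> n is =
     1 / real n * (\<Sum>i\<in>{1..n} - set is. \<Sum>l\<le>length is. \<Prod>j\<leftarrow>drop l is. real_of_int (\<epsilon> i j))"

text \<open>
  For \<open>-1 \<le> q \<le> 1\<close> and \<open>k \<ge> 1\<close> the number \<open>[k+1]\<^sub>q\<close> vanishes exactly if \<open>q = -1\<close> and \<open>k\<close> is
  odd. The quotient of \<open>Z\<close> by \<open>[k+1]\<^sub>q\<close>, whose mean over the random signs is \<open>(n-k)/n\<close> for
  \<open>q > -1\<close>, is then an undefined \<open>0/0\<close> and is read as \<open>1\<close>, so that \<open>Y\<^sub>n\<^sub>,\<^sub>k\<close> becomes \<open>X\<^sub>n\<^sub>,\<^sub>k\<close>.
  (Division by zero in HOL would instead give \<open>Y\<^sub>n\<^sub>,\<^sub>k = 0\<close> and make the assumptions of the theorem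
  contradictory for \<open>q = -1\<close>.)
\<close>

definition baby_weight :: "real \<Rightarrow> (nat \<Rightarrow> nat \<Rightarrow> int) \<Rightarrow> nat \<Rightarrow> nat list \<Rightarrow> real" where
  "baby_weight q \<epsilon> n is =
     (if qint q (length is + 1) = 0 then 1
      else inverse (qint q (length is + 1)) * baby_Z \<epsilon> n is)"

definition baby_Y :: "real \<Rightarrow> (nat \<Rightarrow> nat \<Rightarrow> int) \<Rightarrow> nat \<Rightarrow> nat \<Rightarrow> nat set oper" where
  "baby_Y q \<epsilon> n k =
     op_sum (distinct_tuples n k)
       (\<lambda>is. of_real (1 / real n powr (real k / 2) * baby_weight q \<epsilon> n is))
       (op_prod (baby_gamma {1..n} \<epsilon>))"

fun q_hermite :: "real \<Rightarrow> nat \<Rightarrow> complex poly" where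
  "q_hermite q 0 = 1"
| "q_hermite q (Suc 0) = [:0, 1:]"
| "q_hermite q (Suc (Suc k)) =
     [:0, 1:] * q_hermite q (Suc k) - smult (of_real (qint q (Suc k))) (q_hermite q k)"


section \<open>The \<open>q\<close>-gaussian variable\<close>

text \<open>
  Up to isometry, \<open>H\<^sub>\<real>\<close> is the real \<open>\<ell>\<^sup>2('j)\<close>, where the type \<^typ>\<open>'j\<close> indexes an orthonormal
  basis. The \<open>m\<close>-th Hilbert tensor power of its complexification is \<open>\<ell>\<^sup>2\<close> of the words of length
  \<open>m\<close> over \<^typ>\<open>'j\<close>, and \<open>f\<^sub>1 \<otimes> \<dots> \<otimes> f\<^sub>m\<close> is the function sending
  \<open>w\<close> to the product of the \<open>f\<^sub>i (w\<^sub>i)\<close>; so \<open>f\<^sub>\<pi>\<^sub>(\<^sub>1\<^sub>) \<otimes> \<dots> \<otimes> f\<^sub>\<pi>\<^sub>(\<^sub>m\<^sub>)\<close> at \<open>w\<close> is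
  \<open>f\<^sub>1 \<otimes> \<dots> \<otimes> f\<^sub>m\<close> at \<open>w \<circ> \<pi>\<^sup>-\<^sup>1\<close>. A Fock space vector is a function on all words, and
  the vacuum component is its value at the empty word.
\<close>

definition inversions :: "nat \<Rightarrow> (nat \<Rightarrow> nat) \<Rightarrow> nat" where
  "inversions m \<pi> = card {(i, j). i < j \<and> j < m \<and> \<pi> i > \<pi> j}"

definition q_symmetrizer :: "real \<Rightarrow> 'j list oper" where
  "q_symmetrizer q \<eta> = (\<lambda>w. \<Sum>\<pi> | \<pi> permutes {..<length w}.
     of_real (q ^ inversions (length w) \<pi>) * \<eta> (permute_list (inv \<pi>) w))"

definition level_inner :: "real \<Rightarrow> nat \<Rightarrow> 'j list vec \<Rightarrow> 'j list vec \<Rightarrow> complex" where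
  "level_inner q m \<xi> \<eta> = (\<Sum>\<^sub>\<infinity>w\<in>{w. length w = m}. \<xi> w * cnj (q_symmetrizer q \<eta> w))"

text \<open>
  For \<open>|q| < 1\<close> the operator \<open>P\<^sub>m\<close> is bounded and bounded below on the \<open>m\<close>-th tensor power, so
  the completion is the \<open>\<ell>\<^sup>2\<close>-direct sum of the levels.
\<close>

definition q_fock :: "real \<Rightarrow> 'j list vec set" where
  "q_fock q = {\<xi>. (\<forall>m. (\<lambda>w. (cmod (\<xi> w))\<^sup>2) summable_on {w. length w = m}) \<and>
                  summable (\<lambda>m. Re (level_inner q m \<xi> \<xi>))}"

definition q_inner :: "real \<Rightarrow> 'j list vec \<Rightarrow> 'j list vec \<Rightarrow> complex" where
  "q_inner q \<xi> \<eta> = suminf (\<lambda>m. level_inner q m \<xi> \<eta>)"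

definition vacuum :: "'j list vec" where
  "vacuum w = (if w = [] then 1 else 0)"

fun creation :: "('j \<Rightarrow> real) \<Rightarrow> 'j list oper" where
  "creation h \<xi> [] = 0"
| "creation h \<xi> (j # w) = of_real (h j) * \<xi> w"

definition q_gaussian_op :: "real \<Rightarrow> ('j \<Rightarrow> real) \<Rightarrow> 'j list oper" where
  "q_gaussian_op q h =
     (\<lambda>\<xi> w. creation h \<xi> w + adjoint_on (q_fock q) (q_inner q) (creation h) \<xi> w)"

definition vacuum_state :: "real \<Rightarrow> 'j list oper \<Rightarrow> complex" where
  "vacuum_state q T = q_inner q (T vacuum) vacuum"

definition classical_gaussian :: "real \<Rightarrow> real measure" where
  "classical_gaussian q =
     (if q = 1 then density lborel std_normal_density
      else measure_pmf (pmf_of_set {-1, 1}))"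

text \<open>
  \<open>\<tau>\<^sub>q(P(p\<^sub>1(G\<^sub>q),\<dots>,p\<^sub>N(G\<^sub>q)))\<close> for one-variable polynomials \<open>p\<^sub>1,\<dots>,p\<^sub>N\<close>. In the extreme cases
  \<open>q = \<plusminus>1\<close> the variable \<open>G\<^sub>q\<close> is the identity function on \<open>\<real>\<close> under its distribution.
\<close>

definition q_gaussian_moment ::
    "real \<Rightarrow> ('j \<Rightarrow> real) \<Rightarrow> complex poly list \<Rightarrow> nc_poly \<Rightarrow> complex" where
  "q_gaussian_moment q h ps P =
     (if \<bar>q\<bar> < 1
      then vacuum_state q (nc_eval_op P (map (\<lambda>p. op_poly p (q_gaussian_op q h)) ps))
      else LINT x|classical_gaussian q. nc_eval_scalar P (map (\<lambda>p. poly p (of_real x)) ps))"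

end

theory Submission
  imports Defs "HOL-Computational_Algebra.Fundamental_Theorem_Algebra"
begin

text \<open>
  All operators of the baby Fock model are left multiplications by elements of the algebra, so the
  theorem is a statement about sequences of algebra elements. Multiplying the sum \<open>X\<^sub>n\<^sub>,\<^sub>k\<close> over
  \<open>k\<close>-tuples of distinct letters by \<open>X\<^sub>n\<^sub>,\<^sub>1\<close> from the right either adds a new letter or contracts one
  of the old ones, and the contraction of the letter \<open>i\<close> with its copy inside the tuple costs exactly
  the product of signs that occurs in \<open>Z\<close>. Hence, without any error term and as long as \<open>[k]\<^sub>q \<noteq> 0\<close>,
  \<open>X\<^sub>k X\<^sub>1 = X\<^sub>k\<^sub>+\<^sub>1 + [k]\<^sub>q Y\<^sub>k\<^sub>-\<^sub>1\<close> (\<open>X_chaos_mul_X1\<close>, \<open>contraction_eq_Y_chaos\<close>). As \<open>Y\<^sub>k\<^sub>-\<^sub>1\<close> is close to \<open>X\<^sub>k\<^sub>-\<^sub>1\<close> by assumption, this is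
  the recursion of the \<open>q\<close>-Hermite polynomials up to a small error, and induction shows that
  \<open>X\<^sub>k - H\<^sup>q\<^sub>k(X\<^sub>1)\<close> and \<open>Y\<^sub>k - H\<^sup>q\<^sub>k(X\<^sub>1)\<close> tend to \<open>0\<close> (\<open>X_chaos_minus_hermite_X_null\<close>). A moment of the \<open>X\<close> and \<open>Y\<close> is
  therefore asymptotically the moment of a single polynomial in \<open>X\<^sub>1\<close>, whose limit is known
  (\<open>joint_moments_tendsto\<close>).

  Smallness is measured in the Hilbert-Schmidt norm. All elements in question are sums
  of chaoses, that is, of sums \<open>n\<^sup>-\<^sup>K\<^sup>/\<^sup>2 \<Sum> c(J) x\<^sub>J\<close> over all words \<open>J\<close> of a fixed length \<open>K\<close> with bounded
  coefficients. These form a \<open>*\<close>-algebra, and counting words in which every letter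
  occurs an even number of times shows that their Hilbert-Schmidt norms are bounded (\<open>hs_norm_chaos_le\<close>).
  By the estimate \<open>\<parallel>a e\<parallel>\<^sup>2 \<le> \<parallel>e\<parallel> \<parallel>a\<^sup>* a e\<parallel>\<close> the sequences with vanishing norm are a two-sided ideal in it,
  which is the role that Hoelder's inequality has in the usual argument. The spectral theorem
  in finite dimension identifies the noncommutative \<open>L\<^sup>2\<close> norm, defined by functional
  calculus, with the Hilbert-Schmidt norm (\<open>baby_norm_2\<close>).

  If \<open>q = -1\<close> and \<open>k\<close> is even, then \<open>[k]\<^sub>q = 0\<close>, the recursion requires the contraction term itself to vanish
  in the limit, and \<open>Y\<^sub>k\<^sub>-\<^sub>1 = X\<^sub>k\<^sub>-\<^sub>1\<close> by convention says nothing about it. Here the convergence of the second and the fourth moment of \<open>X\<^sub>1\<close> to those of a random sign forces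
  the proportion of the pairs \<open>i \<noteq> j\<close> with \<open>\<epsilon>(i,j) = 1\<close> to vanish (\<open>commuting_density_eq\<close>).
  Then almost all letters anticommute, antisymmetry makes \<open>X\<^sub>k\<close> small for all \<open>k \<ge> 2\<close> (\<open>X_chaos_null\<close>), and
  so the contraction term, a difference of such elements, is small too.

  On the side of the limit, for \<open>|q| < 1\<close>, a polynomial in polynomials in \<open>G\<^sub>q\<close> has to be recognised as
  one polynomial in \<open>G\<^sub>q\<close>. This needs linearity of \<open>G\<^sub>q\<close> on the span of the tensor powers of \<open>h\<close>, hence
  the existence and the uniqueness of the adjoint of the creation operator. Uniqueness rests on the
  injectivity of the symmetrizers \<open>P\<^sub>m\<close>. It holds because the number of inversions of \<open>\<rho>\<^sup>-\<^sup>1\<sigma>\<close> is the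
  size of the symmetric difference of two sets of pairs attached to \<open>\<rho>\<close> and \<open>\<sigma>\<close>, and the kernel
  \<open>q\<close> to the power \<open>|A \<triangle> B|\<close> on the subsets of a finite set is strictly positive definite.
\<close>


section \<open>Polynomials in a linear operator\<close>

text \<open>Vectors are coefficient functions and operators are arbitrary maps between them, so linearity is a
  property of an operator relative to an invariant subspace.\<close>

definition lin_subspace :: "'b vec set \<Rightarrow> bool" where
  "lin_subspace W \<longleftrightarrow> (\<lambda>_. 0) \<in> W \<and> (\<forall>x\<in>W. \<forall>y\<in>W. (\<lambda>b. x b + y b) \<in> W) \<and>
     (\<forall>c. \<forall>x\<in>W. (\<lambda>b. c * x b) \<in> W)"

definition linear_on_subspace :: "'b vec set \<Rightarrow> 'b oper \<Rightarrow> bool" where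
  "linear_on_subspace W G \<longleftrightarrow> lin_subspace W \<and> (\<forall>x\<in>W. G x \<in> W) \<and>
     (\<forall>x\<in>W. \<forall>y\<in>W. G (\<lambda>b. x b + y b) = (\<lambda>b. G x b + G y b)) \<and>
     (\<forall>c. \<forall>x\<in>W. G (\<lambda>b. c * x b) = (\<lambda>b. c * G x b))"

lemma lin_subspace_sum:
  assumes "lin_subspace W" "\<And>i. i \<in> A \<Longrightarrow> f i \<in> W"
  shows "(\<lambda>b. \<Sum>i\<in>A. c i * f i b) \<in> W"
proof (cases "finite A")
  case True
  then show ?thesis using assms(2)
  proof (induction A rule: finite_induct)
    case empty
    then show ?case using assms(1) by (simp add: lin_subspace_def)
  next
    case (insert a A)
    then have "(\<lambda>b. c a * f a b) \<in> W" "(\<lambda>b. \<Sum>i\<in>A. c i * f i b) \<in> W"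
      using assms(1) by (auto simp: lin_subspace_def)
    then have "(\<lambda>b. c a * f a b + (\<Sum>i\<in>A. c i * f i b)) \<in> W"
      using assms(1) by (simp add: lin_subspace_def)
    then show ?case using insert.hyps by simp
  qed
next
  case False
  then show ?thesis using assms(1) by (simp add: lin_subspace_def)
qed

lemma linear_on_subspace_sum:
  assumes "linear_on_subspace W G" "\<And>i. i \<in> A \<Longrightarrow> f i \<in> W"
  shows "G (\<lambda>b. \<Sum>i\<in>A. c i * f i b) = (\<lambda>b. \<Sum>i\<in>A. c i * G (f i) b)"
proof -
  have W: "lin_subspace W" and
    add: "\<And>x y. x \<in> W \<Longrightarrow> y \<in> W \<Longrightarrow> G (\<lambda>b. x b + y b) = (\<lambda>b. G x b + G y b)" and
    scale: "\<And>c x. x \<in> W \<Longrightarrow> G (\<lambda>b. c * x b) = (\<lambda>b. c * G x b)"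
    using assms(1) by (auto simp: linear_on_subspace_def)
  have zero: "G (\<lambda>b. 0) = (\<lambda>b. 0)"
    using scale[of "\<lambda>b. 0" 0] W by (simp add: lin_subspace_def)
  show ?thesis
  proof (cases "finite A")
    case True
    then show ?thesis using assms(2)
    proof (induction A rule: finite_induct)
      case (insert a A)
      have "(\<lambda>b. c a * f a b) \<in> W" "(\<lambda>b. \<Sum>i\<in>A. c i * f i b) \<in> W"
        using W insert.prems lin_subspace_sum[OF W, of A f c] by (auto simp: lin_subspace_def)
      from add[OF this] show ?case
        using insert scale[of "f a" "c a"] by simp
    qed (use zero in simp)
  qed (use zero in simp)
qed

lemma linear_on_subspace_zero:
  assumes "linear_on_subspace W G"
  shows "G (\<lambda>b. 0) = (\<lambda>b. 0)"
proof -
  have "(\<lambda>b. 0) \<in> W" using assms by (auto simp: linear_on_subspace_def lin_subspace_def)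
  moreover have "G (\<lambda>b. c * x b) = (\<lambda>b. c * G x b)" if "x \<in> W" for c x
    using assms that by (simp add: linear_on_subspace_def)
  from this[of "\<lambda>b. 0" 0] show ?thesis using calculation by simp
qed

lemma linear_on_subspace_add:
  assumes "linear_on_subspace W G" "x \<in> W" "y \<in> W"
  shows "G (\<lambda>b. x b + y b) = (\<lambda>b. G x b + G y b)"
  using assms by (simp add: linear_on_subspace_def)

lemma linear_on_subspace_funpow:
  assumes "linear_on_subspace W G" "x \<in> W"
  shows "(G ^^ i) x \<in> W"
  using assms by (induction i) (auto simp: linear_on_subspace_def)

lemma op_poly_in_subspace:
  assumes "linear_on_subspace W G" "x \<in> W"
  shows "op_poly p G x \<in> W"
  unfolding op_poly_def op_sum_def
  using assms linear_on_subspace_funpow[OF assms]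
  by (intro lin_subspace_sum) (auto simp: linear_on_subspace_def)

lemma op_poly_bound:
  assumes "degree p \<le> N"
  shows "op_poly p T x b = (\<Sum>i\<le>N. coeff p i * (T ^^ i) x b)"
  unfolding op_poly_def op_sum_def
  by (rule sum.mono_neutral_left) (use assms in \<open>auto simp: coeff_eq_0\<close>)

lemma op_poly_add: "op_poly (p + r) T x = (\<lambda>b. op_poly p T x b + op_poly r T x b)"
proof
  fix b
  define N where "N = max (degree p) (degree r)"
  have "degree p \<le> N" "degree r \<le> N" "degree (p + r) \<le> N"
    by (auto simp: N_def degree_add_le)
  then show "op_poly (p + r) T x b = op_poly p T x b + op_poly r T x b"
    by (simp add: op_poly_bound[where N = N] sum.distrib distrib_right)
qed

lemma op_poly_smult: "op_poly (smult c p) T x = (\<lambda>b. c * op_poly p T x b)"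
proof
  fix b
  show "op_poly (smult c p) T x b = c * op_poly p T x b"
    by (simp add: op_poly_bound[OF degree_smult_le] op_poly_bound[of p "degree p"]
        sum_distrib_left mult.assoc)
qed

lemma op_poly_0: "op_poly 0 T x = (\<lambda>b. 0)"
  by (simp add: op_poly_def op_sum_def)

lemma op_poly_1: "op_poly 1 T x = x"
  by (simp add: op_poly_def op_sum_def)

lemma op_poly_sum:
  "op_poly (\<Sum>i\<in>A. p i) T x = (\<lambda>b. \<Sum>i\<in>A. op_poly (p i) T x b)"
  by (induction A rule: infinite_finite_induct) (simp_all add: op_poly_0 op_poly_add)

lemma op_poly_pCons_0:
  assumes "linear_on_subspace W G" "x \<in> W"
  shows "op_poly (pCons 0 p) G x = G (op_poly p G x)"
proof -
  have "G (op_poly p G x) = (\<lambda>b. \<Sum>i\<le>degree p. coeff p i * (G ^^ Suc i) x b)"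
    unfolding op_poly_def op_sum_def
    by (subst linear_on_subspace_sum[OF assms(1) linear_on_subspace_funpow[OF assms]]) simp
  moreover have "op_poly (pCons 0 p) G x b = (\<Sum>i\<le>degree p. coeff p i * (G ^^ Suc i) x b)" for b
    by (subst op_poly_bound[where N = "Suc (degree p)"])
      (simp_all add: sum.atMost_Suc_shift degree_pCons_eq_if del: sum.atMost_Suc)
  ultimately show ?thesis by auto
qed

text \<open>In \<open>p(G) (r(G) x)\<close> the powers of \<open>G\<close> from \<open>p\<close> have to pass through the sum that defines \<open>r(G) x\<close>;
  this is where linearity along the orbit of \<open>x\<close> is used.\<close>

lemma op_poly_mult:
  assumes "linear_on_subspace W G" "x \<in> W"
  shows "op_poly (p * r) G x = op_poly p G (op_poly r G x)"
proof (induction p)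
  case 0
  then show ?case by (simp add: op_poly_0)
next
  case (pCons a p)
  have r: "op_poly r G x \<in> W" by (rule op_poly_in_subspace[OF assms])
  have eq: "pCons a p = smult a 1 + pCons 0 p" by simp
  have "op_poly (pCons a p * r) G x = op_poly (smult a r + pCons 0 (p * r)) G x"
    by simp
  also have "\<dots> = (\<lambda>b. a * op_poly r G x b + G (op_poly p G (op_poly r G x)) b)"
    by (simp only: op_poly_add op_poly_smult op_poly_pCons_0[OF assms] pCons.IH)
  also have "\<dots> = op_poly (pCons a p) G (op_poly r G x)"
    unfolding eq by (simp only: op_poly_add op_poly_smult op_poly_1 op_poly_pCons_0[OF assms(1) r])
  finally show ?case .
qed

lemma op_poly_x:
  assumes "linear_on_subspace W G" "x \<in> W"
  shows "op_poly [:0, 1:] G x = G x"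
  using op_poly_pCons_0[OF assms, of 1] by (simp add: op_poly_1 flip: one_pCons)

text \<open>The one-variable polynomial \<open>P(p\<^sub>1, \<dots>, p\<^sub>N)\<close>; as polynomials in one operator commute, it carries the
  whole value of \<open>P\<close> at such polynomials.\<close>

definition subst_poly :: "nc_poly \<Rightarrow> complex poly list \<Rightarrow> complex poly" where
  "subst_poly P ps = (\<Sum>w\<in>Poly_Mapping.keys P.
     smult (Poly_Mapping.lookup P w) (prod_list (map (\<lambda>v. ps ! v) w)))"

lemma op_prod_op_poly:
  assumes "linear_on_subspace W G" "x \<in> W" "set w \<subseteq> {..<length ps}"
  shows "op_prod (\<lambda>v. map (\<lambda>p. op_poly p G) ps ! v) w x = op_poly (prod_list (map (\<lambda>v. ps ! v) w)) G x"
  using assms(3)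
proof (induction w)
  case Nil
  then show ?case by (simp add: op_prod_def op_poly_1)
next
  case (Cons v w)
  then show ?case
    by (simp add: op_prod_def op_poly_mult[OF assms(1,2)])
qed

lemma nc_eval_op_poly:
  assumes "linear_on_subspace W G" "x \<in> W" "P \<in> nc_polys (length ps)"
  shows "nc_eval_op P (map (\<lambda>p. op_poly p G) ps) x = op_poly (subst_poly P ps) G x"
  unfolding nc_eval_op_def subst_poly_def op_poly_sum op_sum_def
  using assms(3) by (intro ext sum.cong refl)
    (simp add: op_poly_smult nc_polys_def op_prod_op_poly[OF assms(1,2)])

lemma nc_eval_scalar_subst_poly:
  assumes "P \<in> nc_polys (length ps)"
  shows "nc_eval_scalar P (map (\<lambda>p. poly p z) ps) = poly (subst_poly P ps) z"
proof -
  have "prod_list (map (\<lambda>v. map (\<lambda>p. poly p z) ps ! v) w) = poly (prod_list (map (\<lambda>v. ps ! v) w)) z"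
    if "set w \<subseteq> {..<length ps}" for w
    using that by (induction w) auto
  then show ?thesis
    using assms unfolding nc_eval_scalar_def subst_poly_def poly_sum
    by (intro sum.cong refl) (simp add: nc_polys_def)
qed

definition univariate :: "complex poly \<Rightarrow> nc_poly" where
  "univariate R = Abs_poly_mapping (\<lambda>w. if set w \<subseteq> {0} then coeff R (length w) else 0)"

lemma univariate:
  shows lookup_univariate:
      "Poly_Mapping.lookup (univariate R) w = (if set w \<subseteq> {0} then coeff R (length w) else 0)"
    and keys_univariate:
      "Poly_Mapping.keys (univariate R) = (\<lambda>i. replicate i 0) ` {i. coeff R i \<noteq> 0}"
proof -
  have w: "set w \<subseteq> {0} \<longleftrightarrow> w = replicate (length w) 0" for w :: "nat list"
  proof
    assume "set w \<subseteq> {0}"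
    then show "w = replicate (length w) 0" by (intro replicate_eqI) auto
  next
    assume w: "w = replicate (length w) 0"
    show "set w \<subseteq> {0}" by (subst w) auto
  qed
  have *: "{w :: nat list. (if set w \<subseteq> {0} then coeff R (length w) else 0) \<noteq> 0} = (\<lambda>i. replicate i 0) ` {i. coeff R i \<noteq> 0}"
  proof (intro set_eqI iffI)
    fix x :: "nat list" assume "x \<in> {w. (if set w \<subseteq> {0} then coeff R (length w) else 0) \<noteq> 0}"
    then have "coeff R (length x) \<noteq> 0" "set x \<subseteq> {0}" by (auto split: if_splits)
    moreover from this(2) have "x = replicate (length x) 0" by (rule iffD1[OF w])
    ultimately show "x \<in> (\<lambda>i. replicate i 0) ` {i. coeff R i \<noteq> 0}" by blast
  qed auto
  have fin: "finite {i. coeff R i \<noteq> 0}"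
    by (rule finite_subset[of _ "{..degree R}"]) (auto simp: le_degree)
  show l: "Poly_Mapping.lookup (univariate R) w = (if set w \<subseteq> {0} then coeff R (length w) else 0)" for w
    unfolding univariate_def
    by (subst Abs_poly_mapping_inverse) (use fin in \<open>simp_all add: *\<close>)
  show "Poly_Mapping.keys (univariate R) = (\<lambda>i. replicate i 0) ` {i. coeff R i \<noteq> 0}"
    unfolding Poly_Mapping.keys.rep_eq l * ..
qed

lemma univariate_in_nc_polys: "univariate R \<in> nc_polys 1"
  by (auto simp: nc_polys_def keys_univariate)

lemma subst_poly_univariate: "subst_poly (univariate R) [[:0, 1:]] = R"
proof -
  have "subst_poly (univariate R) [[:0, 1:]] = (\<Sum>i | coeff R i \<noteq> 0. smult (coeff R i) ([:0, 1:] ^ i))"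
    unfolding subst_poly_def keys_univariate
    by (subst sum.reindex) (auto simp: inj_on_def replicate_eq_replicate lookup_univariate map_replicate_const
        prod_list_replicate set_replicate_conv_if intro!: sum.cong)
  also have "\<dots> = (\<Sum>i\<le>degree R. monom (coeff R i) i)"
    by (rule sum.mono_neutral_cong_left) (auto simp: le_degree monom_altdef)
  also have "\<dots> = R" by (rule poly_as_sum_of_monoms)
  finally show ?thesis .
qed

section \<open>Injectivity of the symmetrizers\<close>

lemma sum_Pow_insert:
  fixes f :: "'a set \<Rightarrow> real"
  assumes "finite E" "e \<notin> E"
  shows "(\<Sum>A\<in>Pow (insert e E). f A) = (\<Sum>A\<in>Pow E. f A + f (insert e A))"
proof -
  have "inj_on (insert e) (Pow E)" using assms(2) by (auto simp: inj_on_def)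
  moreover have "Pow E \<inter> insert e ` Pow E = {}" using assms(2) by auto
  ultimately show ?thesis
    using assms by (simp add: Pow_insert sum.union_disjoint sum.reindex sum.distrib)
qed

text \<open>The kernel \<open>q\<^bsup>|A \<triangle> B|\<^esup>\<close> on the subsets of a finite set is the tensor power of the \<open>2 \<times> 2\<close> matrix
  with ones on the diagonal and \<open>q\<close> off the diagonal, whose smallest eigenvalue is \<open>1 - |q|\<close>.\<close>

lemma sym_diff_kernel_ge:
  fixes q :: real and x :: "'a set \<Rightarrow> real"
  assumes "finite E" "\<bar>q\<bar> < 1"
  shows "(1 - \<bar>q\<bar>) ^ card E * (\<Sum>A\<in>Pow E. (x A)\<^sup>2) \<le>
    (\<Sum>A\<in>Pow E. \<Sum>B\<in>Pow E. q ^ card (sym_diff A B) * x A * x B)"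
  using assms(1)
proof (induction E arbitrary: x rule: finite_induct)
  case empty
  then show ?case by (simp add: power2_eq_square)
next
  case (insert e E)
  define Q where "Q y z = (\<Sum>A\<in>Pow E. \<Sum>B\<in>Pow E. q ^ card (sym_diff A B) * y A * z B)" for y z :: "'a set \<Rightarrow> real"
  (* With s = sgn q, polarization turns the mixed terms into 2 q Q(x,y) = |q| (Q(x + s y) - Q(x) - Q(y)). *)
  define s where "s = (if 0 \<le> q then 1 else -1 :: real)"
  define y where "y A = x (insert e A)" for A
  define z where "z A = x A + s * y A" for A
  have card: "card (sym_diff (insert e A) (insert e B)) = card (sym_diff A B)"
    "card (sym_diff (insert e A) B) = Suc (card (sym_diff A B))"
    "card (sym_diff A (insert e B)) = Suc (card (sym_diff A B))" if "A \<in> Pow E" "B \<in> Pow E" for A B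
  proof -
    have e: "e \<notin> A" "e \<notin> B" using that insert.hyps by auto
    have "finite A" "finite B" using that finite_subset[OF _ insert.hyps(1)] by auto
    then have fin: "finite (sym_diff A B)" by simp
    have "sym_diff (insert e A) (insert e B) = sym_diff A B"
      "sym_diff (insert e A) B = insert e (sym_diff A B)"
      "sym_diff A (insert e B) = insert e (sym_diff A B)" using e by blast+
    then show "card (sym_diff (insert e A) (insert e B)) = card (sym_diff A B)"
      "card (sym_diff (insert e A) B) = Suc (card (sym_diff A B))"
      "card (sym_diff A (insert e B)) = Suc (card (sym_diff A B))"
      using e fin by simp_all
  qed
  have "(\<Sum>A\<in>Pow (insert e E). \<Sum>B\<in>Pow (insert e E). q ^ card (sym_diff A B) * x A * x B)
      = (\<Sum>A\<in>Pow E. \<Sum>B\<in>Pow E. (q ^ card (sym_diff A B) * x A * x B + q * (q ^ card (sym_diff A B) * x A * y B))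
        + (q * (q ^ card (sym_diff A B) * y A * x B) + q ^ card (sym_diff A B) * y A * y B))"
    unfolding sum_Pow_insert[OF insert.hyps] sum.distrib[symmetric]
    by (intro sum.cong refl) (simp only: card y_def power_Suc mult.assoc)
  also have "\<dots> = Q x x + q * Q x y + (q * Q y x + Q y y)"
    unfolding Q_def by (simp only: sum.distrib sum_distrib_left)
  also have "\<dots> = (1 - \<bar>q\<bar>) * (Q x x + Q y y) + \<bar>q\<bar> * Q z z"
  proof -
    have "Q z z = (\<Sum>A\<in>Pow E. \<Sum>B\<in>Pow E. (q ^ card (sym_diff A B) * x A * x B + s * (q ^ card (sym_diff A B) * x A * y B))
        + (s * (q ^ card (sym_diff A B) * y A * x B) + (s * s) * (q ^ card (sym_diff A B) * y A * y B)))"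
      unfolding Q_def z_def by (intro sum.cong refl) (simp add: algebra_simps)
    also have "\<dots> = Q x x + s * Q x y + (s * Q y x + (s * s) * Q y y)"
      unfolding Q_def by (simp only: sum.distrib sum_distrib_left)
    finally have zz: "Q z z = Q x x + s * Q x y + (s * Q y x + Q y y)" by (simp add: s_def)
    have qs: "\<bar>q\<bar> * s = q" by (simp add: s_def)
    have "Q x x + r * s * Q x y + (r * s * Q y x + Q y y) = (1 - r) * (Q x x + Q y y) + r * Q z z" for r
      unfolding zz by (simp add: algebra_simps)
    from this[of "\<bar>q\<bar>"] show ?thesis unfolding qs .
  qed
  finally have eq: "(\<Sum>A\<in>Pow (insert e E). \<Sum>B\<in>Pow (insert e E). q ^ card (sym_diff A B) * x A * x B)
      = (1 - \<bar>q\<bar>) * (Q x x + Q y y) + \<bar>q\<bar> * Q z z" .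
  have IH: "(1 - \<bar>q\<bar>) ^ card E * (\<Sum>A\<in>Pow E. (v A)\<^sup>2) \<le> Q v v" for v
    unfolding Q_def by (rule insert.IH)
  have "0 \<le> (1 - \<bar>q\<bar>) ^ card E * (\<Sum>A\<in>Pow E. (z A)\<^sup>2)"
    using assms(2) by (intro mult_nonneg_nonneg sum_nonneg) auto
  also have "\<dots> \<le> Q z z" by (rule IH)
  finally have "0 \<le> \<bar>q\<bar> * Q z z" by simp
  moreover have "(1 - \<bar>q\<bar>) * ((1 - \<bar>q\<bar>) ^ card E * (\<Sum>A\<in>Pow E. (x A)\<^sup>2) + (1 - \<bar>q\<bar>) ^ card E * (\<Sum>A\<in>Pow E. (y A)\<^sup>2))
      \<le> (1 - \<bar>q\<bar>) * (Q x x + Q y y)"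
    using assms(2) by (intro mult_left_mono add_mono IH) auto
  moreover have "(1 - \<bar>q\<bar>) ^ card (insert e E) * (\<Sum>A\<in>Pow (insert e E). (x A)\<^sup>2) =
      (1 - \<bar>q\<bar>) * ((1 - \<bar>q\<bar>) ^ card E * (\<Sum>A\<in>Pow E. (x A)\<^sup>2) + (1 - \<bar>q\<bar>) ^ card E * (\<Sum>A\<in>Pow E. (y A)\<^sup>2))"
    by (simp only: sum_Pow_insert[OF insert.hyps] sum.distrib y_def card_insert_disjoint[OF insert.hyps]
        power_Suc distrib_left mult.assoc)
  ultimately show ?case unfolding eq by linarith
qed

lemma permutes_lessThan_eq_id:
  fixes m :: nat
  assumes "\<pi> permutes {..<m}" "\<And>i j. i < j \<Longrightarrow> j < m \<Longrightarrow> \<pi> i \<le> \<pi> j"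
  shows "\<pi> = id"
proof -
  have less: "\<pi> i < \<pi> j" if "i < j" "j < m" for i j
  proof -
    have "\<pi> i \<noteq> \<pi> j" using that(1) by (auto simp: inj_eq[OF permutes_inj[OF assms(1)]])
    then show ?thesis using assms(2)[OF that] by simp
  qed
  have le: "i \<le> \<pi> i" if "i < m" for i
    using that
  proof (induction i)
    case (Suc i)
    then show ?case using less[of i "Suc i"] by linarith
  qed simp
  have "(\<Sum>i<m. \<pi> i) = (\<Sum>i<m. i)"
    using sum.permute[OF assms(1), of "\<lambda>i. i"] by (simp add: comp_def)
  then have "\<pi> i = i" if "i < m" for i
    using sum_strict_mono_ex1[of "{..<m}" "\<lambda>i. i" \<pi>] le that
    by (metis finite_lessThan lessThan_iff le_neq_implies_less less_irrefl)
  then show ?thesis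
    using permutes_not_in[OF assms(1)] by (metis eq_id_iff lessThan_iff)
qed

definition inversion_pairs :: "nat \<Rightarrow> (nat \<Rightarrow> nat) \<Rightarrow> (nat \<times> nat) set" where
  "inversion_pairs m \<sigma> = {(a, b). a < b \<and> b < m \<and> inv \<sigma> b < inv \<sigma> a}"

text \<open>A pair of positions is inverted by \<open>\<rho>\<^sup>-\<^sup>1\<sigma>\<close> if and only if \<open>\<rho>\<^sup>-\<^sup>1\<close> and \<open>\<sigma>\<^sup>-\<^sup>1\<close> order the two values of \<open>\<sigma>\<close> at
  these positions differently, that is, if the pair of values is an inversion for just one of them.\<close>

lemma inversions_eq_card_sym_diff:
  assumes \<rho>: "\<rho> permutes {..<m}" and \<sigma>: "\<sigma> permutes {..<m}"
  shows "inversions m (inv \<rho> \<circ> \<sigma>) = card (sym_diff (inversion_pairs m \<rho>) (inversion_pairs m \<sigma>))"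
proof -
  let ?L = "{(i, j). i < j \<and> j < m \<and> inv \<rho> (\<sigma> j) < inv \<rho> (\<sigma> i)}"
  let ?R = "sym_diff (inversion_pairs m \<rho>) (inversion_pairs m \<sigma>)"
  let ?f = "\<lambda>(i, j). (min (\<sigma> i) (\<sigma> j), max (\<sigma> i) (\<sigma> j))"
  let ?g = "\<lambda>(a, b). (min (inv \<sigma> a) (inv \<sigma> b), max (inv \<sigma> a) (inv \<sigma> b))"
  have \<sigma>i [simp]: "inv \<sigma> (\<sigma> i) = i" "\<sigma> (inv \<sigma> i) = i" for i
    using permutes_inverses[OF \<sigma>] by auto
  have lt: "\<sigma> i < m \<longleftrightarrow> i < m" "inv \<sigma> i < m \<longleftrightarrow> i < m" for i
    using permutes_in_image[OF \<sigma>, of i] permutes_in_image[OF permutes_inv[OF \<sigma>], of i] by auto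
  have inj: "\<sigma> i = \<sigma> j \<longleftrightarrow> i = j" "inv \<sigma> i = inv \<sigma> j \<longleftrightarrow> i = j" "inv \<rho> i = inv \<rho> j \<longleftrightarrow> i = j" for i j
    using permutes_inj[OF \<sigma>] permutes_inj[OF permutes_inv[OF \<sigma>]] permutes_inj[OF permutes_inv[OF \<rho>]]
    by (auto dest: injD)
  have "bij_betw ?f ?L ?R"
  proof (rule bij_betw_byWitness[where f' = ?g])
    show "\<forall>p\<in>?L. ?g (?f p) = p" by (auto simp: min_def max_def)
    show "\<forall>p\<in>?R. ?f (?g p) = p"
    proof
      fix p assume "p \<in> ?R"
      then obtain a b where p: "p = (a, b)" and "a < b" by (auto simp: inversion_pairs_def)
      then show "?f (?g p) = p"
        by (cases "inv \<sigma> a \<le> inv \<sigma> b") (simp_all add: min_def max_def)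
    qed
    show "?f ` ?L \<subseteq> ?R"
    proof (rule image_subsetI)
      fix p assume "p \<in> ?L"
      then obtain i j where p: "p = (i, j)" and ij: "i < j" "j < m" "inv \<rho> (\<sigma> j) < inv \<rho> (\<sigma> i)" by auto
      show "?f p \<in> ?R"
      proof (cases "\<sigma> i < \<sigma> j")
        case True
        then show ?thesis using ij lt by (simp add: p inversion_pairs_def)
      next
        case False
        then have "\<sigma> j < \<sigma> i" using ij inj(1)[of i j] by simp
        then show ?thesis using ij lt by (simp add: p inversion_pairs_def)
      qed
    qed
    show "?g ` ?R \<subseteq> ?L"
    proof (rule image_subsetI)
      fix p assume pR: "p \<in> ?R"
      then obtain a b where p: "p = (a, b)" and 1: "a < b" "b < m" by (auto simp: inversion_pairs_def)
      have ab: "(a, b) \<in> ?R" using pR p by simp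
      show "?g p \<in> ?L"
      proof (cases "inv \<sigma> a < inv \<sigma> b")
        case True
        then have "inv \<rho> b < inv \<rho> a" using ab by (auto simp: inversion_pairs_def)
        then show ?thesis using True 1 lt by (simp add: p)
      next
        case False
        then have F: "inv \<sigma> b < inv \<sigma> a" using 1 inj(2)[of a b] by simp
        then have "\<not> inv \<rho> b < inv \<rho> a" using ab 1 by (auto simp: inversion_pairs_def)
        then have "inv \<rho> a < inv \<rho> b" using 1 inj(3)[of a b] by simp
        then show ?thesis using F 1 lt by (simp add: p)
      qed
    qed
  qed
  then have "card ?L = card ?R" by (rule bij_betw_same_card)
  then show ?thesis by (simp add: inversions_def)
qed

text \<open>If \<open>\<rho>\<close> and \<open>\<sigma>\<close> have the same inversions, then \<open>\<rho>\<^sup>-\<^sup>1\<sigma>\<close> has none, so it is increasing and thus the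
  identity.\<close>

lemma inj_on_inversion_pairs: "inj_on (inversion_pairs m) {\<sigma>. \<sigma> permutes {..<m}}"
proof (rule inj_onI)
  fix \<rho> \<sigma> assume \<rho>: "\<rho> \<in> {\<sigma>. \<sigma> permutes {..<m}}" and \<sigma>: "\<sigma> \<in> {\<sigma>. \<sigma> permutes {..<m}}"
    and eq: "inversion_pairs m \<rho> = inversion_pairs m \<sigma>"
  let ?\<pi> = "inv \<rho> \<circ> \<sigma>"
  have perm: "?\<pi> permutes {..<m}" using \<rho> \<sigma> by (intro permutes_compose permutes_inv) auto
  have "inversions m ?\<pi> = 0" using inversions_eq_card_sym_diff[of \<rho> m \<sigma>] \<rho> \<sigma> eq by simp
  moreover have "finite {(i, j). i < j \<and> j < m \<and> ?\<pi> j < ?\<pi> i}"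
    by (rule finite_subset[of _ "{..<m} \<times> {..<m}"]) auto
  ultimately have "{(i, j). i < j \<and> j < m \<and> ?\<pi> j < ?\<pi> i} = {}" by (simp add: inversions_def)
  then have "?\<pi> i \<le> ?\<pi> j" if "i < j" "j < m" for i j using that by (auto simp: not_less[symmetric])
  then have "?\<pi> = id" by (rule permutes_lessThan_eq_id[OF perm])
  then have "\<rho> \<circ> ?\<pi> = \<rho>" by simp
  then show "\<rho> = \<sigma>" using permutes_inv_o(1)[of \<rho>] \<rho> by (simp add: o_assoc)
qed

text \<open>The sum in the assumption is convolution with \<open>\<Sum> q\<^bsup>i(\<pi>)\<^esup> \<pi>\<close>, so \<open>F\<close> is in the kernel of the matrix
  \<open>q\<^bsup>i(\<rho>\<^sup>-\<^sup>1\<sigma>)\<^esup>\<close>. This is a principal submatrix of the strictly positive definite kernel on sets of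
  pairs, since a permutation is determined by its inversions.\<close>

lemma inversion_kernel_injective_real:
  fixes q :: real and F :: "(nat \<Rightarrow> nat) \<Rightarrow> real"
  assumes q: "\<bar>q\<bar> < 1"
    and zero: "\<And>\<sigma>. \<sigma> permutes {..<m} \<Longrightarrow> (\<Sum>\<pi> | \<pi> permutes {..<m}. q ^ inversions m \<pi> * F (\<sigma> \<circ> inv \<pi>)) = 0"
    and \<sigma>: "\<sigma> permutes {..<m}"
  shows "F \<sigma> = 0"
proof -
  let ?S = "{\<sigma>. \<sigma> permutes {..<m}}"
  let ?A = "inversion_pairs m"
  let ?E = "{..<m} \<times> {..<m}"
  have finS: "finite ?S" by (rule finite_permutations) simp
  have inj: "inj_on ?A ?S" by (rule inj_on_inversion_pairs)
  (* F, transported to the inversion sets and extended by zero to all sets of pairs. *)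
  define x where "x C = (if C \<in> ?A ` ?S then F (inv_into ?S ?A C) else 0)" for C
  have xA: "x (?A \<rho>) = F \<rho>" if "\<rho> \<in> ?S" for \<rho>
    using that inj by (simp add: x_def)
  have sub: "?A ` ?S \<subseteq> Pow ?E" by (auto simp: inversion_pairs_def)
  have row: "(\<Sum>\<rho>\<in>?S. q ^ card (sym_diff (?A \<rho>) (?A \<sigma>)) * F \<rho>) = 0" if \<sigma>: "\<sigma> \<in> ?S" for \<sigma>
  proof -
    have "(\<Sum>\<rho>\<in>?S. q ^ card (sym_diff (?A \<rho>) (?A \<sigma>)) * F \<rho>)
        = (\<Sum>\<rho>\<in>?S. q ^ inversions m (inv \<rho> \<circ> \<sigma>) * F \<rho>)"
      using \<sigma> by (intro sum.cong refl) (simp add: inversions_eq_card_sym_diff)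
    also have "\<dots> = (\<Sum>\<pi>\<in>?S. q ^ inversions m \<pi> * F (\<sigma> \<circ> inv \<pi>))"
    proof (rule sum.reindex_bij_witness[where i = "\<lambda>\<pi>. \<sigma> \<circ> inv \<pi>" and j = "\<lambda>\<rho>. inv \<rho> \<circ> \<sigma>"])
      fix \<rho> assume \<rho>: "\<rho> \<in> ?S"
      have bij: "bij \<rho>" "bij \<sigma>" using \<rho> \<sigma> permutes_bij by auto
      have "inv (inv \<rho> \<circ> \<sigma>) = inv \<sigma> \<circ> \<rho>"
        using bij by (simp add: o_inv_distrib bij_imp_bij_inv inv_inv_eq)
      then show eq: "\<sigma> \<circ> inv (inv \<rho> \<circ> \<sigma>) = \<rho>"
        using permutes_inv_o(1)[of \<sigma>] \<sigma> by (simp add: o_assoc)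
      show "inv \<rho> \<circ> \<sigma> \<in> ?S" using \<rho> \<sigma> by (auto intro: permutes_compose permutes_inv)
      show "q ^ inversions m (inv \<rho> \<circ> \<sigma>) * F (\<sigma> \<circ> inv (inv \<rho> \<circ> \<sigma>)) = q ^ inversions m (inv \<rho> \<circ> \<sigma>) * F \<rho>"
        unfolding eq ..
    next
      fix \<pi> assume \<pi>: "\<pi> \<in> ?S"
      have bij: "bij \<pi>" "bij \<sigma>" using \<pi> \<sigma> permutes_bij by auto
      have "inv (\<sigma> \<circ> inv \<pi>) = \<pi> \<circ> inv \<sigma>"
        using bij by (simp add: o_inv_distrib bij_imp_bij_inv inv_inv_eq)
      then show "inv (\<sigma> \<circ> inv \<pi>) \<circ> \<sigma> = \<pi>"
        using permutes_inv_o(2)[of \<sigma>] \<sigma> by (simp add: o_assoc[symmetric])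
      show "\<sigma> \<circ> inv \<pi> \<in> ?S" using \<pi> \<sigma> by (auto intro: permutes_compose permutes_inv)
    qed
    also have "\<dots> = 0" using zero \<sigma> by simp
    finally show ?thesis .
  qed
  have "(\<Sum>C\<in>Pow ?E. \<Sum>D\<in>Pow ?E. q ^ card (sym_diff C D) * x C * x D)
      = (\<Sum>C\<in>?A ` ?S. \<Sum>D\<in>Pow ?E. q ^ card (sym_diff C D) * x C * x D)"
    by (rule sum.mono_neutral_right[OF _ sub]) (auto simp: x_def)
  also have "\<dots> = (\<Sum>C\<in>?A ` ?S. \<Sum>D\<in>?A ` ?S. q ^ card (sym_diff C D) * x C * x D)"
    by (intro sum.cong refl sum.mono_neutral_right[OF _ sub]) (auto simp: x_def)
  also have "\<dots> = (\<Sum>\<rho>\<in>?S. \<Sum>\<sigma>\<in>?S. q ^ card (sym_diff (?A \<rho>) (?A \<sigma>)) * F \<rho> * F \<sigma>)"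
    by (simp only: sum.reindex[OF inj] comp_def) (intro sum.cong refl, simp only: xA)
  also have "\<dots> = (\<Sum>\<sigma>\<in>?S. (\<Sum>\<rho>\<in>?S. q ^ card (sym_diff (?A \<rho>) (?A \<sigma>)) * F \<rho>) * F \<sigma>)"
    unfolding sum_distrib_right by (rule sum.swap)
  also have "\<dots> = 0" using row by simp
  finally have "(1 - \<bar>q\<bar>) ^ card ?E * (\<Sum>C\<in>Pow ?E. (x C)\<^sup>2) \<le> 0"
    using sym_diff_kernel_ge[of ?E q x] q by simp
  moreover have "0 < (1 - \<bar>q\<bar>) ^ card ?E" using q by simp
  ultimately have "(\<Sum>C\<in>Pow ?E. (x C)\<^sup>2) \<le> 0" by (simp add: mult_le_0_iff)
  then have "(\<Sum>C\<in>Pow ?E. (x C)\<^sup>2) = 0" by (simp add: antisym sum_nonneg)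
  then have "\<forall>C\<in>Pow ?E. x C = 0" by (simp add: sum_nonneg_eq_0_iff)
  then have "x (?A \<sigma>) = 0" using sub \<sigma> by blast
  then show ?thesis using xA \<sigma> by simp
qed

lemma inversion_kernel_injective:
  fixes q :: real and F :: "(nat \<Rightarrow> nat) \<Rightarrow> complex"
  assumes q: "\<bar>q\<bar> < 1"
    and zero: "\<And>\<sigma>. \<sigma> permutes {..<m} \<Longrightarrow>
      (\<Sum>\<pi> | \<pi> permutes {..<m}. of_real (q ^ inversions m \<pi>) * F (\<sigma> \<circ> inv \<pi>)) = 0"
    and \<sigma>: "\<sigma> permutes {..<m}"
  shows "F \<sigma> = 0"
proof (rule complex_eqI)
  show "Re (F \<sigma>) = Re 0"
    using inversion_kernel_injective_real[OF q _ \<sigma>, of "\<lambda>\<rho>. Re (F \<rho>)"] arg_cong[OF zero, of _ Re]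
    by simp
  show "Im (F \<sigma>) = Im 0"
    using inversion_kernel_injective_real[OF q _ \<sigma>, of "\<lambda>\<rho>. Im (F \<rho>)"] arg_cong[OF zero, of _ Im]
    by simp
qed

text \<open>The \<open>q\<close>-factorial \<open>[m]\<^sub>q!\<close>, which is the eigenvalue of \<open>P\<^sub>m\<close> at a tensor power.\<close>

definition perm_weight :: "real \<Rightarrow> nat \<Rightarrow> real" where
  "perm_weight q m = (\<Sum>\<pi> | \<pi> permutes {..<m}. q ^ inversions m \<pi>)"

lemma perm_weight_nonzero:
  assumes "\<bar>q\<bar> < 1"
  shows "perm_weight q m \<noteq> 0"
proof
  assume "perm_weight q m = 0"
  then have "(\<lambda>_ :: nat \<Rightarrow> nat. 1 :: real) id = 0"
    by (intro inversion_kernel_injective_real[where m = m, OF assms _ permutes_id]) (simp add: perm_weight_def)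
  then show False by simp
qed

text \<open>Along the orbit of a word under permutations, \<open>P\<^sub>m\<close> acts as convolution on the symmetric group.\<close>

lemma q_symmetrizer_injective:
  assumes q: "\<bar>q\<bar> < 1" and zero: "\<And>w. q_symmetrizer q \<eta> w = 0"
  shows "\<eta> w = 0"
proof -
  have "\<eta> (permute_list id w) = 0"
  proof (rule inversion_kernel_injective[where m = "length w" and F = "\<lambda>\<sigma>. \<eta> (permute_list \<sigma> w)",
        OF q _ permutes_id])
    fix \<sigma> assume \<sigma>: "\<sigma> permutes {..<length w}"
    have "(\<Sum>\<pi> | \<pi> permutes {..<length w}. of_real (q ^ inversions (length w) \<pi>) * \<eta> (permute_list (\<sigma> \<circ> inv \<pi>) w))
        = q_symmetrizer q \<eta> (permute_list \<sigma> w)"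
      unfolding q_symmetrizer_def
      by (intro sum.cong) (simp_all add: permute_list_compose permutes_inv)
    then show "(\<Sum>\<pi> | \<pi> permutes {..<length w}. of_real (q ^ inversions (length w) \<pi>) * \<eta> (permute_list (\<sigma> \<circ> inv \<pi>) w)) = 0"
      using zero by simp
  qed
  then show ?thesis by simp
qed

section \<open>Moments of the \<open>q\<close>-gaussian variable\<close>

definition tensor_power :: "('j \<Rightarrow> real) \<Rightarrow> 'j list \<Rightarrow> real" where
  "tensor_power h w = prod_list (map h w)"

lemma tensor_power_permute:
  assumes "\<pi> permutes {..<length w}"
  shows "tensor_power h (permute_list \<pi> w) = tensor_power h w"
proof -
  have "tensor_power h v = prod_mset (image_mset h (mset v))" for v
    by (simp add: tensor_power_def flip: mset_map prod_mset_prod_list)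
  then show ?thesis using assms by simp
qed

text \<open>The vector \<open>\<Sum>\<^sub>m a(m) h\<^sup>\<otimes>\<^sup>m\<close>.\<close>

definition radial :: "('j \<Rightarrow> real) \<Rightarrow> (nat \<Rightarrow> complex) \<Rightarrow> 'j list vec" where
  "radial h a = (\<lambda>w. a (length w) * of_real (tensor_power h w))"

lemma q_symmetrizer_radial:
  "q_symmetrizer q (radial h a) w = of_real (perm_weight q (length w)) * radial h a w"
proof -
  have "radial h a (permute_list (inv \<pi>) w) = radial h a w" if "\<pi> permutes {..<length w}" for \<pi>
    using tensor_power_permute[OF permutes_inv[OF that], of h] by (simp add: radial_def)
  then have "q_symmetrizer q (radial h a) w =
      (\<Sum>\<pi> | \<pi> permutes {..<length w}. of_real (q ^ inversions (length w) \<pi>) * radial h a w)"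
    unfolding q_symmetrizer_def by (intro sum.cong refl) simp
  then show ?thesis by (simp only: perm_weight_def of_real_sum sum_distrib_right)
qed

text \<open>Fubini for a product of two absolutely summable families; it serves to split words into their first
  letter and the rest.\<close>

lemma summable_product_complex:
  fixes f :: "'a \<Rightarrow> complex" and g :: "'b \<Rightarrow> complex"
  assumes "(\<lambda>x. norm (f x)) summable_on A" "(\<lambda>x. norm (g x)) summable_on B"
  shows "(\<lambda>p. norm ((\<lambda>(x, y). f x * g y) p)) summable_on A \<times> B"
    and "infsum (\<lambda>(x, y). f x * g y) (A \<times> B) = infsum f A * infsum g B"
proof -
  have g: "g summable_on B" by (rule Infinite_Sum.abs_summable_summable[OF assms(2)])
  show "(\<lambda>p. norm ((\<lambda>(x, y). f x * g y) p)) summable_on A \<times> B"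
    using assms by (subst Infinite_Sum.abs_summable_on_Sigma_iff)
      (simp add: norm_mult abs_mult summable_on_cmult_right infsum_cmult_right' summable_on_cmult_left)
  then have "(\<lambda>(x, y). f x * g y) summable_on A \<times> B" by (rule Infinite_Sum.abs_summable_summable)
  then have "infsum (\<lambda>(x, y). f x * g y) (A \<times> B) = infsum (\<lambda>x. infsum (\<lambda>y. f x * g y) B) A"
    by (rule infsum_Sigma'_banach[symmetric])
  also have "\<dots> = infsum f A * infsum g B"
    by (simp add: infsum_cmult_right' infsum_cmult_left')
  finally show "infsum (\<lambda>(x, y). f x * g y) (A \<times> B) = infsum f A * infsum g B" .
qed

abbreviation level :: "nat \<Rightarrow> 'j list set" where
  "level m \<equiv> {w. length w = m}"

lemma bij_betw_Cons_level: "bij_betw (\<lambda>(j, w). j # w) (UNIV \<times> level m) (level (Suc m))"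
  by (auto simp: bij_betw_def inj_on_def length_Suc_conv)

lemma infsum_level_Suc:
  "infsum f (level (Suc m)) = infsum (\<lambda>(j, w). f (j # w)) (UNIV \<times> level m)"
  using infsum_reindex_bij_betw[OF bij_betw_Cons_level, of f m] by (simp add: split_def)

lemma summable_level_Suc:
  "f summable_on level (Suc m) \<longleftrightarrow> (\<lambda>(j, w). f (j # w)) summable_on UNIV \<times> level m"
  using summable_on_reindex_bij_betw[OF bij_betw_Cons_level, of f m] by (simp add: split_def)

context
  fixes q :: real and h :: "'j \<Rightarrow> real"
  assumes q: "\<bar>q\<bar> < 1" and h: "((\<lambda>j. (h j)\<^sup>2) has_sum 1) UNIV"
begin

lemma h_summable: "(\<lambda>j. norm (complex_of_real ((h j)\<^sup>2))) summable_on UNIV"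
  using h by (simp add: has_sum_imp_summable norm_power)

lemma h_infsum: "infsum (\<lambda>j. complex_of_real ((h j)\<^sup>2)) UNIV = 1"
  using has_sum_of_real[OF h, where 'a = complex] by (simp add: infsumI)

lemma tensor_power_summable: "(\<lambda>w. norm (complex_of_real ((tensor_power h w)\<^sup>2))) summable_on level m"
proof (induction m)
  case 0
  then show ?case by simp
next
  case (Suc m)
  have "(\<lambda>p. norm ((\<lambda>(j, w). complex_of_real ((h j)\<^sup>2) * complex_of_real ((tensor_power h w)\<^sup>2)) p)) summable_on UNIV \<times> level m"
    by (rule summable_product_complex(1)[OF h_summable Suc.IH])
  then show ?case
    unfolding summable_level_Suc
    by (simp add: tensor_power_def power_mult_distrib split_def norm_mult)
qed

lemma level_inner_radial:
  "level_inner q m \<xi> (radial h a) =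
    cnj (a m) * of_real (perm_weight q m) * infsum (\<lambda>w. \<xi> w * of_real (tensor_power h w)) (level m)"
proof -
  have "level_inner q m \<xi> (radial h a) =
      infsum (\<lambda>w. (cnj (a m) * of_real (perm_weight q m)) * (\<xi> w * of_real (tensor_power h w))) (level m)"
    unfolding level_inner_def q_symmetrizer_radial
    by (intro infsum_cong) (simp add: radial_def)
  then show ?thesis by (simp add: infsum_cmult_right')
qed

lemma radial_square_summable: "(\<lambda>w. (cmod (radial h a w))\<^sup>2) summable_on level m"
proof -
  have "(\<lambda>w. (cmod (a m))\<^sup>2 * (tensor_power h w)\<^sup>2) summable_on level m"
    using tensor_power_summable[of m] by (intro summable_on_cmult_right) (simp add: norm_power)
  then show ?thesis
    by (rule summable_on_cong[THEN iffD1, rotated])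
      (simp add: radial_def norm_mult power_mult_distrib)
qed

lemma radial_in_q_fock:
  assumes "finite {m. a m \<noteq> 0}"
  shows "radial h a \<in> q_fock q"
  unfolding q_fock_def
proof (intro CollectI conjI allI radial_square_summable)
  show "summable (\<lambda>m. Re (level_inner q m (radial h a) (radial h a)))"
    by (rule summable_finite[OF assms]) (simp add: level_inner_radial)
qed

lemma level_inner_basis:
  "level_inner q m (\<lambda>v. if v = w then 1 else 0) \<eta> = (if m = length w then cnj (q_symmetrizer q \<eta> w) else 0)"
proof (cases "m = length w")
  case True
  have "level_inner q m (\<lambda>v. if v = w then 1 else 0) \<eta> = infsum (\<lambda>v. cnj (q_symmetrizer q \<eta> v)) {w}"
    unfolding level_inner_def by (rule infsum_cong_neutral) (auto simp: True)
  then show ?thesis by (simp add: True)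
next
  case False
  then have "level_inner q m (\<lambda>v. if v = w then 1 else 0) \<eta> = 0"
    unfolding level_inner_def by (intro infsum_0) auto
  then show ?thesis using False by simp
qed

lemma basis_in_q_fock: "(\<lambda>v. if v = w then 1 else 0) \<in> q_fock q"
  unfolding q_fock_def
proof (intro CollectI conjI allI)
  let ?d = "\<lambda>v. if v = w then 1 else 0 :: complex"
  show "(\<lambda>v. (cmod (?d v))\<^sup>2) summable_on level m" for m
    by (rule finite_nonzero_values_imp_summable_on) (rule finite_subset[of _ "{w}"], auto)
  show "summable (\<lambda>m. Re (level_inner q m ?d ?d))"
    by (rule summable_finite[of "{length w}"]) (auto simp: level_inner_basis)
qed

lemma q_inner_basis:
  "q_inner q (\<lambda>v. if v = w then 1 else 0) \<eta> = cnj (q_symmetrizer q \<eta> w)"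
  unfolding q_inner_def level_inner_basis
  by (subst suminf_finite[of "{length w}"]) auto

text \<open>Testing against the words as basis vectors gives the values of \<open>P\<^sub>m \<zeta>\<close>, so injectivity of the
  symmetrizers makes adjoints unique.\<close>

lemma q_inner_nondegenerate:
  assumes "\<And>\<xi>. \<xi> \<in> q_fock q \<Longrightarrow> q_inner q \<xi> \<zeta> = q_inner q \<xi> \<zeta>'"
  shows "\<zeta> = \<zeta>'"
proof
  fix w
  have "cnj (q_symmetrizer q \<zeta> v) = cnj (q_symmetrizer q \<zeta>' v)" for v
    using assms[OF basis_in_q_fock[of v]] unfolding q_inner_basis .
  then have "q_symmetrizer q \<zeta> v = q_symmetrizer q \<zeta>' v" for v by simp
  then have "q_symmetrizer q (\<lambda>u. \<zeta> u - \<zeta>' u) v = 0" for v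
    by (simp add: q_symmetrizer_def right_diff_distrib sum_subtractf)
  from q_symmetrizer_injective[OF q this] show "\<zeta> w = \<zeta>' w" by simp
qed

text \<open>Splitting off the first letter of a word leaves the factor \<open>\<Sum> h\<^sub>j\<^sup>2 = 1\<close>.\<close>

lemma creation_infsum:
  assumes "\<xi> \<in> q_fock q"
  shows "infsum (\<lambda>w. creation h \<xi> w * of_real (tensor_power h w)) (level (Suc m)) =
    infsum (\<lambda>w. \<xi> w * of_real (tensor_power h w)) (level m)"
proof -
  have "(\<lambda>w. norm (\<xi> w * \<xi> w)) summable_on level m"
    using assms by (simp add: q_fock_def norm_mult power2_eq_square)
  moreover have "(\<lambda>w. norm (complex_of_real (tensor_power h w) * complex_of_real (tensor_power h w))) summable_on level m"
    using tensor_power_summable[of m] by (simp add: power2_eq_square)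
  ultimately have abs: "(\<lambda>w. norm (\<xi> w * of_real (tensor_power h w))) summable_on level m"
    by (rule Infinite_Sum.abs_summable_product)
  have "infsum (\<lambda>w. creation h \<xi> w * of_real (tensor_power h w)) (level (Suc m)) =
      infsum (\<lambda>(j, w). of_real ((h j)\<^sup>2) * (\<xi> w * of_real (tensor_power h w))) (UNIV \<times> level m)"
    unfolding infsum_level_Suc
    by (intro infsum_cong) (auto simp: tensor_power_def power2_eq_square)
  also have "\<dots> = infsum (\<lambda>w. \<xi> w * of_real (tensor_power h w)) (level m)"
    unfolding summable_product_complex(2)[OF h_summable abs] h_infsum by simp
  finally show ?thesis .
qed

text \<open>On the tensor powers the annihilation operator acts by \<open>h\<^bsup>\<otimes>(m+1)\<^esup> \<mapsto> [m+1]\<^sub>q h\<^bsup>\<otimes>m\<^esup>\<close>; here the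
  \<open>q\<close>-integer appears as a quotient of the eigenvalues of two consecutive symmetrizers.\<close>

lemma adjoint_creation_radial:
  assumes a: "finite {m. a m \<noteq> 0}"
  shows "adjoint_on (q_fock q) (q_inner q) (creation h) (radial h a) =
    radial h (\<lambda>m. of_real (perm_weight q (Suc m) / perm_weight q m) * a (Suc m))"
    (is "_ = radial h ?b")
proof -
  have "finite {m. a (Suc m) \<noteq> 0}"
    using finite_vimageI[OF a, of Suc] by (simp add: vimage_def)
  then have b: "finite {m. ?b m \<noteq> 0}" by (rule rev_finite_subset) auto
  have eq: "q_inner q (creation h \<xi>) (radial h a) = q_inner q \<xi> (radial h ?b)" if \<xi>: "\<xi> \<in> q_fock q" for \<xi>
  proof -
    have 0: "level_inner q 0 (creation h \<xi>) (radial h a) = 0"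
      by (simp add: level_inner_def)
    have Suc: "level_inner q (Suc m) (creation h \<xi>) (radial h a) = level_inner q m \<xi> (radial h ?b)" for m
      using perm_weight_nonzero[OF q, of m]
      by (simp add: level_inner_radial creation_infsum[OF \<xi>])
    have "summable (\<lambda>m. level_inner q m (creation h \<xi>) (radial h a))"
      by (rule summable_finite[OF a]) (simp add: level_inner_radial)
    from suminf_split_head[OF this] have "q_inner q (creation h \<xi>) (radial h a) = suminf (\<lambda>m. level_inner q (Suc m) (creation h \<xi>) (radial h a))"
      using 0 by (simp add: q_inner_def)
    then show ?thesis by (simp add: Suc q_inner_def)
  qed
  show ?thesis
    unfolding adjoint_on_def
  proof (rule the_equality)
    show "radial h ?b \<in> q_fock q \<and> (\<forall>\<xi>\<in>q_fock q. q_inner q (creation h \<xi>) (radial h a) = q_inner q \<xi> (radial h ?b))"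
      using radial_in_q_fock[OF b] eq by blast
    fix \<zeta> assume \<zeta>: "\<zeta> \<in> q_fock q \<and> (\<forall>\<xi>\<in>q_fock q. q_inner q (creation h \<xi>) (radial h a) = q_inner q \<xi> \<zeta>)"
    show "\<zeta> = radial h ?b"
      by (rule q_inner_nondegenerate) (use \<zeta> eq in simp)
  qed
qed

definition radial_space :: "'j list vec set" where
  "radial_space = radial h ` {a. finite {m. a m \<noteq> 0}}"

text \<open>The action of \<open>G\<^sub>q\<close> on coefficients with respect to the tensor powers of \<open>h\<close>: a Jacobi matrix.\<close>

definition gaussian_shift :: "(nat \<Rightarrow> complex) \<Rightarrow> nat \<Rightarrow> complex" where
  "gaussian_shift a m = (if m = 0 then 0 else a (m - 1)) +
     of_real (perm_weight q (Suc m) / perm_weight q m) * a (Suc m)"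

lemma q_gaussian_op_radial:
  assumes "finite {m. a m \<noteq> 0}"
  shows "q_gaussian_op q h (radial h a) = radial h (gaussian_shift a)"
proof
  fix w
  show "q_gaussian_op q h (radial h a) w = radial h (gaussian_shift a) w"
    unfolding q_gaussian_op_def adjoint_creation_radial[OF assms]
    by (cases w) (simp_all add: radial_def gaussian_shift_def tensor_power_def algebra_simps)
qed

lemma radial_add: "(\<lambda>w. radial h a w + radial h b w) = radial h (\<lambda>m. a m + b m)"
  by (simp add: radial_def distrib_right)

lemma radial_scale: "(\<lambda>w. c * radial h a w) = radial h (\<lambda>m. c * a m)"
  by (simp add: radial_def mult.assoc)

lemma finite_support_add:
  fixes a b :: "nat \<Rightarrow> complex"
  assumes "finite {m. a m \<noteq> 0}" "finite {m. b m \<noteq> 0}"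
  shows "finite {m. a m + b m \<noteq> 0}"
  by (rule finite_subset[OF _ finite_UnI[OF assms]]) auto

lemma q_gaussian_op_linear: "linear_on_subspace radial_space (q_gaussian_op q h)"
  unfolding linear_on_subspace_def
proof (intro conjI ballI allI)
  have scale: "finite {m. c * a m \<noteq> 0}" if "finite {m. a m \<noteq> 0}" for a :: "nat \<Rightarrow> complex" and c
    by (rule finite_subset[OF _ that]) auto
  show "lin_subspace radial_space"
    unfolding lin_subspace_def
  proof (intro conjI ballI allI)
    have "(\<lambda>_. 0) = radial h (\<lambda>_. 0)" by (simp add: radial_def)
    then show "(\<lambda>_. 0) \<in> radial_space" by (auto simp: radial_space_def)
  qed (auto simp: radial_space_def radial_add radial_scale intro!: imageI finite_support_add scale)
  fix x assume "x \<in> radial_space"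
  then obtain a where x: "x = radial h a" and a: "finite {m. a m \<noteq> 0}" by (auto simp: radial_space_def)
  have "finite {m. a (Suc m) \<noteq> 0}"
    using finite_vimageI[OF a, of Suc] by (simp add: vimage_def)
  then have "finite {m. of_real (perm_weight q (Suc m) / perm_weight q m) * a (Suc m) \<noteq> 0}"
    by (rule rev_finite_subset) auto
  moreover have "finite {m. (if m = 0 then 0 else a (m - 1)) \<noteq> 0}"
    by (rule finite_subset[OF _ finite_imageI[OF a, of Suc]]) (auto simp: image_iff split: if_splits intro!: exI[of _ "_ - 1"])
  ultimately have "finite {m. gaussian_shift a m \<noteq> 0}"
    unfolding gaussian_shift_def by (intro finite_support_add)
  then show "q_gaussian_op q h x \<in> radial_space"
    by (auto simp: x q_gaussian_op_radial[OF a] radial_space_def)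
  show "q_gaussian_op q h (\<lambda>b. c * x b) = (\<lambda>b. c * q_gaussian_op q h x b)" for c
    unfolding x radial_scale q_gaussian_op_radial[OF a] q_gaussian_op_radial[OF scale[OF a]]
    by (intro arg_cong[of _ _ "radial h"] ext) (simp add: gaussian_shift_def algebra_simps)
  fix y assume "y \<in> radial_space"
  then obtain b where y: "y = radial h b" and b: "finite {m. b m \<noteq> 0}" by (auto simp: radial_space_def)
  show "q_gaussian_op q h (\<lambda>w. x w + y w) = (\<lambda>w. q_gaussian_op q h x w + q_gaussian_op q h y w)"
    unfolding x y radial_add q_gaussian_op_radial[OF a] q_gaussian_op_radial[OF b]
      q_gaussian_op_radial[OF finite_support_add[OF a b]]
    by (intro arg_cong[of _ _ "radial h"] ext) (simp add: gaussian_shift_def algebra_simps add_divide_distrib)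
qed

lemma vacuum_in_radial_space: "vacuum \<in> radial_space"
proof -
  have "vacuum = radial h (\<lambda>m. if m = 0 then 1 else 0)"
    by (auto simp: vacuum_def radial_def tensor_power_def fun_eq_iff)
  then show ?thesis by (auto simp: radial_space_def)
qed

end

text \<open>The joint moments of polynomials in \<open>G\<^sub>q\<close> are determined by the moments of \<open>G\<^sub>q\<close>, which is what the
  convergence in distribution of a single sequence of operators controls.\<close>

lemma q_gaussian_moment_univariate:
  fixes h :: "'j \<Rightarrow> real"
  assumes h: "((\<lambda>j. (h j)\<^sup>2) has_sum 1) UNIV" and P: "P \<in> nc_polys (length ps)"
  shows "q_gaussian_moment q h ps P = q_gaussian_moment q h [[:0, 1:]] (univariate (subst_poly P ps))"
proof (cases "\<bar>q\<bar> < 1")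
  case True
  have "nc_eval_op P (map (\<lambda>p. op_poly p (q_gaussian_op q h)) ps) vacuum =
      op_poly (subst_poly P ps) (q_gaussian_op q h) vacuum"
    by (rule nc_eval_op_poly[OF q_gaussian_op_linear[OF True h] vacuum_in_radial_space[OF True h] P])
  moreover have "nc_eval_op (univariate (subst_poly P ps)) (map (\<lambda>p. op_poly p (q_gaussian_op q h)) [[:0, 1:]]) vacuum =
      op_poly (subst_poly P ps) (q_gaussian_op q h) vacuum"
    using nc_eval_op_poly[OF q_gaussian_op_linear[OF True h] vacuum_in_radial_space[OF True h],
        of "univariate (subst_poly P ps)" "[[:0, 1:]]"] univariate_in_nc_polys[of "subst_poly P ps"]
    by (simp add: subst_poly_univariate)
  ultimately show ?thesis using True by (simp add: q_gaussian_moment_def vacuum_state_def)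
next
  case False
  have "nc_eval_scalar P (map (\<lambda>p. poly p z) ps) =
      nc_eval_scalar (univariate (subst_poly P ps)) (map (\<lambda>p. poly p z) [[:0, 1:]])" for z
    using nc_eval_scalar_subst_poly[OF P] nc_eval_scalar_subst_poly[of "univariate (subst_poly P ps)" "[[:0, 1:]]"]
      univariate_in_nc_polys[of "subst_poly P ps"]
    by (simp add: subst_poly_univariate)
  then show ?thesis using False by (simp add: q_gaussian_moment_def)
qed

section \<open>Spectral theorem in finite dimension\<close>

definition supported_on :: "'b set \<Rightarrow> 'b vec set" where
  "supported_on F = {x. \<forall>A. A \<notin> F \<longrightarrow> x A = 0}"

definition l2_inner :: "'b set \<Rightarrow> 'b vec \<Rightarrow> 'b vec \<Rightarrow> complex" where
  "l2_inner F x y = (\<Sum>A\<in>F. x A * cnj (y A))"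

lemma lin_subspace_supported_on: "lin_subspace (supported_on F)"
  by (auto simp: lin_subspace_def supported_on_def)

lemma l2_inner_sum_left: "l2_inner F (\<lambda>b. \<Sum>i\<in>T. c i * f i b) y = (\<Sum>i\<in>T. c i * l2_inner F (f i) y)"
  unfolding l2_inner_def sum_distrib_left sum_distrib_right
  by (subst sum.swap) (simp add: mult.assoc)

lemma l2_inner_scale_left: "l2_inner F (\<lambda>b. c * x b) y = c * l2_inner F x y"
  by (simp add: l2_inner_def sum_distrib_left mult.assoc)

lemma l2_inner_diff_left: "l2_inner F (\<lambda>b. x b - z b) y = l2_inner F x y - l2_inner F z y"
  by (simp add: l2_inner_def sum_subtractf left_diff_distrib)

lemma l2_inner_commute: "l2_inner F x y = cnj (l2_inner F y x)"
  by (simp add: l2_inner_def mult.commute)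

lemma l2_inner_scale_right: "l2_inner F x (\<lambda>b. c * y b) = cnj c * l2_inner F x y"
  by (simp add: l2_inner_def sum_distrib_left mult_ac)

lemma l2_inner_diff_right: "l2_inner F x (\<lambda>b. y b - z b) = l2_inner F x y - l2_inner F x z"
  by (simp add: l2_inner_def sum_subtractf right_diff_distrib)

lemma l2_inner_self: "l2_inner F x x = of_real (\<Sum>A\<in>F. (cmod (x A))\<^sup>2)"
  unfolding l2_inner_def of_real_sum by (rule sum.cong) (simp_all only: complex_norm_square)

lemma l2_inner_self_eq_0:
  assumes "finite F" "x \<in> supported_on F" "l2_inner F x x = 0"
  shows "x = (\<lambda>_. 0)"
proof
  fix A
  have "(\<Sum>A\<in>F. (cmod (x A))\<^sup>2) = 0"
    using assms(3) by (simp only: l2_inner_self of_real_eq_0_iff)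
  then have "\<forall>A\<in>F. x A = 0" using assms(1) by (simp add: sum_nonneg_eq_0_iff)
  then show "x A = 0" using assms(2) by (cases "A \<in> F") (auto simp: supported_on_def)
qed

definition selfadjoint_on :: "'b set \<Rightarrow> 'b oper \<Rightarrow> bool" where
  "selfadjoint_on F S \<longleftrightarrow> (\<forall>x\<in>supported_on F. S x \<in> supported_on F) \<and>
     (\<forall>x\<in>supported_on F. \<forall>y\<in>supported_on F. l2_inner F (S x) y = l2_inner F x (S y))"

lemma eigenspaces_orthogonal:
  assumes "selfadjoint_on F S"
    and "x \<in> eigenspace_on (supported_on F) S s" "y \<in> eigenspace_on (supported_on F) S t" "s \<noteq> t"
  shows "l2_inner F x y = 0"
proof -
  have "of_real s * l2_inner F x y = l2_inner F (S x) y"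
    using assms(2) by (simp add: eigenspace_on_def l2_inner_scale_left)
  also have "\<dots> = l2_inner F x (S y)"
    using assms(1-3) unfolding selfadjoint_on_def eigenspace_on_def by blast
  also have "\<dots> = of_real t * l2_inner F x y"
    using assms(3) by (simp add: eigenspace_on_def l2_inner_scale_right)
  finally show ?thesis using assms(4) by simp
qed

text \<open>Gaussian elimination: a nonzero coordinate of one of the vectors is used to clear this coordinate in
  the others.\<close>

lemma linear_dependence:
  fixes v :: "'i \<Rightarrow> 'b vec"
  assumes "finite F" "finite N" "card F < card N"
  shows "\<exists>c. (\<exists>i\<in>N. c i \<noteq> 0) \<and> (\<forall>A\<in>F. (\<Sum>i\<in>N. c i * v i A) = 0)"
  using assms
proof (induction F arbitrary: N v rule: finite_induct)
  case empty
  then have "N \<noteq> {}" by auto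
  then show ?case by (intro exI[of _ "\<lambda>_. 1"]) auto
next
  case (insert a F)
  show ?case
  proof (cases "\<forall>i\<in>N. v i a = 0")
    case True
    obtain c where "\<exists>i\<in>N. c i \<noteq> 0" "\<forall>A\<in>F. (\<Sum>i\<in>N. c i * v i A) = 0"
      using insert.IH[of N v] insert.prems insert.hyps by auto
    then show ?thesis using True by (intro exI[of _ c]) auto
  next
    case False
    then obtain j where j: "j \<in> N" "v j a \<noteq> 0" by blast
    define v' where "v' i A = v i A - v i a / v j a * v j A" for i A
    obtain c where c: "\<exists>i\<in>N - {j}. c i \<noteq> 0" "\<forall>A\<in>F. (\<Sum>i\<in>N - {j}. c i * v' i A) = 0"
    proof -
      have "card F < card (N - {j})" using insert.prems insert.hyps j by auto
      then show ?thesis using that insert.IH[of "N - {j}" v'] insert.prems(1) by blast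
    qed
    define d where "d = (\<lambda>i. if i = j then - (\<Sum>i\<in>N - {j}. c i * v i a) / v j a else c i)"
    have eq: "(\<Sum>i\<in>N. d i * v i A) = (\<Sum>i\<in>N - {j}. c i * v' i A)" for A
    proof -
      have "(\<Sum>i\<in>N. d i * v i A) = d j * v j A + (\<Sum>i\<in>N - {j}. c i * v i A)"
        using j insert.prems by (subst sum.remove[of _ j]) (auto simp: d_def intro!: sum.cong)
      then show ?thesis
        by (simp add: v'_def d_def right_diff_distrib sum_subtractf sum_distrib_right sum_divide_distrib mult.assoc)
    qed
    have "v' i a = 0" for i using j by (simp add: v'_def)
    then have "\<forall>A\<in>insert a F. (\<Sum>i\<in>N. d i * v i A) = 0" using c(2) unfolding eq by simp
    moreover have "\<exists>i\<in>N. d i \<noteq> 0" using c(1) by (auto simp: d_def)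
    ultimately show ?thesis by blast
  qed
qed

text \<open>A polynomial relation \<open>p(S) x = 0\<close> lets the roots of \<open>p\<close> be split off one at a time. If
  \<open>(S - \<lambda>) x\<close> is already a sum of eigenvectors, every component at an eigenvalue other than \<open>\<lambda>\<close>
  can be divided by the difference of the eigenvalues; self-adjointness excludes a component at
  \<open>\<lambda>\<close> itself, as this would be a Jordan block.\<close>

lemma eigenvector_decomposition_of_annihilated:
  assumes F: "finite F" and lin: "linear_on_subspace (supported_on F) S" and sa: "selfadjoint_on F S"
    and "x \<in> supported_on F" "p \<noteq> 0" "op_poly p S x = (\<lambda>_. 0)"
  shows "\<exists>T e. finite T \<and> (\<forall>t. e t \<in> eigenspace_on (supported_on F) S t) \<and> x = (\<lambda>b. \<Sum>t\<in>T. e t b)"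
  using assms(4-6)
proof (induction "degree p" arbitrary: p x)
  case 0
  then obtain a where "p = [:a:]" "a \<noteq> 0" by (metis degree_eq_zeroE pCons_0_0)
  then have "x = (\<lambda>_. 0)"
    using "0.prems"(3) by (simp add: op_poly_def op_sum_def fun_eq_iff)
  moreover have "(\<lambda>_. 0) \<in> eigenspace_on (supported_on F) S t" for t
    using linear_on_subspace_zero[OF lin] by (simp add: eigenspace_on_def supported_on_def)
  ultimately show ?case
    by (intro exI[of _ "{}"] exI[of _ "\<lambda>_ _. 0"]) simp
next
  case (Suc d)
  let ?V = "supported_on F"
  have V: "lin_subspace ?V" by (rule lin_subspace_supported_on)
  obtain z where "poly p z = 0"
    using Suc.hyps(2) fundamental_theorem_of_algebra[of p] constant_degree[of p] by auto
  then have "[:- z, 1:] dvd p" by (simp only: poly_eq_0_iff_dvd)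
  then obtain p' where p: "p = p' * [:- z, 1:]" unfolding dvd_def by (auto simp only: mult.commute)
  define u where "u = op_poly [:- z, 1:] S x"
  have u_apply: "u = (\<lambda>b. S x b - z * x b)"
    unfolding u_def using op_poly_add[of "[:0, 1:]" "[:- z:]" S x]
    by (simp add: op_poly_x[OF lin Suc.prems(1)]) (simp add: op_poly_def op_sum_def)
  have p': "p' \<noteq> 0" "degree p' = d"
  proof -
    show "p' \<noteq> 0" using p Suc.prems(2) by auto
    then show "degree p' = d"
      using Suc.hyps(2) degree_mult_eq[of p' "[:- z, 1:]"] unfolding p by simp
  qed
  have uV: "u \<in> ?V" unfolding u_def by (rule op_poly_in_subspace[OF lin Suc.prems(1)])
  have "op_poly p' S u = (\<lambda>_. 0)"
    using Suc.prems(3) op_poly_mult[OF lin Suc.prems(1), of p' "[:- z, 1:]"] p u_def by simp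
  from Suc.hyps(1)[OF p'(2)[symmetric] uV p'(1) this]
  obtain T e where T: "finite T" and e: "\<And>t. e t \<in> eigenspace_on ?V S t"
    and u: "u = (\<lambda>b. \<Sum>t\<in>T. e t b)" by blast
  have eV: "e t \<in> ?V" and Se: "S (e t) = (\<lambda>b. of_real t * e t b)" for t
    using e[of t] by (auto simp: eigenspace_on_def)
  define T' where "T' = {t\<in>T. of_real t \<noteq> z}"
  (* Removing these components from x leaves a vector that S - z sends to the z-component w of u. *)
  define y where "y = (\<lambda>b. x b + (\<Sum>t\<in>T'. (- 1 / (of_real t - z)) * e t b))"
  have sumV: "(\<lambda>b. \<Sum>t\<in>T'. (- 1 / (of_real t - z)) * e t b) \<in> ?V"
    by (rule lin_subspace_sum[OF V]) (rule eV)
  then have yV: "y \<in> ?V"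
    using V Suc.prems(1) by (simp add: y_def lin_subspace_def)
  define w where "w = (\<lambda>b. \<Sum>t\<in>T - T'. e t b)"
  have "S y = (\<lambda>b. S x b + (\<Sum>t\<in>T'. (- 1 / (of_real t - z)) * S (e t) b))"
  proof -
    have "S y = (\<lambda>b. S x b + S (\<lambda>b. \<Sum>t\<in>T'. (- 1 / (of_real t - z)) * e t b) b)"
      unfolding y_def by (rule linear_on_subspace_add[OF lin Suc.prems(1) sumV])
    then show ?thesis by (simp only: linear_on_subspace_sum[OF lin eV])
  qed
  then have "S y b - z * y b = u b - (\<Sum>t\<in>T'. e t b)" for b
  proof -
    assume "S y = (\<lambda>b. S x b + (\<Sum>t\<in>T'. (- 1 / (of_real t - z)) * S (e t) b))"
    then have "S y b - z * y b = u b + ((\<Sum>t\<in>T'. (- 1 / (of_real t - z)) * (of_real t * e t b))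
        - z * (\<Sum>t\<in>T'. (- 1 / (of_real t - z)) * e t b))"
      unfolding u_apply y_def by (simp only: Se) (simp only: algebra_simps)
    also have "(\<Sum>t\<in>T'. (- 1 / (of_real t - z)) * (of_real t * e t b))
        - z * (\<Sum>t\<in>T'. (- 1 / (of_real t - z)) * e t b)
        = (\<Sum>t\<in>T'. (- 1 / (of_real t - z)) * ((of_real t - z) * e t b))"
      by (simp only: sum_distrib_left sum_subtractf[symmetric]) (simp only: algebra_simps)
    also have "(\<Sum>t\<in>T'. (- 1 / (of_real t - z)) * ((of_real t - z) * e t b)) = (\<Sum>t\<in>T'. - e t b)"
      by (rule sum.cong) (auto simp: T'_def)
    finally show ?thesis by (simp add: sum_negf)
  qed
  then have Sy: "S y b = z * y b + w b" for b
    using T unfolding u w_def by (subst (asm) sum.subset_diff[of T' T]) (auto simp: T'_def algebra_simps)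
  have w0: "w = (\<lambda>_. 0)"
  proof (cases "\<exists>s\<in>T. of_real s = z")
    case True
    then obtain s where s: "s \<in> T" "of_real s = z" by blast
    have "T - T' = {s}" using s by (auto simp: T'_def)
    then have w: "w = e s" by (simp add: w_def)
    have "w = (\<lambda>b. S y b - of_real s * y b)" using Sy s by (auto simp: fun_eq_iff)
    then have "l2_inner F w (e s) = l2_inner F (S y) (e s) - of_real s * l2_inner F y (e s)"
      by (simp add: l2_inner_diff_left l2_inner_scale_left)
    also have "l2_inner F (S y) (e s) = l2_inner F y (S (e s))"
      using sa yV eV by (simp add: selfadjoint_on_def)
    finally have "l2_inner F (e s) (e s) = 0" by (simp add: Se l2_inner_scale_right w)
    then show ?thesis using l2_inner_self_eq_0[OF F eV] w by simp
  next
    case False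
    then have "T - T' = {}" by (auto simp: T'_def)
    then show ?thesis unfolding w_def by (simp only: sum.empty)
  qed
  have Sy: "S y = (\<lambda>b. z * y b)" using Sy w0 by auto
  have x: "x = (\<lambda>b. y b + (\<Sum>t\<in>T'. (1 / (of_real t - z)) * e t b))"
    by (simp add: y_def sum_negf)
  have e': "(\<lambda>b. c * e t b) \<in> eigenspace_on ?V S t" for c t
    using lin eV[of t] Se[of t]
    by (auto simp: eigenspace_on_def linear_on_subspace_def lin_subspace_def mult_ac)
  show ?case
  proof (cases "y = (\<lambda>_. 0)")
    case True
    have "x = (\<lambda>b. \<Sum>t\<in>T'. (1 / (of_real t - z)) * e t b)" using x True by simp
    moreover have "finite T'" using T by (simp add: T'_def)
    ultimately show ?thesis
      using e' by (intro exI[of _ T'] exI[of _ "\<lambda>t b. (1 / (of_real t - z)) * e t b"] conjI allI)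
  next
    case False
    have "z * l2_inner F y y = l2_inner F (S y) y" by (simp add: Sy l2_inner_scale_left)
    also have "\<dots> = l2_inner F y (S y)" using sa yV by (simp add: selfadjoint_on_def)
    also have "\<dots> = cnj z * l2_inner F y y" by (simp add: Sy l2_inner_scale_right)
    finally have "z = cnj z" using False l2_inner_self_eq_0[OF F yV] by auto
    then obtain r where r: "z = of_real r" by (metis Reals_cnj_iff Reals_cases)
    define e1 where "e1 = (\<lambda>t b. if t = r then y b else (1 / (of_real t - z)) * e t b)"
    have rT: "r \<notin> T'" by (simp add: T'_def r)
    have "e1 t \<in> eigenspace_on ?V S t" for t
      unfolding e1_def using e'[of "1 / (of_real t - z)" t] Sy yV r
      by (cases "t = r") (auto simp: eigenspace_on_def)
    moreover have "x = (\<lambda>b. \<Sum>t\<in>insert r T'. e1 t b)"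
    proof -
      have "(\<Sum>t\<in>T'. e1 t b) = (\<Sum>t\<in>T'. (1 / (of_real t - z)) * e t b)" for b
        by (rule sum.cong) (use rT in \<open>auto simp: e1_def\<close>)
      then show ?thesis using rT T by (subst x) (simp add: T'_def e1_def)
    qed
    ultimately show ?thesis using T by (intro exI[of _ "insert r T'"] exI[of _ e1]) (simp add: T'_def)
  qed
qed

text \<open>More powers \<open>S\<^sup>i x\<close> than there are coordinates satisfy a linear relation, which is a polynomial that
  annihilates \<open>x\<close>.\<close>

lemma eigenvector_decomposition:
  assumes F: "finite F" and lin: "linear_on_subspace (supported_on F) S" and sa: "selfadjoint_on F S"
    and x: "x \<in> supported_on F"
  shows "\<exists>T e. finite T \<and> (\<forall>t. e t \<in> eigenspace_on (supported_on F) S t) \<and> x = (\<lambda>b. \<Sum>t\<in>T. e t b)"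
proof -
  obtain c where c: "\<exists>i\<in>{..card F}. c i \<noteq> 0" "\<forall>A\<in>F. (\<Sum>i\<le>card F. c i * (S ^^ i) x A) = 0"
    using linear_dependence[OF F, of "{..card F}" "\<lambda>i. (S ^^ i) x"] by auto
  define p where "p = (\<Sum>i\<le>card F. monom (c i) i)"
  have coeff: "coeff p i = (if i \<le> card F then c i else 0)" for i
    by (simp add: p_def coeff_sum)
  have deg: "degree p \<le> card F" by (rule degree_le) (simp add: coeff)
  have "p \<noteq> 0" using c(1) coeff by (metis atMost_iff coeff_0)
  moreover have "op_poly p S x = (\<lambda>_. 0)"
  proof
    fix A
    show "op_poly p S x A = 0"
    proof (cases "A \<in> F")
      case True
      then show ?thesis using c(2) by (simp add: op_poly_bound[OF deg] coeff)
    next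
      case False
      then show ?thesis using op_poly_in_subspace[OF lin x, of p] by (simp add: supported_on_def)
    qed
  qed
  ultimately show ?thesis
    using eigenvector_decomposition_of_annihilated[OF F lin sa x] by blast
qed


text \<open>Whenever a finite family of maps into the eigenspaces decomposes every vector, these maps are the
  spectral projections: orthogonality of the eigenspaces leaves no other eigenvalue and no other
  choice of the components.\<close>

lemma fun_calc_of_decomposition:
  fixes e :: "real \<Rightarrow> 'b oper" and F :: "'b set"
  defines "V \<equiv> supported_on F"
  assumes F: "finite F" and T: "finite T" and sa: "selfadjoint_on F S"
    and e: "\<And>t x. x \<in> V \<Longrightarrow> e t x \<in> eigenspace_on V S t"
    and dec: "\<And>x. x \<in> V \<Longrightarrow> x = (\<lambda>b. \<Sum>t\<in>T. e t x b)"
    and x: "x \<in> V"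
  shows "fun_calc V (l2_inner F) f S x = (\<lambda>b. \<Sum>t\<in>T. of_real (f t) * e t x b)"
proof -
  let ?E = "eigenspace_on V S"
  have eV: "e t x \<in> V" if "x \<in> V" for t x
    using e[OF that, of t] by (simp add: eigenspace_on_def)
  have EV: "y \<in> V" if "y \<in> ?E t" for y t using that by (simp add: eigenspace_on_def)
  have zero: "y = (\<lambda>_. 0)" if "y \<in> V" "l2_inner F y y = 0" for y
    using l2_inner_self_eq_0[OF F] that by (simp add: V_def)
  have orth: "l2_inner F y z = 0" if "y \<in> ?E s" "z \<in> ?E t" "s \<noteq> t" for y z s t
    using eigenspaces_orthogonal[OF sa] that by (simp add: V_def)
  have expand: "l2_inner F x y = (\<Sum>t\<in>T. l2_inner F (e t x) y)" if "x \<in> V" for x y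
    using arg_cong[OF dec[OF that], of "\<lambda>z. l2_inner F z y"] l2_inner_sum_left[of F "\<lambda>_. 1" "\<lambda>t. e t x" T y]
    by simp
  define spec where "spec = {t. ?E t \<noteq> {\<lambda>_. 0}}"
  have Et: "?E t = {\<lambda>_. 0}" if "t \<notin> spec" for t using that by (simp add: spec_def)
  have "spec \<subseteq> T"
  proof (rule ccontr)
    assume "\<not> spec \<subseteq> T"
    then obtain t where t: "t \<in> spec" "t \<notin> T" by blast
    have "y = (\<lambda>_. 0)" if y: "y \<in> ?E t" for y
    proof (rule zero[OF EV[OF y]])
      show "l2_inner F y y = 0"
        unfolding expand[OF EV[OF y], of y] using t(2)
        by (intro sum.neutral ballI orth[OF e[OF EV[OF y]] y]) auto
    qed
    moreover have "?E t \<noteq> {}" using e[OF x, of t] by blast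
    ultimately have "?E t = {\<lambda>_. 0}" by auto
    then show False using t(1) by (simp add: spec_def)
  qed
  have proj: "orth_proj (l2_inner F) (?E t) x = e t x" if t: "t \<in> T" for t
    unfolding orth_proj_def
  proof (rule the_equality)
    have "l2_inner F (\<lambda>b. x b - e t x b) w = 0" if w: "w \<in> ?E t" for w
    proof -
      have "l2_inner F x w = l2_inner F (e t x) w + (\<Sum>s\<in>T - {t}. l2_inner F (e s x) w)"
        unfolding expand[OF x] using T t by (rule sum.remove)
      also have "(\<Sum>s\<in>T - {t}. l2_inner F (e s x) w) = 0"
        by (intro sum.neutral ballI orth[OF e[OF x] w]) auto
      finally show ?thesis by (simp add: l2_inner_diff_left)
    qed
    then show *: "e t x \<in> ?E t \<and> (\<forall>w\<in>?E t. l2_inner F (\<lambda>b. x b - e t x b) w = 0)"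
      using e[OF x] by blast
    fix y assume y: "y \<in> ?E t \<and> (\<forall>w\<in>?E t. l2_inner F (\<lambda>b. x b - y b) w = 0)"
    define d where "d = (\<lambda>b. y b - e t x b)"
    have "l2_inner F d w = 0" if "w \<in> ?E t" for w
      using * y that by (auto simp: d_def l2_inner_diff_left)
    then have "l2_inner F d y = 0" "l2_inner F d (e t x) = 0" using * y by blast+
    then have "l2_inner F y d = 0" "l2_inner F (e t x) d = 0"
      using l2_inner_commute[of F y d] l2_inner_commute[of F "e t x" d] by simp_all
    then have "l2_inner F d d = 0" by (subst d_def) (simp add: l2_inner_diff_left)
    moreover have "d \<in> V" using y eV[OF x] EV by (auto simp: d_def V_def supported_on_def)
    ultimately have "d = (\<lambda>_. 0)" by (rule zero[rotated])
    then show "y = e t x" by (auto simp: d_def fun_eq_iff)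
  qed
  have "fun_calc V (l2_inner F) f S x b = (\<Sum>t\<in>T. of_real (f t) * e t x b)" for b
  proof -
    have "fun_calc V (l2_inner F) f S x b
        = (\<Sum>t\<in>spec. of_real (f t) * orth_proj (l2_inner F) (?E t) x b)"
      by (simp add: fun_calc_def op_sum_def spec_def)
    also have "\<dots> = (\<Sum>t\<in>spec. of_real (f t) * e t x b)"
      using \<open>spec \<subseteq> T\<close> by (intro sum.cong refl) (auto simp: proj)
    also have "\<dots> = (\<Sum>t\<in>T. of_real (f t) * e t x b)"
    proof (rule sum.mono_neutral_left[OF T \<open>spec \<subseteq> T\<close>], intro ballI)
      fix t assume "t \<in> T - spec"
      then have "e t x = (\<lambda>_. 0)" using e[OF x, of t] Et[of t] by simp
      then show "of_real (f t) * e t x b = 0" by simp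
    qed
    finally show ?thesis .
  qed
  then show ?thesis by blast
qed

text \<open>Decomposing the finitely many basis vectors and extending linearly gives one finite set of
  eigenvalues that serves all vectors.\<close>

lemma spectral_decomposition:
  fixes F :: "'b set" and S :: "'b oper"
  assumes F: "finite F" and lin: "linear_on_subspace (supported_on F) S" and sa: "selfadjoint_on F S"
  shows "\<exists>T e. finite T \<and>
    (\<forall>t. \<forall>x\<in>supported_on F. e t x \<in> eigenspace_on (supported_on F) S t) \<and>
    (\<forall>x\<in>supported_on F. x = (\<lambda>b. \<Sum>t\<in>T. e t x b))"
proof -
  let ?V = "supported_on F"
  let ?E = "eigenspace_on ?V S"
  have zeroE: "(\<lambda>_. 0) \<in> ?E t" for t
    using linear_on_subspace_zero[OF lin] by (simp add: eigenspace_on_def supported_on_def)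
  have sumE: "(\<lambda>b. \<Sum>i\<in>A. c i * f i b) \<in> ?E t" if "\<And>i. i \<in> A \<Longrightarrow> f i \<in> ?E t" for A c f t
  proof -
    have fV: "f i \<in> ?V" and Sf: "S (f i) = (\<lambda>b. of_real t * f i b)" if "i \<in> A" for i
      using \<open>\<And>i. i \<in> A \<Longrightarrow> f i \<in> ?E t\<close>[OF that] by (auto simp: eigenspace_on_def)
    have "S (\<lambda>b. \<Sum>i\<in>A. c i * f i b) = (\<lambda>b. \<Sum>i\<in>A. c i * S (f i) b)"
      by (rule linear_on_subspace_sum[OF lin fV])
    also have "\<dots> = (\<lambda>b. of_real t * (\<Sum>i\<in>A. c i * f i b))"
      unfolding sum_distrib_left by (intro ext sum.cong refl) (simp add: Sf)
    finally show ?thesis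
      using lin_subspace_sum[OF lin_subspace_supported_on[of F], of A f c, OF fV]
      by (simp add: eigenspace_on_def)
  qed
  define u where "u A = (\<lambda>B. if B = A then (1::complex) else 0)" for A :: 'b
  have "\<forall>A\<in>F. \<exists>T e. finite T \<and> (\<forall>t. e t \<in> ?E t) \<and> u A = (\<lambda>b. \<Sum>t\<in>T. e t b)"
  proof
    fix A assume "A \<in> F"
    then have "u A \<in> ?V" by (auto simp: u_def supported_on_def)
    then show "\<exists>T e. finite T \<and> (\<forall>t. e t \<in> ?E t) \<and> u A = (\<lambda>b. \<Sum>t\<in>T. e t b)"
      by (rule eigenvector_decomposition[OF F lin sa])
  qed
  from bchoice[OF this] obtain T
    where "\<forall>A\<in>F. \<exists>e. finite (T A) \<and> (\<forall>t. e t \<in> ?E t) \<and> u A = (\<lambda>b. \<Sum>t\<in>T A. e t b)" ..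
  from bchoice[OF this] obtain g
    where "\<forall>A\<in>F. finite (T A) \<and> (\<forall>t. g A t \<in> ?E t) \<and> u A = (\<lambda>b. \<Sum>t\<in>T A. g A t b)" ..
  then have fin: "\<And>A. A \<in> F \<Longrightarrow> finite (T A)" and g: "\<And>A t. A \<in> F \<Longrightarrow> g A t \<in> ?E t"
    and u: "\<And>A. A \<in> F \<Longrightarrow> u A = (\<lambda>b. \<Sum>t\<in>T A. g A t b)" by blast+
  define TT where "TT = (\<Union>A\<in>F. T A)"
  define e where "e t x = (\<lambda>b. \<Sum>A\<in>F. x A * (if t \<in> T A then g A t else (\<lambda>_. 0)) b)" for t x
  have TT: "finite TT" using F fin by (auto simp: TT_def)
  have "e t x \<in> ?E t" for t x
    unfolding e_def by (rule sumE) (use g zeroE in auto)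
  moreover have "x = (\<lambda>b. \<Sum>t\<in>TT. e t x b)" if x: "x \<in> ?V" for x
  proof
    fix b
    have "(\<Sum>t\<in>TT. e t x b) = (\<Sum>A\<in>F. x A * (\<Sum>t\<in>TT. (if t \<in> T A then g A t else (\<lambda>_. 0)) b))"
      unfolding e_def sum_distrib_left by (rule sum.swap)
    also have "\<dots> = (\<Sum>A\<in>F. x A * u A b)"
    proof (intro sum.cong refl arg_cong2[of _ _ _ _ "(*)"])
      fix A assume A: "A \<in> F"
      then have "T A \<subseteq> TT" by (auto simp: TT_def)
      then show "(\<Sum>t\<in>TT. (if t \<in> T A then g A t else (\<lambda>_. 0)) b) = u A b"
        unfolding u[OF A] by (intro sum.mono_neutral_cong_right TT) auto
    qed
    also have "\<dots> = (\<Sum>A\<in>F. if A = b then x A else 0)"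
      by (intro sum.cong refl) (simp add: u_def)
    also have "\<dots> = x b" using x F by (auto simp: supported_on_def)
    finally show "x b = (\<Sum>t\<in>TT. e t x b)" by simp
  qed
  ultimately show ?thesis using TT by (intro exI[of _ TT] exI[of _ e]) simp
qed

text \<open>For \<open>S = D\<^sup>*D\<close> this is \<open>|D|\<^sup>2 = D\<^sup>*D\<close>. The eigenspaces of \<open>\<surd>S\<close> are those of \<open>S\<close>, with the square roots of
  the eigenvalues; positivity makes the square root injective on them.\<close>

lemma fun_calc_square_sqrt:
  assumes F: "finite F" and lin: "linear_on_subspace (supported_on F) S" and sa: "selfadjoint_on F S"
    and pos: "\<And>x. x \<in> supported_on F \<Longrightarrow> 0 \<le> Re (l2_inner F (S x) x)"
    and x: "x \<in> supported_on F"
  shows "fun_calc (supported_on F) (l2_inner F) (\<lambda>t. t powr 2)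
    (fun_calc (supported_on F) (l2_inner F) sqrt S) x = S x"
proof -
  let ?V = "supported_on F"
  let ?E = "eigenspace_on ?V S"
  obtain T e where T: "finite T" and e: "\<And>t x. x \<in> ?V \<Longrightarrow> e t x \<in> ?E t"
    and dec: "\<And>x. x \<in> ?V \<Longrightarrow> x = (\<lambda>b. \<Sum>t\<in>T. e t x b)"
    using spectral_decomposition[OF F lin sa] by blast
  have eV: "e t x \<in> ?V" and Se: "S (e t x) = (\<lambda>b. of_real t * e t x b)" if "x \<in> ?V" for t x
    using e[OF that, of t] by (auto simp: eigenspace_on_def)
  have orth: "l2_inner F y z = 0" if "y \<in> ?E s" "z \<in> ?E t" "s \<noteq> t" for y z s t
    using eigenspaces_orthogonal[OF sa that] .
  have zero: "y = (\<lambda>_. 0)" if "y \<in> ?V" "l2_inner F y y = 0" for y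
    using l2_inner_self_eq_0[OF F that] .
  have neg: "e t x = (\<lambda>_. 0)" if "t < 0" "x \<in> ?V" for t x
  proof (rule zero[OF eV[OF that(2)]])
    have "0 \<le> Re (of_real t * l2_inner F (e t x) (e t x))"
      using pos[OF eV[OF that(2), of t]] by (simp add: Se[OF that(2)] l2_inner_scale_left)
    then have "0 \<le> t * Re (l2_inner F (e t x) (e t x))" by simp
    moreover have "0 \<le> Re (l2_inner F (e t x) (e t x))" by (simp add: l2_inner_self sum_nonneg)
    ultimately have "Re (l2_inner F (e t x) (e t x)) = 0"
      using that(1) by (simp add: zero_le_mult_iff)
    then show "l2_inner F (e t x) (e t x) = 0" by (simp add: l2_inner_self)
  qed
  (* The components at negative numbers vanish, and on the remaining ones sqrt is injective. *)
  define T' where "T' = {t\<in>T. 0 \<le> t}"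
  have T': "finite T'" using T by (simp add: T'_def)
  have dec': "x = (\<lambda>b. \<Sum>t\<in>T'. e t x b)" if "x \<in> ?V" for x
  proof -
    have "(\<Sum>t\<in>T. e t x b) = (\<Sum>t\<in>T'. e t x b)" for b
      by (rule sum.mono_neutral_right) (use T neg[OF _ that] in \<open>auto simp: T'_def not_le\<close>)
    then show ?thesis using dec[OF that] by simp
  qed
  define R where "R = fun_calc ?V (l2_inner F) sqrt S"
  have R: "R y = (\<lambda>b. \<Sum>t\<in>T'. of_real (sqrt t) * e t y b)" if "y \<in> ?V" for y
    unfolding R_def by (rule fun_calc_of_decomposition[OF F T' sa e dec' that])
  have other: "e s y = (\<lambda>_. 0)" if y: "y \<in> ?E t" and "s \<noteq> t" "s \<in> T'" for s t y
  proof (rule zero)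
    have yV: "y \<in> ?V" using y by (simp add: eigenspace_on_def)
    show "e s y \<in> ?V" by (rule eV[OF yV])
    have "(\<Sum>r\<in>T'. l2_inner F (e r y) (e s y)) = l2_inner F y (e s y)"
      using arg_cong[OF dec'[OF yV], of "\<lambda>z. l2_inner F z (e s y)"]
        l2_inner_sum_left[of F "\<lambda>_. 1" "\<lambda>t. e t y" T' "e s y"] by simp
    also have "\<dots> = 0" using orth[OF y e[OF yV, of s]] that(2) by simp
    also have "(\<Sum>r\<in>T'. l2_inner F (e r y) (e s y)) = (\<Sum>r\<in>T'. if r = s then l2_inner F (e s y) (e s y) else 0)"
      by (intro sum.cong refl) (use orth[OF e[OF yV] e[OF yV]] in auto)
    also have "\<dots> = l2_inner F (e s y) (e s y)" using T' that(3) by simp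
    finally show "l2_inner F (e s y) (e s y) = 0" .
  qed
  have self: "e t y = y" if y: "y \<in> ?E t" and t: "t \<in> T'" for t y
  proof -
    have yV: "y \<in> ?V" using y by (simp add: eigenspace_on_def)
    have "(\<Sum>s\<in>T'. e s y b) = (\<Sum>s\<in>T'. if s = t then e t y b else 0)" for b
      by (intro sum.cong refl) (use other[OF y] in auto)
    then show ?thesis using dec'[OF yV] T' t by simp
  qed
  have RE: "R (e t y) = (\<lambda>b. of_real (sqrt t) * e t y b)" if y: "y \<in> ?V" and t: "t \<in> T'" for t y
  proof
    fix b
    have "R (e t y) b = (\<Sum>s\<in>T'. if s = t then of_real (sqrt t) * e t y b else 0)"
      unfolding R[OF eV[OF y]]
      by (intro sum.cong refl) (use other[OF e[OF y, of t]] self[OF e[OF y, of t] t] in auto)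
    then show "R (e t y) b = of_real (sqrt t) * e t y b" using T' t by simp
  qed
  have RV: "R y \<in> ?V" if "y \<in> ?V" for y
    unfolding R[OF that] by (rule lin_subspace_sum[OF lin_subspace_supported_on eV[OF that]])
  have Rip: "l2_inner F (R y) z = (\<Sum>t\<in>T'. of_real (sqrt t) * l2_inner F (e t y) (e t z))"
    if y: "y \<in> ?V" and z: "z \<in> ?V" for y z
  proof -
    have "l2_inner F (e t y) z = l2_inner F (e t y) (e t z)" if t: "t \<in> T'" for t
    proof -
      have "l2_inner F z (e t y) = (\<Sum>s\<in>T'. l2_inner F (e s z) (e t y))"
        using arg_cong[OF dec'[OF z], of "\<lambda>w. l2_inner F w (e t y)"]
          l2_inner_sum_left[of F "\<lambda>_. 1" "\<lambda>t. e t z" T' "e t y"] by simp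
      also have "\<dots> = (\<Sum>s\<in>T'. if s = t then l2_inner F (e t z) (e t y) else 0)"
        by (intro sum.cong refl) (use orth[OF e[OF z] e[OF y]] in auto)
      finally have "l2_inner F z (e t y) = l2_inner F (e t z) (e t y)" using T' t by simp
      then show ?thesis by (metis l2_inner_commute)
    qed
    then show ?thesis unfolding R[OF y] l2_inner_sum_left by simp
  qed
  have "selfadjoint_on F R"
    unfolding selfadjoint_on_def
  proof (intro conjI ballI)
    fix y z assume y: "y \<in> ?V" and z: "z \<in> ?V"
    have "cnj (l2_inner F (R z) y) = l2_inner F (R y) z"
      unfolding Rip[OF z y] Rip[OF y z] cnj_sum
      by (intro sum.cong refl) (simp add: l2_inner_commute[of F "e _ z"])
    then show "l2_inner F (R y) z = l2_inner F y (R z)" by (metis l2_inner_commute)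
  qed (rule RV)
  define e' where "e' r y = (if r \<in> sqrt ` T' then e (r\<^sup>2) y else (\<lambda>_. 0))" for r y
  have e'T: "e' (sqrt t) y = e t y" if "t \<in> T'" for t y
    using that by (auto simp: e'_def T'_def)
  have "fun_calc ?V (l2_inner F) (\<lambda>t. t powr 2) R x = (\<lambda>b. \<Sum>r\<in>sqrt ` T'. of_real (r powr 2) * e' r x b)"
  proof (rule fun_calc_of_decomposition[OF F _ \<open>selfadjoint_on F R\<close> _ _ x])
    show "finite (sqrt ` T')" using T' by simp
    fix y assume y: "y \<in> ?V"
    show "e' r y \<in> eigenspace_on ?V R r" for r
    proof (cases "r \<in> sqrt ` T'")
      case True
      then obtain t where t: "t \<in> T'" "r = sqrt t" by blast
      show ?thesis unfolding t(2) e'T[OF t(1)]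
        using RE[OF y t(1)] eV[OF y] by (simp add: eigenspace_on_def)
    next
      case False
      have "R (\<lambda>_. 0) = (\<lambda>_. 0)"
      proof -
        have z: "(\<lambda>_. 0) \<in> ?V" by (simp add: supported_on_def)
        have zE: "(\<lambda>_. 0) \<in> ?E t" for t
          using linear_on_subspace_zero[OF lin] by (simp add: eigenspace_on_def z)
        have "e t (\<lambda>_. 0) = (\<lambda>_. 0)" if "t \<in> T'" for t using self[OF zE that] .
        then show ?thesis unfolding R[OF z] by simp
      qed
      then show ?thesis using False by (simp add: e'_def eigenspace_on_def supported_on_def)
    qed
    show "y = (\<lambda>b. \<Sum>r\<in>sqrt ` T'. e' r y b)"
      using dec'[OF y] by (subst sum.reindex) (auto simp: inj_on_def e'T)
  qed
  also have "\<dots> = (\<lambda>b. \<Sum>t\<in>T'. of_real t * e t x b)"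
    by (subst sum.reindex) (auto simp: inj_on_def e'T T'_def powr_numeral intro!: sum.cong ext)
  also have "\<dots> = (\<lambda>b. \<Sum>t\<in>T'. 1 * S (e t x) b)" by (simp add: Se[OF x])
  also have "\<dots> = S (\<lambda>b. \<Sum>t\<in>T'. 1 * e t x b)"
    by (rule linear_on_subspace_sum[OF lin eV[OF x], symmetric])
  also have "\<dots> = S x" using dec'[OF x] by simp
  finally show ?thesis unfolding R_def .
qed

section \<open>The baby Fock algebra\<close>

lemma baby_space_supported_on: "baby_space I = supported_on (Pow I)"
  by (auto simp: baby_space_def supported_on_def)

lemma baby_mult_sum_left:
  "baby_mult I \<epsilon> (\<lambda>b. \<Sum>i\<in>T. c i * f i b) y = (\<lambda>b. \<Sum>i\<in>T. c i * baby_mult I \<epsilon> (f i) y b)"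
proof
  fix A
  let ?t = "\<lambda>i B C. if sym_diff B C = A then of_int (reorder_sign \<epsilon> B C) * f i B * y C else 0"
  have "baby_mult I \<epsilon> (\<lambda>b. \<Sum>i\<in>T. c i * f i b) y A = (\<Sum>B\<in>Pow I. \<Sum>C\<in>Pow I. \<Sum>i\<in>T. c i * ?t i B C)"
    unfolding baby_mult_def
    by (intro sum.cong refl) (simp add: sum_distrib_left sum_distrib_right mult_ac)
  also have "\<dots> = (\<Sum>B\<in>Pow I. \<Sum>i\<in>T. \<Sum>C\<in>Pow I. c i * ?t i B C)"
    by (intro sum.cong refl sum.swap)
  also have "\<dots> = (\<Sum>i\<in>T. c i * (\<Sum>B\<in>Pow I. \<Sum>C\<in>Pow I. ?t i B C))"
    unfolding sum_distrib_left by (rule sum.swap)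
  finally show "baby_mult I \<epsilon> (\<lambda>b. \<Sum>i\<in>T. c i * f i b) y A = (\<Sum>i\<in>T. c i * baby_mult I \<epsilon> (f i) y A)"
    by (simp add: baby_mult_def)
qed

lemma baby_mult_sum_right:
  "baby_mult I \<epsilon> x (\<lambda>b. \<Sum>i\<in>T. c i * f i b) = (\<lambda>b. \<Sum>i\<in>T. c i * baby_mult I \<epsilon> x (f i) b)"
proof
  fix A
  let ?t = "\<lambda>i B C. if sym_diff B C = A then of_int (reorder_sign \<epsilon> B C) * x B * f i C else 0"
  have "baby_mult I \<epsilon> x (\<lambda>b. \<Sum>i\<in>T. c i * f i b) A = (\<Sum>B\<in>Pow I. \<Sum>C\<in>Pow I. \<Sum>i\<in>T. c i * ?t i B C)"
    unfolding baby_mult_def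
    by (intro sum.cong refl) (simp add: sum_distrib_left sum_distrib_right mult_ac)
  also have "\<dots> = (\<Sum>B\<in>Pow I. \<Sum>i\<in>T. \<Sum>C\<in>Pow I. c i * ?t i B C)"
    by (intro sum.cong refl sum.swap)
  also have "\<dots> = (\<Sum>i\<in>T. c i * (\<Sum>B\<in>Pow I. \<Sum>C\<in>Pow I. ?t i B C))"
    unfolding sum_distrib_left by (rule sum.swap)
  finally show "baby_mult I \<epsilon> x (\<lambda>b. \<Sum>i\<in>T. c i * f i b) A = (\<Sum>i\<in>T. c i * baby_mult I \<epsilon> x (f i) A)"
    by (simp add: baby_mult_def)
qed

lemma baby_mult_scale_left: "baby_mult I \<epsilon> (\<lambda>b. c * x b) y = (\<lambda>b. c * baby_mult I \<epsilon> x y b)"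
  using baby_mult_sum_left[of I \<epsilon> "\<lambda>_. c" "\<lambda>_. x" "{()}" y] by simp

lemma baby_mult_scale_right: "baby_mult I \<epsilon> x (\<lambda>b. c * y b) = (\<lambda>b. c * baby_mult I \<epsilon> x y b)"
  using baby_mult_sum_right[of I \<epsilon> x "\<lambda>_. c" "\<lambda>_. y" "{()}"] by simp

lemma baby_mult_add_left:
  "baby_mult I \<epsilon> (\<lambda>b. x b + z b) y = (\<lambda>b. baby_mult I \<epsilon> x y b + baby_mult I \<epsilon> z y b)"
  using baby_mult_sum_left[of I \<epsilon> "\<lambda>_. 1" "\<lambda>i::nat. if i = 0 then x else z" "{0, 1}" y] by simp

lemma baby_mult_add_right:
  "baby_mult I \<epsilon> x (\<lambda>b. y b + z b) = (\<lambda>b. baby_mult I \<epsilon> x y b + baby_mult I \<epsilon> x z b)"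
  using baby_mult_sum_right[of I \<epsilon> x "\<lambda>_. 1" "\<lambda>i::nat. if i = 0 then y else z" "{0, 1}"] by simp

lemma baby_mult_diff_left:
  "baby_mult I \<epsilon> (\<lambda>b. x b - z b) y = (\<lambda>b. baby_mult I \<epsilon> x y b - baby_mult I \<epsilon> z y b)"
  using baby_mult_add_left[of I \<epsilon> x "\<lambda>b. (-1) * z b" y] unfolding baby_mult_scale_left by simp

lemma baby_mult_diff_right:
  "baby_mult I \<epsilon> x (\<lambda>b. y b - z b) = (\<lambda>b. baby_mult I \<epsilon> x y b - baby_mult I \<epsilon> x z b)"
  using baby_mult_add_right[of I \<epsilon> x y "\<lambda>b. (-1) * z b"] unfolding baby_mult_scale_right by simp

lemma baby_mult_in_space:
  assumes "finite I"
  shows "baby_mult I \<epsilon> x y \<in> baby_space I"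
  using assms by (simp add: baby_space_def baby_mult_apply)

lemma linear_on_subspace_baby_mult:
  assumes "finite I"
  shows "linear_on_subspace (baby_space I) (baby_mult I \<epsilon> x)"
  unfolding linear_on_subspace_def
proof (intro conjI ballI allI)
  show "lin_subspace (baby_space I)"
    unfolding baby_space_supported_on by (rule lin_subspace_supported_on)
qed (rule baby_mult_in_space[OF assms] baby_mult_add_right baby_mult_scale_right)+

lemma baby_basis_in_space: "B \<subseteq> I \<Longrightarrow> baby_basis B \<in> baby_space I"
  by (auto simp: baby_basis_def baby_space_def)

text \<open>The support of a word: a letter occurring an even number of times cancels.\<close>

primrec odd_letters :: "nat list \<Rightarrow> nat set" where
  "odd_letters [] = {}"
| "odd_letters (i # J) = sym_diff {i} (odd_letters J)"

lemma odd_letters_append: "odd_letters (J @ K) = sym_diff (odd_letters J) (odd_letters K)"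
proof (induction J)
  case (Cons i J)
  show ?case by (simp only: append_Cons odd_letters.simps Cons.IH) blast
qed simp

lemma odd_letters_subset: "odd_letters J \<subseteq> set J"
  by (induction J) (simp_all, blast)

lemma odd_letters_distinct: "distinct J \<Longrightarrow> odd_letters J = set J"
  by (induction J) (simp_all, blast?)

(* The index sets {1..n} have to keep their form under simplification. *)
declare One_nat_def [simp del]

locale baby_fock =
  fixes \<epsilon> :: "nat \<Rightarrow> nat \<Rightarrow> int"
  assumes sign: "sign_function \<epsilon>"
begin

abbreviation space :: "nat \<Rightarrow> nat set vec set" where
  "space n \<equiv> baby_space {1..n}"

abbreviation mul :: "nat \<Rightarrow> nat set vec \<Rightarrow> nat set vec \<Rightarrow> nat set vec" where
  "mul n \<equiv> baby_mult {1..n} \<epsilon>"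

abbreviation star :: "nat set vec \<Rightarrow> nat set vec" where
  "star \<equiv> baby_star \<epsilon>"

abbreviation unit :: "nat set vec" where
  "unit \<equiv> baby_basis {}"

definition hs_norm :: "nat \<Rightarrow> nat set vec \<Rightarrow> real" where
  "hs_norm n x = L2_set (\<lambda>A. cmod (x A)) (Pow {1..n})"

lemma sgn_square:
  assumes "A \<subseteq> {1..n}" "B \<subseteq> {1..n}"
  shows "(of_int (reorder_sign \<epsilon> A B) :: complex) * of_int (reorder_sign \<epsilon> A B) = 1"
    and "\<bar>real_of_int (reorder_sign \<epsilon> A B)\<bar> = 1"
proof -
  have "reorder_sign \<epsilon> A B \<in> {-1, 1}"
    using assms by (intro reorder_sign_pm1[OF sign]) auto
  then show "(of_int (reorder_sign \<epsilon> A B) :: complex) * of_int (reorder_sign \<epsilon> A B) = 1"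
    "\<bar>real_of_int (reorder_sign \<epsilon> A B)\<bar> = 1" by auto
qed

lemma mul_in_space [simp]: "mul n x y \<in> space n"
  by (rule baby_mult_in_space) simp

lemma unit_in_space [simp]: "unit \<in> space n"
  by (rule baby_basis_in_space) simp

lemma mul_unit [simp]:
  assumes "x \<in> space n"
  shows "mul n unit x = x" "mul n x unit = x"
  by (rule baby_unit[OF _ assms], simp)+

lemma mul_assoc: "mul n (mul n x y) z = mul n x (mul n y z)"
  by (rule baby_assoc[OF sign]) auto

lemma star_in_space [simp]: "x \<in> space n \<Longrightarrow> star x \<in> space n"
  by (auto simp: baby_space_def baby_star_def)

lemma star_star:
  assumes "x \<in> space n"
  shows "star (star x) = x"
proof
  fix A
  show "star (star x) A = x A"
  proof (cases "A \<subseteq> {1..n}")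
    case True
    then show ?thesis using sgn_square(1)[OF True True]
      by (simp add: baby_star_def mult.assoc[symmetric])
  qed (use assms in \<open>simp add: baby_star_def baby_space_def\<close>)
qed

lemma star_unit: "star unit = unit"
  by (auto simp: baby_star_def baby_basis_def reorder_sign_def)

lemma star_sum: "star (\<lambda>b. \<Sum>i\<in>T. c i * f i b) = (\<lambda>b. \<Sum>i\<in>T. cnj (c i) * star (f i) b)"
  by (simp add: baby_star_def sum_distrib_left mult_ac)

lemma star_add: "star (\<lambda>b. x b + y b) = (\<lambda>b. star x b + star y b)"
  by (simp add: baby_star_def distrib_left)

text \<open>Bilinearity of the exponent in the sign reduces this to
  \<open>s(A,A) = s(B,B) s(B,C) s(C,B) s(C,C)\<close> for \<open>A = B \<triangle> C\<close>.\<close>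

lemma star_mul: "star (mul n x y) = mul n (star y) (star x)"
proof
  fix A
  show "star (mul n x y) A = mul n (star y) (star x) A"
  proof (cases "A \<subseteq> {1..n}")
    case A: True
    let ?s = "\<lambda>B C. of_int (reorder_sign \<epsilon> B C) :: complex"
    have "star (mul n x y) A
        = (\<Sum>B\<in>Pow {1..n}. ?s A A * (?s B (sym_diff A B) * cnj (x B) * cnj (y (sym_diff A B))))"
      using A by (simp add: baby_star_def baby_mult_apply sum_distrib_left)
    also have "\<dots> = (\<Sum>C\<in>Pow {1..n}. ?s C (sym_diff A C) * star y C * star x (sym_diff A C))"
    proof (rule sum.reindex_bij_witness[where i = "\<lambda>C. sym_diff A C" and j = "\<lambda>B. sym_diff A B"])
      fix B assume B: "B \<in> Pow {1..n}"
      define C where "C = sym_diff A B"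
      have C: "C \<subseteq> {1..n}" using A B by (auto simp: C_def)
      have AC: "sym_diff A C = B" and A': "A = sym_diff B C" by (auto simp: C_def)
      have fin: "finite A" "finite B" "finite C" "0 \<notin> A" "0 \<notin> B" "0 \<notin> C"
        using A B C finite_subset[of _ "{1..n}"] by auto
      have "reorder_sign \<epsilon> A A = reorder_sign \<epsilon> B B * reorder_sign \<epsilon> B C *
          (reorder_sign \<epsilon> C B * reorder_sign \<epsilon> C C)"
        by (subst A', subst A')
          (simp only: reorder_sign_sym_diff[OF sign] fin finite_Un finite_Diff Un_iff Diff_iff simp_thms mult_ac)
      then have "?s A A = ?s B B * ?s B C * (?s C B * ?s C C)" by (metis of_int_mult)
      then have "?s A A * ?s B C = ?s C B * ?s C C * ?s B B * (?s B C * ?s B C)" by simp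
      then have sg: "?s A A * ?s B C = ?s C B * ?s C C * ?s B B"
        using B C by (simp only: sgn_square(1)[of B n C] Pow_iff mult_1_right)
      have "?s C B * star y C * star x B = (?s C B * ?s C C * ?s B B) * (cnj (x B) * cnj (y C))"
        by (simp add: baby_star_def)
      also have "\<dots> = ?s A A * (?s B C * cnj (x B) * cnj (y C))"
        by (simp only: sg[symmetric]) (simp only: mult.assoc)
      finally show "?s (sym_diff A B) (sym_diff A (sym_diff A B)) * star y (sym_diff A B) *
          star x (sym_diff A (sym_diff A B)) =
          ?s A A * (?s B (sym_diff A B) * cnj (x B) * cnj (y (sym_diff A B)))"
        unfolding C_def[symmetric] AC .
    qed (use A in auto)
    also have "\<dots> = mul n (star y) (star x) A"
      using A by (simp add: baby_mult_apply)
    finally show ?thesis .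
  qed (simp add: baby_star_def baby_mult_apply)
qed

lemma mul_vacuum_component:
  "mul n x y {} = (\<Sum>B\<in>Pow {1..n}. of_int (reorder_sign \<epsilon> B B) * x B * y B)"
  by (simp add: baby_mult_apply)

lemma hs_norm_nonneg [simp]: "0 \<le> hs_norm n x"
  by (simp add: hs_norm_def)

lemma hs_norm_star [simp]: "hs_norm n (star x) = hs_norm n x"
  unfolding hs_norm_def
  by (intro L2_set_cong refl) (simp add: baby_star_def norm_mult sgn_square(2))

lemma hs_norm_add: "hs_norm n (\<lambda>b. x b + y b) \<le> hs_norm n x + hs_norm n y"
proof -
  have "hs_norm n (\<lambda>b. x b + y b) \<le> L2_set (\<lambda>A. cmod (x A) + cmod (y A)) (Pow {1..n})"
    unfolding hs_norm_def by (intro L2_set_mono) (auto simp: norm_triangle_ineq)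
  also have "\<dots> \<le> hs_norm n x + hs_norm n y"
    unfolding hs_norm_def by (rule L2_set_triangle_ineq)
  finally show ?thesis .
qed

lemma hs_norm_scale: "hs_norm n (\<lambda>b. c * x b) = cmod c * hs_norm n x"
  unfolding hs_norm_def norm_mult by (simp add: L2_set_right_distrib)

lemma vacuum_component_le_hs_norm: "cmod (x {}) \<le> hs_norm n x"
  unfolding hs_norm_def by (rule member_le_L2_set) auto

lemma mul_vacuum_component_le: "cmod (mul n x y {}) \<le> hs_norm n x * hs_norm n y"
proof -
  have "cmod (mul n x y {}) \<le> (\<Sum>B\<in>Pow {1..n}. cmod (x B) * cmod (y B))"
    unfolding mul_vacuum_component
    by (rule sum_norm_le) (auto simp: norm_mult sgn_square(2))
  also have "\<dots> \<le> hs_norm n x * hs_norm n y"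
    unfolding hs_norm_def using L2_set_mult_ineq[of "\<lambda>A. cmod (x A)" "\<lambda>A. cmod (y A)"] by simp
  finally show ?thesis .
qed

lemma baby_inner_l2_inner: "baby_inner {1..n} \<epsilon> = l2_inner (Pow {1..n})"
  by (intro ext) (simp add: baby_inner_orthonormal[OF sign] l2_inner_def)

lemma star_mul_self_vacuum_component: "mul n (star x) x {} = of_real ((hs_norm n x)\<^sup>2)"
proof -
  have "mul n (star x) x {} = l2_inner (Pow {1..n}) x x"
    by (simp add: baby_inner_l2_inner[symmetric] baby_inner_def baby_phi_def)
  then show ?thesis by (simp add: l2_inner_self hs_norm_def L2_set_def sum_nonneg)
qed

lemma hs_norm_mul_square_le: "(hs_norm n (mul n a e))\<^sup>2 \<le> hs_norm n e * hs_norm n (mul n (mul n (star a) a) e)"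
proof -
  have "of_real ((hs_norm n (mul n a e))\<^sup>2) = mul n (star e) (mul n (mul n (star a) a) e) {}"
    by (simp only: star_mul_self_vacuum_component[symmetric] star_mul mul_assoc)
  then have "(hs_norm n (mul n a e))\<^sup>2 = cmod (mul n (star e) (mul n (mul n (star a) a) e) {})"
    by (metis norm_of_real abs_power2 power2_abs)
  then show ?thesis using mul_vacuum_component_le[of n "star e"] by simp
qed

lemma baby_tau_vacuum_component: "baby_tau {1..n} \<epsilon> T = T unit {}"
proof -
  have "baby_tau {1..n} \<epsilon> T = (\<Sum>A\<in>Pow {1..n}. if A = {} then T unit A else 0)"
    unfolding baby_tau_def baby_inner_l2_inner l2_inner_def
    by (intro sum.cong refl) (simp add: baby_basis_def)
  then show ?thesis by simp
qed

text \<open>The adjoint of left multiplication by \<open>d\<close> is left multiplication by \<open>d\<^sup>*\<close>, so \<open>|T|\<^sup>2\<close> is left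
  multiplication by \<open>d\<^sup>* d\<close>, whose trace is the sum of the squared moduli of the coefficients of \<open>d\<close>.\<close>

lemma baby_norm_2:
  assumes d: "d \<in> space n" and T: "\<And>x. x \<in> space n \<Longrightarrow> T x = mul n d x"
  shows "baby_norm {1..n} \<epsilon> 2 T = hs_norm n d"
proof -
  let ?F = "Pow {1..n}"
  let ?ip = "l2_inner ?F"
  have V: "space n = supported_on ?F" by (rule baby_space_supported_on)
  have ip: "?ip x y = mul n (star y) x {}" for x y
    by (simp add: baby_inner_l2_inner[symmetric] baby_inner_def baby_phi_def)
  have adj: "?ip (mul n d x) y = ?ip x (mul n (star d) y)" for x y
    by (simp add: ip star_mul star_star[OF d] mul_assoc)
  have adj': "?ip (mul n (star d) x) y = ?ip x (mul n d y)" for x y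
    by (simp add: ip star_mul mul_assoc)
  have ad: "adjoint_on (space n) ?ip T y = mul n (star d) y" if y: "y \<in> space n" for y
    unfolding adjoint_on_def
  proof (rule the_equality)
    show "mul n (star d) y \<in> space n \<and> (\<forall>x\<in>space n. ?ip (T x) y = ?ip x (mul n (star d) y))"
      using adj T by simp
    fix z assume z: "z \<in> space n \<and> (\<forall>x\<in>space n. ?ip (T x) y = ?ip x z)"
    define w where "w = (\<lambda>b. z b - mul n (star d) y b)"
    have wV: "w \<in> space n"
      using z mul_in_space[of n "star d" y] by (simp add: w_def baby_space_def)
    have eq: "?ip w z = ?ip w (mul n (star d) y)" using z wV adj T by force
    have "?ip w w = ?ip w z - ?ip w (mul n (star d) y)"
      by (subst (2) w_def) (rule l2_inner_diff_right)
    also have "\<dots> = 0" using eq by simp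
    finally have "w = (\<lambda>_. 0)" using l2_inner_self_eq_0[of ?F w] wV V by simp
    then show "z = mul n (star d) y" by (auto simp: w_def fun_eq_iff)
  qed
  define S where "S = adjoint_on (space n) ?ip T \<circ> T"
  have S: "S x = mul n (star d) (mul n d x)" if "x \<in> space n" for x
    using T[OF that] by (simp add: S_def ad)
  have lin: "linear_on_subspace (supported_on ?F) S"
    using lin_subspace_supported_on[of ?F] S unfolding linear_on_subspace_def V[symmetric]
    by (auto simp: lin_subspace_def baby_mult_add_right baby_mult_scale_right)
  have "fun_calc (space n) ?ip (\<lambda>t. t powr 2) (fun_calc (space n) ?ip sqrt S) unit = S unit"
    unfolding V
  proof (rule fun_calc_square_sqrt[OF _ lin])
    show "selfadjoint_on ?F S"
      unfolding selfadjoint_on_def V[symmetric] using S by (simp add: adj adj')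
    fix x assume "x \<in> supported_on ?F"
    then show "0 \<le> Re (?ip (S x) x)"
      by (simp add: V[symmetric] S adj' l2_inner_self sum_nonneg)
  qed (simp_all add: V[symmetric])
  then have "baby_tau {1..n} \<epsilon> (fun_calc (space n) (baby_inner {1..n} \<epsilon>) (\<lambda>t. t powr 2)
      (abs_op (space n) (baby_inner {1..n} \<epsilon>) T)) = of_real ((hs_norm n d)\<^sup>2)"
    using d star_mul_self_vacuum_component[of n d]
    by (simp add: baby_tau_vacuum_component baby_inner_l2_inner abs_op_def S_def[symmetric] S)
  then show ?thesis
    by (simp add: baby_norm_def powr_half_sqrt)
qed

primrec monomial :: "nat \<Rightarrow> nat list \<Rightarrow> nat set vec" where
  "monomial n [] = unit"
| "monomial n (i # J) = mul n (baby_basis {i}) (monomial n J)"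

lemma monomial_in_space [simp]: "monomial n J \<in> space n"
  by (cases J) auto

lemma op_prod_gamma:
  assumes "x \<in> space n"
  shows "op_prod (baby_gamma {1..n} \<epsilon>) J x = mul n (monomial n J) x"
  using assms by (induction J) (simp_all add: op_prod_def baby_gamma_def mul_assoc)

lemma monomial_append: "monomial n (J @ K) = mul n (monomial n J) (monomial n K)"
  by (induction J) (simp_all add: mul_assoc)

lemma star_letter: "star (baby_basis {i}) = baby_basis {i}"
proof -
  have "reorder_sign \<epsilon> {i} {i} = 1" by (auto simp: reorder_sign_def intro!: prod.neutral)
  then show ?thesis by (auto simp: baby_star_def baby_basis_def)
qed

lemma star_monomial:
  assumes "set J \<subseteq> {1..n}"
  shows "star (monomial n J) = monomial n (rev J)"
  using assms
proof (induction J)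
  case (Cons i J)
  then have "monomial n [i] = baby_basis {i}" by (simp add: baby_basis_in_space)
  then show ?case using Cons by (simp add: star_mul star_letter monomial_append)
qed (simp add: star_unit)

lemma monomial_eq_basis:
  assumes "set J \<subseteq> {1..n}"
  shows "\<exists>s\<in>{-1, 1}. monomial n J = (\<lambda>A. s * baby_basis (odd_letters J) A)"
  using assms
proof (induction J)
  case (Cons i J)
  from Cons.prems have "set J \<subseteq> {1..n}" by simp
  from Cons.IH[OF this] obtain s where s: "s \<in> {-1, 1 :: complex}"
    and w: "monomial n J = (\<lambda>A. s * baby_basis (odd_letters J) A)" ..
  have sub: "{i} \<subseteq> {1..n}" "odd_letters J \<subseteq> {1..n}" using Cons.prems odd_letters_subset[of J] by auto
  have "reorder_sign \<epsilon> {i} (odd_letters J) \<in> {-1, 1}"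
    using sub by (intro reorder_sign_pm1[OF sign]) auto
  then have "s * of_int (reorder_sign \<epsilon> {i} (odd_letters J)) \<in> {-1, 1 :: complex}" using s by auto
  moreover have "monomial n (i # J) =
      (\<lambda>A. (s * of_int (reorder_sign \<epsilon> {i} (odd_letters J))) * baby_basis (odd_letters (i # J)) A)"
    by (simp add: w baby_mult_scale_right baby_mult_basis sub mult.assoc del: insert_subset)
  ultimately show ?case by blast
qed auto

lemma monomial_vacuum_component:
  assumes "set J \<subseteq> {1..n}" "odd_letters J \<noteq> {}"
  shows "monomial n J {} = 0"
  using monomial_eq_basis[OF assms(1)] assms(2) by (auto simp: baby_basis_def split: if_splits)

section \<open>Words and their norms\<close>

definition words :: "nat \<Rightarrow> nat \<Rightarrow> nat list set" where
  "words n K = {J. length J = K \<and> set J \<subseteq> {1..n}}"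

lemma finite_words [simp]: "finite (words n K)"
  using finite_lists_length_eq[of "{1..n}" K] by (simp add: words_def conj_commute)

text \<open>The words whose product is a multiple of the unit.\<close>

definition even_words :: "nat \<Rightarrow> nat \<Rightarrow> nat list set" where
  "even_words n L = {J\<in>words n L. odd_letters J = {}}"

text \<open>The first letter occurs again later in the word. Deleting both occurrences leaves a shorter even
  word, and the letter together with the position of its second occurrence restores the original;
  so two more letters contribute a factor \<open>n\<close>, up to a constant.\<close>

lemma card_even_words: "card (even_words n (2 * K)) \<le> fact (2 * K) * n ^ K"
proof (induction K)
  case 0
  have "even_words n (2 * 0) \<subseteq> {[]}" by (auto simp: even_words_def words_def)
  then show ?case using card_mono[of "{[]}" "even_words n (2 * 0)"] by simp
next
  case (Suc K)
  let ?f = "\<lambda>(a, p, T). a # take p T @ a # drop p T"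
  let ?D = "{1..n} \<times> {..2 * K} \<times> even_words n (2 * K)"
  have fin: "finite (even_words n (2 * K))" by (simp add: even_words_def)
  have "even_words n (2 * Suc K) \<subseteq> ?f ` ?D"
  proof
    fix J assume J: "J \<in> even_words n (2 * Suc K)"
    then obtain a R where aR: "J = a # R" by (cases J) (auto simp: even_words_def words_def)
    have "sym_diff {a} (odd_letters R) = {}" using J aR by (simp add: even_words_def)
    then have R: "odd_letters R = {a}" by auto
    then have "a \<in> set R" using odd_letters_subset[of R] by auto
    then obtain R1 R2 where R12: "R = R1 @ a # R2" by (meson split_list)
    have "sym_diff (odd_letters R1) (sym_diff {a} (odd_letters R2)) = {a}"
      using R by (simp add: R12 odd_letters_append)
    then have "sym_diff (odd_letters R1) (odd_letters R2) = {}" by blast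
    then have "odd_letters (R1 @ R2) = {}" by (simp only: odd_letters_append)
    then have "R1 @ R2 \<in> even_words n (2 * K)"
      using J by (simp add: even_words_def words_def aR R12)
    moreover have "a \<in> {1..n}" "length R1 \<le> 2 * K"
      using J by (simp_all add: even_words_def words_def aR R12)
    moreover have "J = ?f (a, length R1, R1 @ R2)" by (simp add: aR R12)
    ultimately show "J \<in> ?f ` ?D" by blast
  qed
  then have "card (even_words n (2 * Suc K)) \<le> card (?f ` ?D)"
    using fin by (intro card_mono) auto
  also have "\<dots> \<le> card ?D" using fin by (intro card_image_le) auto
  also have "\<dots> = n * ((2 * K + 1) * card (even_words n (2 * K)))"
    by (simp add: card_cartesian_product algebra_simps)
  also have "\<dots> \<le> n * ((2 * K + 1) * (fact (2 * K) * n ^ K))"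
    using Suc.IH by (intro mult_left_mono) auto
  also have "\<dots> = fact (Suc (2 * K)) * n ^ Suc K"
    by (simp add: algebra_simps)
  also have "\<dots> \<le> fact (2 * Suc K) * n ^ Suc K"
    by (intro mult_right_mono fact_mono) auto
  finally show ?case .
qed

text \<open>Each \<open>x\<^sub>J\<close> is up to sign the basis vector of its odd letters, so only pairs of words with equal odd
  letters interact.\<close>

lemma hs_norm_square_word_sum_le:
  assumes Ws: "Ws \<subseteq> words n K"
  shows "(hs_norm n (\<lambda>A. \<Sum>J\<in>Ws. c J * monomial n J A))\<^sup>2
    \<le> (\<Sum>J\<in>Ws. \<Sum>J'\<in>{J'\<in>Ws. odd_letters J' = odd_letters J}. cmod (c J) * cmod (c J'))"
proof -
  have fin: "finite Ws" using Ws finite_words finite_subset by blast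
  have set: "set J \<subseteq> {1..n}" if "J \<in> Ws" for J using that Ws by (auto simp: words_def)
  let ?i = "\<lambda>J A. if odd_letters J = A then (1::real) else 0"
  have gw: "cmod (monomial n J A) = ?i J A" if J: "J \<in> Ws" for J A
  proof -
    obtain s where "s \<in> {-1, 1 :: complex}" "monomial n J = (\<lambda>A. s * baby_basis (odd_letters J) A)"
      using monomial_eq_basis[OF set[OF J]] ..
    then show ?thesis by (cases "odd_letters J = A") (auto simp: baby_basis_def)
  qed
  have "(cmod (\<Sum>J\<in>Ws. c J * monomial n J A))\<^sup>2
      \<le> (\<Sum>J\<in>Ws. \<Sum>J'\<in>Ws. cmod (c J) * cmod (c J') * (?i J A * ?i J' A))" for A
  proof -
    have "cmod (\<Sum>J\<in>Ws. c J * monomial n J A) \<le> (\<Sum>J\<in>Ws. cmod (c J) * ?i J A)"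
      by (rule sum_norm_le) (simp add: norm_mult gw)
    then have "(cmod (\<Sum>J\<in>Ws. c J * monomial n J A))\<^sup>2 \<le> (\<Sum>J\<in>Ws. cmod (c J) * ?i J A)\<^sup>2"
      by (rule power_mono) simp
    also have "\<dots> = (\<Sum>J\<in>Ws. \<Sum>J'\<in>Ws. (cmod (c J) * ?i J A) * (cmod (c J') * ?i J' A))"
      by (simp only: power2_eq_square sum_product)
    also have "\<dots> = (\<Sum>J\<in>Ws. \<Sum>J'\<in>Ws. cmod (c J) * cmod (c J') * (?i J A * ?i J' A))"
      by (intro sum.cong refl) (simp only: mult_ac)
    finally show ?thesis .
  qed
  then have "(\<Sum>A\<in>Pow {1..n}. (cmod (\<Sum>J\<in>Ws. c J * monomial n J A))\<^sup>2)
      \<le> (\<Sum>A\<in>Pow {1..n}. \<Sum>J\<in>Ws. \<Sum>J'\<in>Ws. cmod (c J) * cmod (c J') * (?i J A * ?i J' A))"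
    by (intro sum_mono)
  also have "\<dots> = (\<Sum>J\<in>Ws. \<Sum>A\<in>Pow {1..n}. \<Sum>J'\<in>Ws. cmod (c J) * cmod (c J') * (?i J A * ?i J' A))"
    by (rule sum.swap)
  also have "\<dots> = (\<Sum>J\<in>Ws. \<Sum>J'\<in>Ws. \<Sum>A\<in>Pow {1..n}. cmod (c J) * cmod (c J') * (?i J A * ?i J' A))"
    by (intro sum.cong refl sum.swap)
  also have "\<dots> = (\<Sum>J\<in>Ws. \<Sum>J'\<in>Ws. if odd_letters J' = odd_letters J then cmod (c J) * cmod (c J') else 0)"
  proof (intro sum.cong refl)
    fix J J' assume J: "J \<in> Ws"
    have "odd_letters J \<in> Pow {1..n}" using set[OF J] odd_letters_subset[of J] by auto
    moreover have "(\<Sum>A\<in>Pow {1..n}. ?i J A * ?i J' A) = (\<Sum>A\<in>Pow {1..n}.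
        if A = odd_letters J then if odd_letters J' = odd_letters J then 1 else 0 else 0)"
      by (intro sum.cong refl) simp
    ultimately have "(\<Sum>A\<in>Pow {1..n}. ?i J A * ?i J' A) = (if odd_letters J' = odd_letters J then 1 else 0)"
      by simp
    then show "(\<Sum>A\<in>Pow {1..n}. cmod (c J) * cmod (c J') * (?i J A * ?i J' A)) =
        (if odd_letters J' = odd_letters J then cmod (c J) * cmod (c J') else 0)"
      by (simp only: sum_distrib_left[symmetric]) simp
  qed
  also have "\<dots> = (\<Sum>J\<in>Ws. \<Sum>J'\<in>{J'\<in>Ws. odd_letters J' = odd_letters J}. cmod (c J) * cmod (c J'))"
    by (simp only: sum.inter_filter[OF fin])
  finally show ?thesis
    by (simp add: hs_norm_def L2_set_def sum_nonneg)
qed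

section \<open>Sums of chaoses and null sequences\<close>

definition chaos :: "nat \<Rightarrow> (nat \<Rightarrow> nat list \<Rightarrow> complex) \<Rightarrow> nat \<Rightarrow> nat set vec" where
  "chaos K c n = (\<lambda>A. \<Sum>J\<in>words n K. (of_real (1 / sqrt (real n) ^ K) * c n J) * monomial n J A)"

definition bounded_coeffs :: "nat \<Rightarrow> (nat \<Rightarrow> nat list \<Rightarrow> complex) \<Rightarrow> bool" where
  "bounded_coeffs K c \<longleftrightarrow> (\<exists>C. \<forall>n. \<forall>J\<in>words n K. cmod (c n J) \<le> C)"

lemma chaos_in_space [simp]: "chaos K c n \<in> space n"
  unfolding chaos_def
  by (rule lin_subspace_sum[OF _ monomial_in_space]) (simp add: baby_space_supported_on lin_subspace_supported_on)

text \<open>The scalar \<open>n\<^sup>-\<^sup>K\<^sup>/\<^sup>2\<close> exactly balances the number of pairs of words of length \<open>K\<close> with the same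
  odd letters: the concatenation of such a pair is a word of length \<open>2 K\<close> in which every letter
  occurs an even number of times.\<close>

lemma hs_norm_chaos_le:
  assumes C: "\<And>J. J \<in> words n K \<Longrightarrow> cmod (c n J) \<le> C" and "0 \<le> C"
  shows "(hs_norm n (chaos K c n))\<^sup>2 \<le> C\<^sup>2 * fact (2 * K)"
proof -
  let ?W = "words n K" and ?s = "1 / sqrt (real n) ^ K"
  let ?P = "SIGMA J:?W. {J'\<in>?W. odd_letters J' = odd_letters J}"
  have le: "cmod (of_real ?s * c n J) \<le> ?s * C" if "J \<in> ?W" for J
    using C[OF that] by (simp add: norm_mult norm_divide norm_power divide_right_mono)
  have "(hs_norm n (chaos K c n))\<^sup>2 \<le> (\<Sum>J\<in>?W. \<Sum>J'\<in>{J'\<in>?W. odd_letters J' = odd_letters J}.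
      cmod (of_real ?s * c n J) * cmod (of_real ?s * c n J'))"
    unfolding chaos_def by (rule hs_norm_square_word_sum_le[OF order_refl])
  also have "\<dots> \<le> (\<Sum>J\<in>?W. \<Sum>J'\<in>{J'\<in>?W. odd_letters J' = odd_letters J}. (?s * C) * (?s * C))"
    using \<open>0 \<le> C\<close> by (intro sum_mono mult_mono le) auto
  also have "\<dots> = real (card ?P) * (?s * C)\<^sup>2"
  proof -
    have "card ?P = (\<Sum>J\<in>?W. card {J'\<in>?W. odd_letters J' = odd_letters J})"
      by (rule card_SigmaI) auto
    then show ?thesis by (simp only: sum_constant power2_eq_square of_nat_sum sum_distrib_right)
  qed
  also have "\<dots> \<le> real (fact (2 * K) * n ^ K) * (?s * C)\<^sup>2"
  proof (intro mult_right_mono of_nat_mono)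
    have "(\<lambda>(J, J'). J @ J') ` ?P \<subseteq> even_words n (2 * K)"
      by (auto simp: even_words_def words_def odd_letters_append simp del: atLeastAtMost_iff)
    moreover have "inj_on (\<lambda>(J, J'). J @ J') ?P"
      by (auto simp: inj_on_def words_def)
    moreover have "finite (even_words n (2 * K))" by (simp add: even_words_def)
    ultimately have "card ?P \<le> card (even_words n (2 * K))" by (intro card_inj_on_le)
    then show "card ?P \<le> fact (2 * K) * n ^ K" by (rule order_trans[OF _ card_even_words])
  qed simp
  also have "\<dots> = C\<^sup>2 * fact (2 * K) * (real n ^ K * ?s\<^sup>2)"
    by (simp only: power_mult_distrib of_nat_mult of_nat_fact of_nat_power mult_ac)
  also have "\<dots> \<le> C\<^sup>2 * fact (2 * K) * 1"
  proof (intro mult_left_mono)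
    have "(sqrt (real n) ^ K)\<^sup>2 = real n ^ K"
      by (simp add: power_mult[symmetric] mult.commute[of K 2]) (simp add: power_mult)
    then show "real n ^ K * ?s\<^sup>2 \<le> 1" by (simp add: power_divide)
  qed simp
  finally show ?thesis by simp
qed

text \<open>Sequences of algebra elements that are built from finitely many chaoses of fixed orders with
  coefficients bounded uniformly in \<open>n\<close>.\<close>

inductive good :: "(nat \<Rightarrow> nat set vec) \<Rightarrow> bool" where
  chaos: "bounded_coeffs K c \<Longrightarrow> good (chaos K c)"
| add: "good a \<Longrightarrow> good b \<Longrightarrow> good (\<lambda>n A. a n A + b n A)"

lemma good_in_space: "good a \<Longrightarrow> a n \<in> space n"
proof (induction rule: good.induct)
  case (add a b)
  then show ?case by (simp add: baby_space_def)
qed simp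

lemma good_bounded: "good a \<Longrightarrow> \<exists>C. \<forall>n. hs_norm n (a n) \<le> C"
proof (induction rule: good.induct)
  case (chaos K c)
  then obtain C where C: "\<And>n J. J \<in> words n K \<Longrightarrow> cmod (c n J) \<le> C" by (auto simp: bounded_coeffs_def)
  have "(hs_norm n (chaos K c n))\<^sup>2 \<le> (max 0 C)\<^sup>2 * fact (2 * K)" for n
    by (rule hs_norm_chaos_le) (auto intro: order_trans[OF C])
  then show ?case by (meson real_le_rsqrt)
next
  case (add a b)
  then obtain C D where "\<And>n. hs_norm n (a n) \<le> C" "\<And>n. hs_norm n (b n) \<le> D" by blast
  then have "hs_norm n (\<lambda>A. a n A + b n A) \<le> C + D" for n
    using hs_norm_add[of n "a n" "b n"] by (meson add_mono order_trans)
  then show ?case by blast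
qed

lemma mul_chaos:
  "mul n (chaos K c n) (chaos L d n) = chaos (K + L) (\<lambda>n J. c n (take K J) * d n (drop K J)) n"
proof
  fix A
  let ?s = "\<lambda>K. of_real (1 / sqrt (real n) ^ K) :: complex"
  have "mul n (chaos K c n) (chaos L d n) A =
      (\<Sum>J\<in>words n K. (?s K * c n J) * (\<Sum>J'\<in>words n L. (?s L * d n J') * mul n (monomial n J) (monomial n J') A))"
    unfolding chaos_def baby_mult_sum_left baby_mult_sum_right ..
  also have "\<dots> = (\<Sum>(J, J')\<in>words n K \<times> words n L. (?s (K + L) * (c n J * d n J')) * monomial n (J @ J') A)"
    unfolding sum.cartesian_product[symmetric] sum_distrib_left
    by (intro sum.cong refl) (simp add: monomial_append power_add)
  also have "\<dots> = (\<Sum>J\<in>words n (K + L). (?s (K + L) * (c n (take K J) * d n (drop K J))) * monomial n J A)"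
  proof (rule sum.reindex_bij_witness[where i = "\<lambda>J. (take K J, drop K J)" and j = "\<lambda>(J, J'). J @ J'"])
    fix J assume "J \<in> words n (K + L)"
    then show "(take K J, drop K J) \<in> words n K \<times> words n L"
      using set_take_subset[of K J] set_drop_subset[of K J] by (auto simp: words_def)
  qed (auto simp: words_def)
  finally show "mul n (chaos K c n) (chaos L d n) A = chaos (K + L) (\<lambda>n J. c n (take K J) * d n (drop K J)) n A"
    by (simp add: chaos_def)
qed

lemma star_chaos: "star (chaos K c n) = chaos K (\<lambda>n J. cnj (c n (rev J))) n"
proof
  fix A
  have "star (chaos K c n) A = (\<Sum>J\<in>words n K. cnj (of_real (1 / sqrt (real n) ^ K) * c n J) * star (monomial n J) A)"
    unfolding chaos_def star_sum ..
  also have "\<dots> = (\<Sum>J\<in>words n K. (of_real (1 / sqrt (real n) ^ K) * cnj (c n (rev J))) * monomial n J A)"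
    by (rule sum.reindex_bij_witness[where i = rev and j = rev])
      (auto simp: words_def star_monomial)
  finally show "star (chaos K c n) A = chaos K (\<lambda>n J. cnj (c n (rev J))) n A"
    by (simp add: chaos_def)
qed

lemma good_mul:
  assumes "good a" "good b"
  shows "good (\<lambda>n. mul n (a n) (b n))"
  using assms
proof (induction rule: good.induct)
  case (chaos K c)
  from chaos(2) show ?case
  proof (induction rule: good.induct)
    case (chaos L d)
    obtain C where C: "\<And>n J. J \<in> words n K \<Longrightarrow> cmod (c n J) \<le> C"
      using \<open>bounded_coeffs K c\<close> by (auto simp: bounded_coeffs_def)
    obtain D where D: "\<And>n J. J \<in> words n L \<Longrightarrow> cmod (d n J) \<le> D"
      using \<open>bounded_coeffs L d\<close> by (auto simp: bounded_coeffs_def)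
    have "cmod (c n (take K J) * d n (drop K J)) \<le> C * D" if "J \<in> words n (K + L)" for n J
    proof -
      have "take K J \<in> words n K" "drop K J \<in> words n L"
        using that set_take_subset[of K J] set_drop_subset[of K J] by (auto simp: words_def)
      then show ?thesis
        unfolding norm_mult using C D by (intro mult_mono) (auto intro: order_trans[OF norm_ge_zero])
    qed
    then have "bounded_coeffs (K + L) (\<lambda>n J. c n (take K J) * d n (drop K J))"
      by (auto simp: bounded_coeffs_def)
    then show ?case unfolding mul_chaos by (rule good.chaos)
  next
    case (add a b)
    then show ?case unfolding baby_mult_add_right by (intro good.add)
  qed
next
  case (add a b)
  then show ?case unfolding baby_mult_add_left by (intro good.add)
qed

lemma good_star:
  assumes "good a"
  shows "good (\<lambda>n. star (a n))"
  using assms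
proof (induction rule: good.induct)
  case (chaos K c)
  then obtain C where C: "\<And>n J. J \<in> words n K \<Longrightarrow> cmod (c n J) \<le> C" by (auto simp: bounded_coeffs_def)
  then have "bounded_coeffs K (\<lambda>n J. cnj (c n (rev J)))"
    unfolding bounded_coeffs_def by (intro exI[of _ C]) (simp add: words_def)
  then show ?case unfolding star_chaos by (rule good.chaos)
next
  case (add a b)
  then show ?case unfolding star_add by (intro good.add)
qed

lemma good_unit: "good (\<lambda>n. unit)"
proof -
  have "words n 0 = {[]}" for n by (auto simp: words_def)
  then have "(\<lambda>n. unit) = chaos 0 (\<lambda>_ _. 1)" by (intro ext) (simp add: chaos_def)
  then show ?thesis using good.chaos[of 0 "\<lambda>_ _. 1"] by (auto simp: bounded_coeffs_def)
qed

lemma good_scale: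
  assumes "good a"
  shows "good (\<lambda>n A. z * a n A)"
proof -
  have "words n 0 = {[]}" for n by (auto simp: words_def)
  then have "(\<lambda>n A. z * a n A) = (\<lambda>n. mul n (chaos 0 (\<lambda>_ _. z) n) (a n))"
    using good_in_space[OF assms] by (simp add: chaos_def baby_mult_scale_left)
  moreover have "good (chaos 0 (\<lambda>_ _. z))"
    by (rule good.chaos) (auto simp: bounded_coeffs_def)
  ultimately show ?thesis using good_mul[OF _ assms] by simp
qed

lemma good_diff:
  assumes "good a" "good b"
  shows "good (\<lambda>n A. a n A - b n A)"
  using good.add[OF assms(1) good_scale[OF assms(2), of "-1"]] by simp

definition null :: "(nat \<Rightarrow> nat set vec) \<Rightarrow> bool" where
  "null e \<longleftrightarrow> good e \<and> (\<lambda>n. hs_norm n (e n)) \<longlonglongrightarrow> 0"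

lemma nullI:
  assumes "good e" "(\<lambda>n. (hs_norm n (e n))\<^sup>2) \<longlonglongrightarrow> 0"
  shows "null e"
  using tendsto_real_sqrt[OF assms(2)] assms(1) by (simp add: null_def)

text \<open>The estimate \<open>\<parallel>a e\<parallel>\<^sup>2 \<le> \<parallel>e\<parallel> \<parallel>a\<^sup>*a e\<parallel>\<close> replaces Hoelder's inequality: the second factor
  stays bounded because \<open>a\<^sup>*a e\<close> is again a sum of chaoses of fixed orders.\<close>

lemma null_mul_left:
  assumes "good a" "null e"
  shows "null (\<lambda>n. mul n (a n) (e n))"
proof (rule nullI)
  have e: "good e" "(\<lambda>n. hs_norm n (e n)) \<longlonglongrightarrow> 0" using assms(2) by (auto simp: null_def)
  show "good (\<lambda>n. mul n (a n) (e n))" by (rule good_mul[OF assms(1) e(1)])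
  obtain C where C: "\<And>n. hs_norm n (mul n (mul n (star (a n)) (a n)) (e n)) \<le> C"
    using good_bounded[OF good_mul[OF good_mul[OF good_star[OF assms(1)] assms(1)] e(1)]] by blast
  show "(\<lambda>n. (hs_norm n (mul n (a n) (e n)))\<^sup>2) \<longlonglongrightarrow> 0"
  proof (rule tendsto_sandwich[OF _ _ tendsto_const])
    show "\<forall>\<^sub>F n in sequentially. (hs_norm n (mul n (a n) (e n)))\<^sup>2 \<le> hs_norm n (e n) * C"
      by (intro always_eventually allI order_trans[OF hs_norm_mul_square_le] mult_left_mono C hs_norm_nonneg)
    show "(\<lambda>n. hs_norm n (e n) * C) \<longlonglongrightarrow> 0" by (rule tendsto_mult_left_zero[OF e(2)])
  qed auto
qed

lemma null_star:
  assumes "null e"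
  shows "null (\<lambda>n. star (e n))"
  using assms good_star by (simp add: null_def)

lemma null_mul_right:
  assumes "null e" "good b"
  shows "null (\<lambda>n. mul n (e n) (b n))"
proof -
  have "mul n (e n) (b n) = star (mul n (star (b n)) (star (e n)))" for n
  proof -
    have "e n \<in> space n" "b n \<in> space n" using assms good_in_space by (auto simp: null_def)
    then show ?thesis by (simp only: star_mul star_star)
  qed
  then show ?thesis
    using null_star[OF null_mul_left[OF good_star[OF assms(2)] null_star[OF assms(1)]]] by simp
qed

lemma null_add:
  assumes "null a" "null b"
  shows "null (\<lambda>n A. a n A + b n A)"
proof -
  have "(\<lambda>n. hs_norm n (\<lambda>A. a n A + b n A)) \<longlonglongrightarrow> 0"
  proof (rule tendsto_sandwich[OF _ _ tendsto_const])
    show "(\<lambda>n. hs_norm n (a n) + hs_norm n (b n)) \<longlonglongrightarrow> 0"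
      using assms tendsto_add[of "\<lambda>n. hs_norm n (a n)" 0 sequentially "\<lambda>n. hs_norm n (b n)" 0]
      by (simp add: null_def)
  qed (auto intro: hs_norm_add always_eventually)
  then show ?thesis using assms good.add by (simp add: null_def)
qed

lemma null_scale:
  assumes "null a"
  shows "null (\<lambda>n A. z * a n A)"
  using assms good_scale tendsto_mult_right_zero[of "\<lambda>n. hs_norm n (a n)" sequentially "cmod z"]
  by (simp add: null_def hs_norm_scale)

lemma null_diff:
  assumes "null a" "null b"
  shows "null (\<lambda>n A. a n A - b n A)"
  using null_add[OF assms(1) null_scale[OF assms(2), of "-1"]] by simp

lemma null_zero: "null (\<lambda>n A. 0)"
  using good_scale[OF good_unit, of 0] by (simp add: null_def hs_norm_def L2_set_def)

lemma null_eventually_cong: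
  assumes "null a" "good b" "\<forall>\<^sub>F n in sequentially. a n = b n"
  shows "null b"
proof -
  have "\<forall>\<^sub>F n in sequentially. hs_norm n (a n) = hs_norm n (b n)" using assms(3) by eventually_elim simp
  with assms(1) have "(\<lambda>n. hs_norm n (b n)) \<longlonglongrightarrow> 0"
    unfolding null_def by (blast intro: Lim_transform_eventually)
  then show ?thesis using assms(2) by (simp add: null_def)
qed

lemma null_vacuum_component:
  assumes "null e"
  shows "(\<lambda>n. e n {}) \<longlonglongrightarrow> 0"
  by (rule Lim_null_comparison[of _ "\<lambda>n. hs_norm n (e n)"])
    (use assms vacuum_component_le_hs_norm in \<open>auto simp: null_def\<close>)

lemma null_mul_diff:
  assumes "good a" "good b'" "null (\<lambda>n A. a n A - b n A)" "null (\<lambda>n A. a' n A - b' n A)"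
  shows "null (\<lambda>n A. mul n (a n) (a' n) A - mul n (b n) (b' n) A)"
proof -
  have "mul n x x' A - mul n y y' A = mul n x (\<lambda>A. x' A - y' A) A + mul n (\<lambda>A. x A - y A) y' A"
    for n x x' y y' A
    by (simp add: baby_mult_diff_left baby_mult_diff_right)
  then show ?thesis
    using null_add[OF null_mul_left[OF assms(1,4)] null_mul_right[OF assms(3,2)]] by simp
qed

section \<open>The operators \<open>X\<^sub>n\<^sub>,\<^sub>k\<close> and their recursion\<close>

definition distinct_chaos :: "nat \<Rightarrow> (nat \<Rightarrow> nat list \<Rightarrow> real) \<Rightarrow> nat \<Rightarrow> nat set vec" where
  "distinct_chaos k c = chaos k (\<lambda>n J. if distinct J then of_real (c n J) else 0)"

definition X_chaos :: "nat \<Rightarrow> nat \<Rightarrow> nat set vec" where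
  "X_chaos k = distinct_chaos k (\<lambda>n J. 1)"

definition Y_chaos :: "real \<Rightarrow> nat \<Rightarrow> nat \<Rightarrow> nat set vec" where
  "Y_chaos q k = distinct_chaos k (baby_weight q \<epsilon>)"

text \<open>The part of \<open>X\<^sub>k\<^sub>+\<^sub>1 X\<^sub>1\<close> in which the letter of \<open>X\<^sub>1\<close> meets its copy in \<open>X\<^sub>k\<^sub>+\<^sub>1\<close>; it is \<open>[k+1]\<^sub>q Y\<^sub>k\<close>
  whenever \<open>[k+1]\<^sub>q \<noteq> 0\<close>.\<close>

definition contraction :: "nat \<Rightarrow> nat \<Rightarrow> nat set vec" where
  "contraction k = distinct_chaos k (baby_Z \<epsilon>)"

lemma distinct_tuples_words: "distinct_tuples n k = {J\<in>words n k. distinct J}"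
  by (auto simp: distinct_tuples_def words_def)

lemma distinct_chaos_sum:
  "distinct_chaos k c n = (\<lambda>A. \<Sum>J\<in>distinct_tuples n k.
     of_real (1 / sqrt (real n) ^ k * c n J) * monomial n J A)"
  unfolding distinct_chaos_def chaos_def distinct_tuples_words sum.inter_filter[OF finite_words]
  by (intro ext sum.cong refl) simp

lemma distinct_chaos_in_space [simp]: "distinct_chaos k c n \<in> space n"
  by (simp add: distinct_chaos_def)

lemma X_chaos_in_space [simp]: "X_chaos k n \<in> space n"
  by (simp add: X_chaos_def)

lemma powr_half_eq_sqrt_power:
  assumes "1 \<le> k"
  shows "real n powr (real k / 2) = sqrt (real n) ^ k"
proof (cases "n = 0")
  case False
  then have "sqrt (real n) ^ k = (real n powr (1 / 2)) powr real k"
    by (simp add: powr_half_sqrt powr_realpow)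
  then show ?thesis by (simp add: powr_powr)
qed (use assms in simp)

lemma op_sum_distinct_tuples:
  assumes "1 \<le> k" "x \<in> space n"
  shows "op_sum (distinct_tuples n k) (\<lambda>J. of_real (1 / real n powr (real k / 2) * c n J))
      (op_prod (baby_gamma {1..n} \<epsilon>)) x = mul n (distinct_chaos k c n) x"
  unfolding op_sum_def distinct_chaos_sum baby_mult_sum_left op_prod_gamma[OF assms(2)]
    powr_half_eq_sqrt_power[OF assms(1)] ..

lemma baby_X_mul:
  assumes "1 \<le> k" "x \<in> space n"
  shows "baby_X \<epsilon> n k x = mul n (X_chaos k n) x"
  using op_sum_distinct_tuples[OF assms, of "\<lambda>n J. 1"] by (simp add: baby_X_def X_chaos_def)

lemma baby_Y_mul:
  assumes "1 \<le> k" "x \<in> space n"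
  shows "baby_Y q \<epsilon> n k x = mul n (Y_chaos q k n) x"
  using op_sum_distinct_tuples[OF assms, of "baby_weight q \<epsilon>"] by (simp add: baby_Y_def Y_chaos_def)

lemma good_distinct_chaos:
  assumes "\<And>n J. J \<in> words n k \<Longrightarrow> \<bar>c n J\<bar> \<le> C"
  shows "good (distinct_chaos k c)"
proof -
  have "cmod (if distinct J then of_real (c n J) else 0) \<le> max 0 C" if "J \<in> words n k" for n J
    using assms[OF that] by auto
  then show ?thesis
    unfolding distinct_chaos_def by (intro good.chaos) (unfold bounded_coeffs_def, blast)
qed

lemma sign_values:
  assumes "i \<in> {1..n}" "j \<in> {1..n}"
  shows "\<epsilon> i j \<in> {-1, 1}" "\<epsilon> i j = \<epsilon> j i" "\<epsilon> i i = -1"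
  using assms sign by (auto simp: sign_function_def)

lemma abs_baby_Z_le:
  assumes "J \<in> words n k"
  shows "\<bar>baby_Z \<epsilon> n J\<bar> \<le> real (k + 1)"
proof -
  have abs1: "\<bar>\<Prod>j\<leftarrow>K. real_of_int (\<epsilon> i j)\<bar> = 1" if "i \<in> {1..n}" "set K \<subseteq> {1..n}" for i K
    using that(2)
  proof (induction K)
    case (Cons j K)
    then have "\<bar>real_of_int (\<epsilon> i j)\<bar> = 1" using sign_values(1)[OF that(1), of j] by auto
    then show ?case using Cons by (simp add: abs_mult)
  qed simp
  have 1: "\<bar>\<Prod>j\<leftarrow>drop l J. real_of_int (\<epsilon> i j)\<bar> = 1" if "i \<in> {1..n}" for i l
  proof (rule abs1[OF that])
    show "set (drop l J) \<subseteq> {1..n}"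
      using assms set_drop_subset[of l J] unfolding words_def by blast
  qed
  have "\<bar>\<Sum>i\<in>{1..n} - set J. \<Sum>l\<le>length J. \<Prod>j\<leftarrow>drop l J. real_of_int (\<epsilon> i j)\<bar>
      \<le> (\<Sum>i\<in>{1..n} - set J. real (k + 1))"
  proof (rule sum_norm_le[where 'a = real, unfolded real_norm_def])
    fix i assume i: "i \<in> {1..n} - set J"
    have "\<bar>\<Sum>l\<le>length J. \<Prod>j\<leftarrow>drop l J. real_of_int (\<epsilon> i j)\<bar> \<le> (\<Sum>l\<le>length J. 1)"
      by (rule sum_norm_le[where 'a = real, unfolded real_norm_def]) (use i 1 in simp)
    then show "\<bar>\<Sum>l\<le>length J. \<Prod>j\<leftarrow>drop l J. real_of_int (\<epsilon> i j)\<bar> \<le> real (k + 1)"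
      using assms by (simp add: words_def)
  qed
  also have "\<dots> \<le> real n * real (k + 1)"
    using card_mono[of "{1..n}" "{1..n} - set J"] by (simp add: mult_right_mono)
  finally have "\<bar>\<Sum>i\<in>{1..n} - set J. \<Sum>l\<le>length J. \<Prod>j\<leftarrow>drop l J. real_of_int (\<epsilon> i j)\<bar>
      \<le> real n * real (k + 1)" .
  then have "1 / real n * \<bar>\<Sum>i\<in>{1..n} - set J. \<Sum>l\<le>length J. \<Prod>j\<leftarrow>drop l J. real_of_int (\<epsilon> i j)\<bar>
      \<le> 1 / real n * (real n * real (k + 1))"
    by (intro mult_left_mono) auto
  also have "\<dots> \<le> real (k + 1)" by simp
  finally show ?thesis by (simp add: baby_Z_def abs_mult)
qed

lemma good_X_chaos: "good (X_chaos k)"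
  unfolding X_chaos_def by (rule good_distinct_chaos[of _ _ 1]) simp

lemma good_contraction: "good (contraction k)"
  unfolding contraction_def by (rule good_distinct_chaos[OF abs_baby_Z_le])

lemma good_Y_chaos: "good (Y_chaos q k)"
  unfolding Y_chaos_def
proof (rule good_distinct_chaos)
  fix n J assume J: "J \<in> words n k"
  have "\<bar>inverse (qint q (k + 1)) * baby_Z \<epsilon> n J\<bar> \<le> \<bar>inverse (qint q (k + 1))\<bar> * real (k + 1)"
    unfolding abs_mult by (intro mult_left_mono abs_baby_Z_le[OF J]) simp
  then show "\<bar>baby_weight q \<epsilon> n J\<bar> \<le> max 1 (\<bar>inverse (qint q (k + 1))\<bar> * real (k + 1))"
    using J by (auto simp: baby_weight_def words_def)
qed

lemma contraction_eq_Y_chaos: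
  assumes "qint q (k + 1) \<noteq> 0"
  shows "contraction k n A = of_real (qint q (k + 1)) * Y_chaos q k n A"
  unfolding contraction_def Y_chaos_def distinct_chaos_sum sum_distrib_left
proof (intro sum.cong refl)
  fix J assume "J \<in> distinct_tuples n k"
  then have "qint q (k + 1) * baby_weight q \<epsilon> n J = baby_Z \<epsilon> n J"
    using assms by (simp add: baby_weight_def distinct_tuples_def)
  then have "(of_real (baby_Z \<epsilon> n J) :: complex) = of_real (qint q (k + 1)) * of_real (baby_weight q \<epsilon> n J)"
    by (metis of_real_mult)
  then show "of_real (1 / sqrt (real n) ^ k * baby_Z \<epsilon> n J) * monomial n J A =
      of_real (qint q (k + 1)) * (of_real (1 / sqrt (real n) ^ k * baby_weight q \<epsilon> n J) * monomial n J A)"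
    by simp
qed

lemma letter_square:
  assumes "i \<in> {1..n}"
  shows "mul n (baby_basis {i}) (baby_basis {i}) = unit"
proof
  fix A
  have "mul n (baby_basis {i}) (baby_basis {i}) A
      - of_int (\<epsilon> i i) * mul n (baby_basis {i}) (baby_basis {i}) A = 2 * unit A"
    using baby_relations[OF sign, of "{1..n}" i i A] assms by simp
  then show "mul n (baby_basis {i}) (baby_basis {i}) A = unit A"
    using sign_values(3)[OF assms assms] by simp
qed

lemma letters_swap:
  assumes "i \<in> {1..n}" "j \<in> {1..n}" "i \<noteq> j"
  shows "mul n (baby_basis {i}) (baby_basis {j}) = (\<lambda>A. of_int (\<epsilon> i j) * mul n (baby_basis {j}) (baby_basis {i}) A)"
proof
  fix A
  show "mul n (baby_basis {i}) (baby_basis {j}) A = of_int (\<epsilon> i j) * mul n (baby_basis {j}) (baby_basis {i}) A"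
    using baby_relations[OF sign, of "{1..n}" i j A] assms by simp
qed

lemma monomial_swap:
  assumes "i \<in> {1..n}" "j \<in> {1..n}" "i \<noteq> j"
  shows "monomial n (i # j # J) = (\<lambda>A. of_int (\<epsilon> i j) * monomial n (j # i # J) A)"
  by (simp add: mul_assoc[symmetric] letters_swap[OF assms] baby_mult_scale_left)

text \<open>Moving the first letter past \<open>J\<close> collects the signs until it meets its copy, and then \<open>x\<^sub>i\<^sup>2 = 1\<close>.\<close>

lemma monomial_conjugate:
  assumes "i \<in> {1..n}" "set J \<subseteq> {1..n}" "i \<notin> set J"
  shows "monomial n (i # J @ [i]) = (\<lambda>A. of_int (\<Prod>j\<leftarrow>J. \<epsilon> i j) * monomial n J A)"
  using assms(2,3)
proof (induction J)
  case Nil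
  have "baby_basis {i} \<in> space n" using assms(1) by (intro baby_basis_in_space) simp
  then show ?case using letter_square[OF assms(1)] by simp
next
  case (Cons j J)
  have "monomial n (i # (j # J) @ [i]) = (\<lambda>A. of_int (\<epsilon> i j) * monomial n (j # i # J @ [i]) A)"
    using monomial_swap[of i n j "J @ [i]"] Cons.prems assms(1) by simp
  also have "monomial n (j # i # J @ [i]) = mul n (baby_basis {j}) (monomial n (i # J @ [i]))"
    by simp
  also have "monomial n (i # J @ [i]) = (\<lambda>A. of_int (\<Prod>j\<leftarrow>J. \<epsilon> i j) * monomial n J A)"
    using Cons by simp
  finally show ?case by (simp add: baby_mult_scale_right mult.assoc)
qed

lemma monomial_contract:
  assumes "i \<in> {1..n}" "set J \<subseteq> {1..n}" "i \<notin> set J"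
  shows "monomial n (take p J @ i # drop p J @ [i]) =
    (\<lambda>A. of_int (\<Prod>j\<leftarrow>drop p J. \<epsilon> i j) * monomial n J A)"
proof -
  have d: "set (drop p J) \<subseteq> {1..n}" "i \<notin> set (drop p J)"
    using assms set_drop_subset[of p J] by auto
  have "monomial n (take p J @ i # drop p J @ [i]) = mul n (monomial n (take p J)) (monomial n (i # drop p J @ [i]))"
    by (rule monomial_append)
  also have "\<dots> = (\<lambda>A. of_int (\<Prod>j\<leftarrow>drop p J. \<epsilon> i j) * monomial n (take p J @ drop p J) A)"
    unfolding monomial_conjugate[OF assms(1) d] baby_mult_scale_right monomial_append ..
  finally show ?thesis by simp
qed

text \<open>The product runs over tuples of \<open>l + 1\<close> distinct letters followed by a further letter. If the further
  letter is new, the term belongs to \<open>X\<^sub>l\<^sub>+\<^sub>2\<close>. Otherwise removing both copies of it leaves a distinct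
  \<open>l\<close>-tuple \<open>J\<close>, and the term is recovered from \<open>J\<close>, the removed letter \<open>i \<notin> J\<close> and the position \<open>p \<le> l\<close> at
  which it stood. Its sign is the product of the \<open>\<epsilon>(i,j)\<close> over the letters \<open>j\<close> after this position,
  which are the summands of \<open>Z\<close>.\<close>

lemma X_chaos_mul_X1:
  "mul n (X_chaos (Suc l) n) (X_chaos 1 n) = (\<lambda>A. X_chaos (Suc (Suc l)) n A + contraction l n A)"
proof
  fix A
  let ?s = "of_real (1 / sqrt (real n) ^ Suc (Suc l)) :: complex"
  define T where "T = {J\<in>words n (Suc (Suc l)). distinct (take (Suc l) J)}"
  (* f inserts the letter i at position p and appends its copy; g removes the last letter and the
     first occurrence of it. *)
  define f where "f = (\<lambda>(J, i, p). take p J @ i # drop p J @ [i :: nat])"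
  define g where "g K = (let i = last K; p = length (takeWhile (\<lambda>x. x \<noteq> i) K) in
      (take p K @ drop (p + 1) (butlast K), i, p))" for K :: "nat list"
  define D where "D = (SIGMA J:distinct_tuples n l. ({1..n} - set J) \<times> {..l})"
  have finT: "finite T" by (simp add: T_def)
  have "mul n (X_chaos (Suc l) n) (X_chaos 1 n) A = (\<Sum>J\<in>T. ?s * monomial n J A)"
  proof -
    have "distinct (drop (Suc l) J)" if "J \<in> words n (Suc (Suc l))" for J
    proof -
      have "length (drop (Suc l) J) = 1" using that by (simp add: words_def)
      then show ?thesis by (metis One_nat_def length_0_conv length_Suc_conv distinct_singleton)
    qed
    then show ?thesis
      unfolding X_chaos_def distinct_chaos_def mul_chaos
      unfolding T_def sum.inter_filter[OF finite_words] chaos_def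
      by (intro sum.cong) (auto simp: One_nat_def)
  qed
  also have "\<dots> = (\<Sum>J\<in>distinct_tuples n (Suc (Suc l)). ?s * monomial n J A)
      + (\<Sum>J\<in>{J\<in>T. \<not> distinct J}. ?s * monomial n J A)"
  proof -
    have "distinct_tuples n (Suc (Suc l)) = {J\<in>T. distinct J}"
      by (auto simp: distinct_tuples_words T_def)
    then show ?thesis
      using finT by (subst sum.union_disjoint[symmetric]) (auto intro!: sum.cong)
  qed
  also have "(\<Sum>J\<in>{J\<in>T. \<not> distinct J}. ?s * monomial n J A) = (\<Sum>d\<in>D. ?s * monomial n (f d) A)"
  proof (rule sum.reindex_bij_witness[where i = f and j = g])
    fix K assume K: "K \<in> {J\<in>T. \<not> distinct J}"
    define i where "i = last K"
    have "K \<noteq> []" using K by (auto simp: T_def words_def)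
    then have Ki: "K = butlast K @ [i]" by (simp add: i_def)
    have d0: "distinct (butlast K)"
      using K by (simp add: T_def words_def butlast_conv_take)
    then have "i \<in> set (butlast K)" using K by (subst (asm) Ki) simp
    then obtain J1 J2 where J12: "butlast K = J1 @ i # J2" "i \<notin> set J1"
      by (meson split_list_first)
    then have K12: "K = J1 @ i # J2 @ [i]" using Ki by simp
    have "takeWhile (\<lambda>x. x \<noteq> i) K = J1"
      unfolding K12 using J12(2) by (simp add: takeWhile_append takeWhile_eq_all_conv)
    then have gK: "g K = (J1 @ J2, i, length J1)"
      by (simp add: g_def i_def[symmetric] J12(1) K12 butlast_append One_nat_def)
    show fg: "f (g K) = K" unfolding gK by (simp add: f_def K12)
    show "?s * monomial n (f (g K)) A = ?s * monomial n K A" unfolding fg ..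
    show "g K \<in> D"
      using K d0 unfolding gK D_def by (auto simp: distinct_tuples_def T_def words_def K12)
  next
    fix d assume "d \<in> D"
    then obtain J i p where d: "d = (J, i, p)" and J: "J \<in> distinct_tuples n l"
      and i: "i \<in> {1..n}" "i \<notin> set J" and p: "p \<le> l" by (auto simp: D_def)
    have len: "length J = l" and dis: "distinct J" and set: "set J \<subseteq> {1..n}"
      using J by (auto simp: distinct_tuples_def)
    have "i \<notin> set (take p J)" using i set_take_subset[of p J] by auto
    then have "takeWhile (\<lambda>x. x \<noteq> i) (f d) = take p J"
      by (simp add: d f_def takeWhile_append takeWhile_eq_all_conv)
    moreover have "last (f d) = i" "butlast (f d) = take p J @ i # drop p J"
      by (simp_all add: d f_def butlast_append)
    ultimately show "g (f d) = d"
      using p len by (simp add: g_def Let_def d) (simp add: f_def One_nat_def)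
    have "set (f d) \<subseteq> {1..n}"
      using i set set_take_subset[of p J] set_drop_subset[of p J] by (auto simp: d f_def)
    moreover have "length (f d) = Suc (Suc l)" using p len by (simp add: d f_def)
    moreover have "take (Suc l) (f d) = take p J @ i # drop p J"
      using p len by (simp add: d f_def Suc_diff_le)
    moreover have "distinct (take p J @ i # drop p J)"
    proof -
      show ?thesis
        using i(2) dis set_take_disj_set_drop_if_distinct[OF dis order_refl, of p]
          in_set_takeD[of i p J] in_set_dropD[of i p J] by auto
    qed
    moreover have "\<not> distinct (f d)" by (simp add: d f_def)
    ultimately show "f d \<in> {J\<in>T. \<not> distinct J}" by (simp add: T_def words_def)
  qed
  also have "(\<Sum>d\<in>D. ?s * monomial n (f d) A) = contraction l n A"
  proof -
    have s: "?s = of_real (1 / sqrt (real n) ^ l) * of_real (1 / real n)"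
    proof -
      have "1 / sqrt (real n) ^ Suc (Suc l) = (1 / sqrt (real n) ^ l) * (1 / real n)"
        by (simp add: mult.assoc[symmetric])
      then show ?thesis by (simp only: of_real_mult)
    qed
    have "(\<Sum>d\<in>D. ?s * monomial n (f d) A) =
        (\<Sum>J\<in>distinct_tuples n l. \<Sum>(i, p)\<in>({1..n} - set J) \<times> {..l}. ?s * monomial n (f (J, i, p)) A)"
      unfolding D_def by (subst sum.Sigma) (auto simp: distinct_tuples_words split_def)
    also have "\<dots> = (\<Sum>J\<in>distinct_tuples n l. of_real (1 / sqrt (real n) ^ l * baby_Z \<epsilon> n J) * monomial n J A)"
    proof (rule sum.cong[OF refl])
      fix J assume J: "J \<in> distinct_tuples n l"
      have len: "length J = l" and set: "set J \<subseteq> {1..n}"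
        using J by (auto simp: distinct_tuples_def)
      have "(\<Sum>(i, p)\<in>({1..n} - set J) \<times> {..l}. ?s * monomial n (f (J, i, p)) A) =
          (\<Sum>i\<in>{1..n} - set J. \<Sum>p\<le>l. ?s * monomial n (f (J, i, p)) A)"
        by (rule sum.cartesian_product[symmetric])
      also have "\<dots> = (\<Sum>i\<in>{1..n} - set J. \<Sum>p\<le>l. of_real (\<Prod>j\<leftarrow>drop p J. real_of_int (\<epsilon> i j)) * (?s * monomial n J A))"
      proof (intro sum.cong refl)
        fix i p assume "i \<in> {1..n} - set J"
        then have "monomial n (f (J, i, p)) A = of_int (\<Prod>j\<leftarrow>drop p J. \<epsilon> i j) * monomial n J A"
          using monomial_contract[of i n J p] set by (simp add: f_def)
        moreover have "(of_int (\<Prod>j\<leftarrow>K. \<epsilon> i j) :: complex) = of_real (\<Prod>j\<leftarrow>K. real_of_int (\<epsilon> i j))" for K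
          by (induction K) simp_all
        ultimately show "?s * monomial n (f (J, i, p)) A =
            of_real (\<Prod>j\<leftarrow>drop p J. real_of_int (\<epsilon> i j)) * (?s * monomial n J A)"
          by simp
      qed
      also have "\<dots> = of_real (\<Sum>i\<in>{1..n} - set J. \<Sum>p\<le>l. \<Prod>j\<leftarrow>drop p J. real_of_int (\<epsilon> i j)) * (?s * monomial n J A)"
        by (simp only: sum_distrib_right of_real_sum)
      also have "\<dots> = of_real (1 / sqrt (real n) ^ l * baby_Z \<epsilon> n J) * monomial n J A"
        unfolding s by (simp add: baby_Z_def len)
      finally show "(\<Sum>(i, p)\<in>({1..n} - set J) \<times> {..l}. ?s * monomial n (f (J, i, p)) A) =
          of_real (1 / sqrt (real n) ^ l * baby_Z \<epsilon> n J) * monomial n J A" .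
    qed
    also have "\<dots> = contraction l n A"
      by (simp add: contraction_def distinct_chaos_sum)
    finally show ?thesis .
  qed
  finally show "mul n (X_chaos (Suc l) n) (X_chaos 1 n) A = X_chaos (Suc (Suc l)) n A + contraction l n A"
    by (simp add: X_chaos_def distinct_chaos_sum)
qed

section \<open>Approximation by Hermite polynomials\<close>

lemma X_chaos_0: "X_chaos 0 n = unit"
proof -
  have "distinct_tuples n 0 = {[]}" by (auto simp: distinct_tuples_def)
  then show ?thesis by (simp add: X_chaos_def distinct_chaos_sum)
qed

lemma contraction_0: "n \<noteq> 0 \<Longrightarrow> contraction 0 n = unit"
proof -
  assume "n \<noteq> 0"
  moreover have "distinct_tuples n 0 = {[]}" by (auto simp: distinct_tuples_def)
  ultimately show ?thesis by (simp add: contraction_def distinct_chaos_sum baby_Z_def)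
qed

lemma star_X_chaos: "star (X_chaos k n) = X_chaos k n"
  unfolding X_chaos_def distinct_chaos_def star_chaos by (simp add: if_distrib[of cnj] cong: if_cong)

lemma X1_mul_X_chaos: "mul n (X_chaos 1 n) (X_chaos (Suc l) n) = (\<lambda>A. X_chaos (Suc (Suc l)) n A + star (contraction l n) A)"
  using arg_cong[OF X_chaos_mul_X1[of n l], of star] by (simp add: star_mul star_add star_X_chaos)

definition hermite_X :: "real \<Rightarrow> nat \<Rightarrow> nat \<Rightarrow> nat set vec" where
  "hermite_X q k n = op_poly (q_hermite q k) (mul n (X_chaos 1 n)) unit"

lemma mul_linear: "linear_on_subspace (space n) (mul n x)"
  by (rule linear_on_subspace_baby_mult) simp

lemma hermite_X_simps:
  "hermite_X q 0 n = unit"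
  "hermite_X q (Suc 0) n = X_chaos 1 n"
  "hermite_X q (Suc (Suc k)) n =
    (\<lambda>A. mul n (X_chaos 1 n) (hermite_X q (Suc k) n) A - of_real (qint q (Suc k)) * hermite_X q k n A)"
proof -
  show "hermite_X q 0 n = unit" by (simp add: hermite_X_def op_poly_1)
  show "hermite_X q (Suc 0) n = X_chaos 1 n"
    by (simp add: hermite_X_def op_poly_x[OF mul_linear unit_in_space])
  have "q_hermite q (Suc (Suc k)) =
      pCons 0 (q_hermite q (Suc k)) + smult (- of_real (qint q (Suc k))) (q_hermite q k)"
    by simp
  then show "hermite_X q (Suc (Suc k)) n =
    (\<lambda>A. mul n (X_chaos 1 n) (hermite_X q (Suc k) n) A - of_real (qint q (Suc k)) * hermite_X q k n A)"
    unfolding hermite_X_def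
    by (simp only: op_poly_add op_poly_smult op_poly_pCons_0[OF mul_linear unit_in_space]) simp
qed

lemma good_hermite_X: "good (hermite_X q k)"
proof (induction q k rule: q_hermite.induct)
  case (1 q)
  then show ?case using good_unit hermite_X_simps(1)[abs_def] by (simp add: fun_eq_iff[symmetric])
next
  case (2 q)
  have "hermite_X q (Suc 0) = X_chaos 1" by (rule ext) (rule hermite_X_simps)
  then show ?case by (simp add: good_X_chaos)
next
  case (3 q k)
  then show ?case
    using good_diff[OF good_mul[OF good_X_chaos] good_scale] hermite_X_simps(3) by presburger
qed

text \<open>The \<open>q\<close>-Hermite polynomials multiply by \<open>X\<^sub>1\<close> on the left, so the recursion is used in its adjoint form
  \<open>X\<^sub>1 X\<^sub>k\<^sub>+\<^sub>1 = X\<^sub>k\<^sub>+\<^sub>2 + Z\<^sup>*\<close>.\<close>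

lemma X_chaos_minus_hermite_X_null:
  assumes Z: "\<And>l. null (\<lambda>n A. contraction l n A - of_real (qint q (Suc l)) * X_chaos l n A)"
  shows "null (\<lambda>n A. X_chaos k n A - hermite_X q k n A)"
proof (induction k rule: induct_nat_012)
  case 0
  then show ?case by (simp add: X_chaos_0 hermite_X_simps null_zero)
next
  case 1
  show ?case unfolding hermite_X_simps(2) One_nat_def by (simp add: null_zero)
next
  case (ge2 k)
  let ?a = "\<lambda>n. mul n (X_chaos 1 n) (\<lambda>A. X_chaos (Suc k) n A - hermite_X q (Suc k) n A)"
  let ?b = "\<lambda>n. star (\<lambda>A. contraction k n A - of_real (qint q (Suc k)) * X_chaos k n A)"
  let ?c = "\<lambda>n A. of_real (qint q (Suc k)) * (X_chaos k n A - hermite_X q k n A)"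
  have "X_chaos (Suc (Suc k)) n A - hermite_X q (Suc (Suc k)) n A = ?a n A - ?b n A - ?c n A" for n A
  proof -
    have "?b n A = star (contraction k n) A - of_real (qint q (Suc k)) * star (X_chaos k n) A"
      by (simp add: baby_star_def right_diff_distrib mult_ac)
    moreover have "?a n A = X_chaos (Suc (Suc k)) n A + star (contraction k n) A - mul n (X_chaos 1 n) (hermite_X q (Suc k) n) A"
      by (simp only: baby_mult_diff_right X1_mul_X_chaos)
    ultimately show ?thesis
      by (simp add: hermite_X_simps star_X_chaos right_diff_distrib)
  qed
  moreover have "null (\<lambda>n A. ?a n A - ?b n A - ?c n A)"
    by (intro null_diff null_mul_left[OF good_X_chaos ge2(2)] null_star[OF Z] null_scale[OF ge2(1)])
  ultimately show ?case by simp
qed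

section \<open>The case \<open>q = -1\<close>\<close>

text \<open>The proportion of the pairs of commuting letters, up to a factor 2.\<close>

definition commuting_density :: "nat \<Rightarrow> real" where
  "commuting_density n = (\<Sum>i\<in>{1..n}. \<Sum>j\<in>{1..n} - {i}. 1 + real_of_int (\<epsilon> i j)) / (real n)\<^sup>2"

lemma chaos_2_vacuum_component:
  "chaos 2 c n {} = of_real (1 / real n) * (\<Sum>i\<in>{1..n}. c n [i, i])"
proof -
  have "chaos 2 c n {} = (\<Sum>J\<in>words n 2. (of_real (1 / sqrt (real n) ^ 2) * c n J) * monomial n J {})"
    by (simp add: chaos_def)
  also have "\<dots> = (\<Sum>J\<in>(\<lambda>i. [i, i]) ` {1..n}. (of_real (1 / sqrt (real n) ^ 2) * c n J) * monomial n J {})"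
  proof (rule sum.mono_neutral_right)
    show "(\<lambda>i. [i, i]) ` {1..n} \<subseteq> words n 2" by (auto simp: words_def)
    show "\<forall>J\<in>words n 2 - (\<lambda>i. [i, i]) ` {1..n}. (of_real (1 / sqrt (real n) ^ 2) * c n J) * monomial n J {} = 0"
    proof
      fix J assume J: "J \<in> words n 2 - (\<lambda>i. [i, i]) ` {1..n}"
      then have "length J = Suc (Suc 0)" by (auto simp: words_def)
      then obtain i j where ij: "J = [i, j]" by (auto simp: length_Suc_conv)
      have "i \<noteq> j" using J by (auto simp: ij words_def)
      then have "monomial n J {} = 0"
        using J by (intro monomial_vacuum_component) (auto simp: ij words_def simp del: atLeastAtMost_iff)
      then show "(of_real (1 / sqrt (real n) ^ 2) * c n J) * monomial n J {} = 0" by simp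
    qed
  qed simp
  also have "\<dots> = (\<Sum>i\<in>{1..n}. (of_real (1 / real n) * c n [i, i]) * monomial n [i, i] {})"
    by (subst sum.reindex) (auto simp: inj_on_def)
  also have "\<dots> = (\<Sum>i\<in>{1..n}. of_real (1 / real n) * c n [i, i])"
  proof (intro sum.cong refl)
    fix i assume i: "i \<in> {1..n}"
    have "monomial n (i # [] @ [i]) {} = 1"
      by (subst monomial_conjugate[OF i]) (simp_all add: baby_basis_def)
    then show "(of_real (1 / real n) * c n [i, i]) * monomial n [i, i] {} = of_real (1 / real n) * c n [i, i]"
      by simp
  qed
  finally show ?thesis by (simp add: sum_distrib_left)
qed

text \<open>The right-hand side is \<open>\<tau>(X\<^sub>1\<^sup>4 - X\<^sub>1\<^sup>2) = \<tau>(X\<^sub>2 X\<^sub>1 X\<^sub>1)\<close>, as \<open>X\<^sub>1\<^sup>2 = X\<^sub>2 + 1\<close>. By the recursion this is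
  \<open>\<tau>(X\<^sub>3 X\<^sub>1)\<close>, which vanishes, plus the trace of the contraction term multiplied by \<open>X\<^sub>1\<close>, in which
  only pairs of equal letters contribute.\<close>

lemma commuting_density_eq:
  assumes "n \<noteq> 0"
  shows "of_real (commuting_density n) = op_poly ([:0, 0, -1, 0, 1:]) (mul n (X_chaos 1 n)) unit {}"
proof -
  let ?G = "mul n (X_chaos 1 n)"
  let ?X = "X_chaos 1 n" and ?X2 = "X_chaos (Suc (Suc 0)) n" and ?X3 = "X_chaos (Suc (Suc (Suc 0))) n"
  have sq: "mul n ?X ?X = (\<lambda>A. ?X2 A + unit A)"
    using X_chaos_mul_X1[of n 0] contraction_0[OF assms] by (simp flip: One_nat_def)
  have cube: "mul n ?X2 ?X = (\<lambda>A. ?X3 A + contraction 1 n A)"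
    using X_chaos_mul_X1[of n 1] by (simp flip: One_nat_def add: One_nat_def[symmetric])
  have "op_poly [:0, 0, -1, 0, 1:] ?G unit = (\<lambda>A. (?G ^^ Suc (Suc (Suc (Suc 0)))) unit A - (?G ^^ Suc (Suc 0)) unit A)"
    by (simp add: op_poly_def op_sum_def numeral_eq_Suc One_nat_def atMost_Suc fun_eq_iff)
  also have "\<dots> = (\<lambda>A. mul n (mul n ?X ?X) (mul n ?X ?X) A - mul n ?X ?X A)"
    by (simp add: mul_assoc)
  also have "\<dots> = mul n ?X2 (mul n ?X ?X)"
    by (subst (1) sq) (simp add: baby_mult_add_left)
  also have "\<dots> = (\<lambda>A. mul n ?X3 ?X A + mul n (contraction 1 n) ?X A)"
    by (simp only: mul_assoc[symmetric] cube baby_mult_add_left)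
  finally have "op_poly [:0, 0, -1, 0, 1:] ?G unit {} = mul n ?X3 ?X {} + mul n (contraction 1 n) ?X {}" by simp
  also have "mul n ?X3 ?X {} = 0"
  proof -
    have "monomial n J {} = 0" if J: "J \<in> words n (Suc (Suc (Suc (Suc 0))))"
      and d: "distinct (take (Suc (Suc (Suc 0))) J)" for J
    proof (rule monomial_vacuum_component)
      show "set J \<subseteq> {1..n}" using J by (simp add: words_def)
      have "length J = Suc (Suc (Suc (Suc 0)))" using J by (simp add: words_def)
      then obtain i j k l where "J = [i, j, k, l]" by (auto simp: length_Suc_conv)
      then show "odd_letters J \<noteq> {}" using d by auto
    qed
    then show ?thesis
      unfolding X_chaos_def distinct_chaos_def mul_chaos
      by (auto simp: chaos_def One_nat_def intro!: sum.neutral)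
  qed
  also have "mul n (contraction 1 n) ?X {} = of_real (1 / real n) * (\<Sum>i\<in>{1..n}. of_real (baby_Z \<epsilon> n [i]))"
    unfolding X_chaos_def contraction_def distinct_chaos_def mul_chaos
    using chaos_2_vacuum_component[of "\<lambda>n J. (if distinct (take 1 J) then of_real (baby_Z \<epsilon> n (take 1 J)) else 0) *
      (if distinct (drop 1 J) then of_real 1 else 0)" n] by (simp add: One_nat_def numeral_2_eq_2)
  also have "\<dots> = of_real (commuting_density n)"
  proof -
    have "baby_Z \<epsilon> n [i] = (\<Sum>j\<in>{1..n} - {i}. 1 + real_of_int (\<epsilon> i j)) / real n" if i: "i \<in> {1..n}" for i
      unfolding baby_Z_def using sign_values(2)[OF i]
      by (simp add: One_nat_def atMost_Suc add.commute)
    then show ?thesis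
      by (simp add: commuting_density_def power2_eq_square sum_divide_distrib)
  qed
  finally show ?thesis by simp
qed

lemma card_words: "card (words n K) = n ^ K"
  using card_lists_length_eq[of "{1..n}" K] by (simp add: words_def conj_commute)

text \<open>Exchanging the first two letters of every tuple permutes the tuples and multiplies the product by the
  sign of these letters; averaging both forms leaves only tuples that begin with a commuting pair.\<close>

lemma X_chaos_symmetrized:
  "X_chaos (Suc (Suc m)) n = (\<lambda>A. \<Sum>J\<in>distinct_tuples n (Suc (Suc m)).
     of_real (1 / sqrt (real n) ^ Suc (Suc m) * ((1 + real_of_int (\<epsilon> (J ! 0) (J ! 1))) / 2)) * monomial n J A)"
proof
  fix A
  let ?D = "distinct_tuples n (Suc (Suc m))"
  let ?\<sigma> = "\<lambda>J. J ! 1 # J ! 0 # drop 2 J"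
  have cons: "\<exists>i j R. J = i # j # R \<and> i \<in> {1..n} \<and> j \<in> {1..n} \<and> i \<noteq> j" if "J \<in> ?D" for J
    using that by (auto simp: distinct_tuples_def length_Suc_conv simp del: atLeastAtMost_iff)
  have sw: "monomial n J A = of_int (\<epsilon> (J ! 0) (J ! 1)) * monomial n (?\<sigma> J) A" if "J \<in> ?D" for J
  proof -
    obtain i j R where "J = i # j # R" "i \<in> {1..n}" "j \<in> {1..n}" "i \<noteq> j" using cons[OF \<open>J \<in> ?D\<close>] by blast
    then show ?thesis using monomial_swap[of i n j R] by (simp add: One_nat_def numeral_2_eq_2 del: monomial.simps)
  qed
  have inv: "?\<sigma> (?\<sigma> J) = J" and mem: "?\<sigma> J \<in> ?D"
    and val: "of_int (\<epsilon> (?\<sigma> J ! 0) (?\<sigma> J ! 1)) * monomial n (?\<sigma> J) A = monomial n J A" if J: "J \<in> ?D" for J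
  proof -
    obtain i j R where ij: "J = i # j # R" "i \<in> {1..n}" "j \<in> {1..n}" "i \<noteq> j" using cons[OF J] by blast
    have sg: "?\<sigma> J = j # i # R" using ij(1) by (simp add: One_nat_def numeral_2_eq_2)
    show "?\<sigma> (?\<sigma> J) = J" unfolding sg by (simp add: ij(1) One_nat_def numeral_2_eq_2)
    show "?\<sigma> J \<in> ?D" unfolding sg using J by (auto simp: ij(1) distinct_tuples_def)
    show "of_int (\<epsilon> (?\<sigma> J ! 0) (?\<sigma> J ! 1)) * monomial n (?\<sigma> J) A = monomial n J A"
      using sw[OF J] sign_values(2)[OF ij(2,3)] unfolding sg by (simp add: ij(1) One_nat_def)
  qed
  have "(\<Sum>J\<in>?D. monomial n J A) = (\<Sum>J\<in>?D. of_int (\<epsilon> (J ! 0) (J ! 1)) * monomial n J A)"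
    by (rule sum.reindex_bij_witness[where i = ?\<sigma> and j = ?\<sigma>]) (rule inv mem val, assumption)+
  then have "2 * (\<Sum>J\<in>?D. monomial n J A) = (\<Sum>J\<in>?D. monomial n J A) + (\<Sum>J\<in>?D. of_int (\<epsilon> (J ! 0) (J ! 1)) * monomial n J A)"
    by simp
  also have "\<dots> = (\<Sum>J\<in>?D. of_real (1 + real_of_int (\<epsilon> (J ! 0) (J ! 1))) * monomial n J A)"
    by (simp add: sum.distrib[symmetric] distrib_right)
  finally have "(\<Sum>J\<in>?D. monomial n J A) = (\<Sum>J\<in>?D. of_real ((1 + real_of_int (\<epsilon> (J ! 0) (J ! 1))) / 2) * monomial n J A)"
    by (simp add: sum_divide_distrib[symmetric] field_simps)
  then have "of_real (1 / sqrt (real n) ^ Suc (Suc m)) * (\<Sum>J\<in>?D. monomial n J A) =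
      of_real (1 / sqrt (real n) ^ Suc (Suc m)) *
      (\<Sum>J\<in>?D. of_real ((1 + real_of_int (\<epsilon> (J ! 0) (J ! 1))) / 2) * monomial n J A)"
    by simp
  then show "X_chaos (Suc (Suc m)) n A = (\<Sum>J\<in>?D.
     of_real (1 / sqrt (real n) ^ Suc (Suc m) * ((1 + real_of_int (\<epsilon> (J ! 0) (J ! 1))) / 2)) * monomial n J A)"
    unfolding X_chaos_def distinct_chaos_sum sum_distrib_left by (simp only: of_real_mult mult_1_right mult.assoc)
qed

text \<open>At most \<open>k\<^sup>k\<close> tuples share the letters of a given \<open>k\<close>-tuple. In each product of two coefficients of such
  tuples, one factor is bounded by \<open>n\<^sup>-\<^sup>k\<^sup>/\<^sup>2\<close>, while the other one keeps \<open>1 + \<epsilon>\<close> for the first two letters;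
  the free choice of the other \<open>k - 2\<close> letters compensates all but \<open>n\<^sup>-\<^sup>2\<close> of the scalars.\<close>

lemma hs_norm_X_chaos_le_density:
  assumes "n \<noteq> 0"
  shows "(hs_norm n (X_chaos (Suc (Suc m)) n))\<^sup>2 \<le> real (Suc (Suc m) ^ Suc (Suc m)) * commuting_density n"
proof -
  let ?k = "Suc (Suc m)"
  let ?D = "distinct_tuples n ?k"
  let ?s = "1 / sqrt (real n) ^ ?k"
  let ?e = "\<lambda>i j. 1 + real_of_int (\<epsilon> i j)"
  let ?c = "\<lambda>J. ?s * (?e (J ! 0) (J ! 1) / 2)"
  have finD: "finite ?D" by (simp add: distinct_tuples_words)
  have e: "0 \<le> ?e i j" "?e i j \<le> 2" if "i \<in> {1..n}" "j \<in> {1..n}" for i j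
    using sign_values(1)[OF that] by auto
  have J01: "J ! 0 \<in> {1..n}" "J ! 1 \<in> {1..n}" if "J \<in> ?D" for J
  proof -
    have "0 < length J" "1 < length J" "set J \<subseteq> {1..n}" using that by (auto simp: distinct_tuples_def)
    then show "J ! 0 \<in> {1..n}" "J ! 1 \<in> {1..n}" using nth_mem by blast+
  qed
  have c: "0 \<le> ?c J" "?c J \<le> ?s" if "J \<in> ?D" for J
  proof -
    have *: "0 \<le> ?e (J ! 0) (J ! 1) / 2" "?e (J ! 0) (J ! 1) / 2 \<le> 1"
      using e[OF J01[OF that]] by simp_all
    show "0 \<le> ?c J" by (intro mult_nonneg_nonneg *(1)) simp
    have "?c J \<le> ?s * 1" by (intro mult_left_mono *(2)) simp
    then show "?c J \<le> ?s" by simp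
  qed
  have eq: "X_chaos ?k n = (\<lambda>A. \<Sum>J\<in>?D. of_real (?c J) * monomial n J A)"
    by (rule X_chaos_symmetrized)
  have "(hs_norm n (X_chaos ?k n))\<^sup>2 \<le> (\<Sum>J\<in>?D. \<Sum>J'\<in>{J'\<in>?D. odd_letters J' = odd_letters J}.
      cmod (of_real (?c J)) * cmod (of_real (?c J')))"
    unfolding eq by (rule hs_norm_square_word_sum_le[of _ _ ?k]) (auto simp: distinct_tuples_words)
  also have "\<dots> \<le> (\<Sum>J\<in>?D. ?c J * (real (?k ^ ?k) * ?s))"
  proof (rule sum_mono)
    fix J assume J: "J \<in> ?D"
    let ?S = "{J'\<in>?D. odd_letters J' = odd_letters J}"
    have "?S \<subseteq> {xs. set xs \<subseteq> set J \<and> length xs = ?k}"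
      using J by (auto simp: distinct_tuples_def odd_letters_distinct)
    then have "card ?S \<le> card {xs. set xs \<subseteq> set J \<and> length xs = ?k}"
      by (intro card_mono finite_lists_length_eq) auto
    also have "\<dots> = ?k ^ ?k"
      using J by (subst card_lists_length_eq) (auto simp: distinct_tuples_def distinct_card)
    finally have card: "real (card ?S) \<le> real (?k ^ ?k)" by (simp only: of_nat_mono)
    have "(\<Sum>J'\<in>?S. cmod (of_real (?c J)) * cmod (of_real (?c J'))) \<le> (\<Sum>J'\<in>?S. ?c J * ?s)"
    proof (rule sum_mono)
      fix J' assume "J' \<in> ?S"
      then show "cmod (of_real (?c J)) * cmod (of_real (?c J')) \<le> ?c J * ?s"
        using c[OF J] c[of J'] by (simp only: norm_of_real mem_Collect_eq abs_of_nonneg mult_left_mono)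
    qed
    also have "\<dots> = ?c J * (real (card ?S) * ?s)" by (simp only: sum_constant mult_ac)
    also have "\<dots> \<le> ?c J * (real (?k ^ ?k) * ?s)"
      using c[OF J] card by (intro mult_left_mono mult_right_mono) auto
    finally show "(\<Sum>J'\<in>?S. cmod (of_real (?c J)) * cmod (of_real (?c J'))) \<le> ?c J * (real (?k ^ ?k) * ?s)" .
  qed
  also have "\<dots> = real (?k ^ ?k) * (?s * ?s / 2) * (\<Sum>J\<in>?D. ?e (J ! 0) (J ! 1))"
  proof -
    have "s * (e / 2) * (K * s) = K * (s * s / 2) * e" for s e K :: real by simp
    then show ?thesis by (simp only: sum_distrib_left)
  qed
  also have "\<dots> \<le> real (?k ^ ?k) * (?s * ?s / 2) * (real (n ^ m) * (real n ^ 2 * commuting_density n))"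
  proof (rule mult_left_mono)
    let ?P = "SIGMA i:{1..n}. {1..n} - {i}"
    let ?F = "\<lambda>(p, R). fst p # snd p # R"
    have sub: "?D \<subseteq> ?F ` (?P \<times> words n m)"
    proof
      fix J assume J: "J \<in> ?D"
      then obtain i j R where ij: "J = i # j # R" by (auto simp: distinct_tuples_def length_Suc_conv)
      then have "J = ?F ((i, j), R)" "((i, j), R) \<in> ?P \<times> words n m"
        using J by (auto simp: distinct_tuples_def words_def simp del: atLeastAtMost_iff)
      then show "J \<in> ?F ` (?P \<times> words n m)" by blast
    qed
    have "(\<Sum>J\<in>?D. ?e (J ! 0) (J ! 1)) \<le> (\<Sum>J\<in>?F ` (?P \<times> words n m). ?e (J ! 0) (J ! 1))"
      by (rule sum_mono2[OF _ sub]) (use e in \<open>auto simp: One_nat_def\<close>)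
    also have "\<dots> = (\<Sum>(p, R)\<in>?P \<times> words n m. ?e (fst p) (snd p))"
      by (subst sum.reindex) (auto simp: inj_on_def One_nat_def split_def)
    also have "\<dots> = (\<Sum>p\<in>?P. \<Sum>R\<in>words n m. ?e (fst p) (snd p))"
      by (rule sum.cartesian_product[symmetric])
    also have "\<dots> = real (n ^ m) * (\<Sum>p\<in>?P. ?e (fst p) (snd p))"
      by (simp only: sum_constant card_words sum_distrib_left)
    also have "(\<Sum>p\<in>?P. ?e (fst p) (snd p)) = (\<Sum>i\<in>{1..n}. \<Sum>j\<in>{1..n} - {i}. ?e i j)"
      by (subst sum.Sigma) (auto simp: split_def)
    also have "\<dots> = real n ^ 2 * commuting_density n"
      using assms by (simp add: commuting_density_def)
    finally show "(\<Sum>J\<in>?D. ?e (J ! 0) (J ! 1)) \<le> real (n ^ m) * (real n ^ 2 * commuting_density n)" .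
  qed simp
  also have "\<dots> = real (?k ^ ?k) * ((?s * ?s * real n ^ ?k) * (commuting_density n / 2))"
    by (simp add: power2_eq_square mult_ac)
  also have "?s * ?s * real n ^ ?k = 1"
  proof -
    have "sqrt (real n) ^ ?k * sqrt (real n) ^ ?k = real n ^ ?k"
      by (simp only: power_mult_distrib[symmetric]) simp
    then show ?thesis using assms by (simp add: field_simps)
  qed
  also have "real (?k ^ ?k) * (1 * (commuting_density n / 2)) \<le> real (?k ^ ?k) * commuting_density n"
  proof (rule mult_left_mono)
    have "0 \<le> commuting_density n"
      unfolding commuting_density_def by (intro divide_nonneg_nonneg sum_nonneg e) auto
    then show "1 * (commuting_density n / 2) \<le> commuting_density n" by simp
  qed simp
  finally show ?thesis .
qed

lemma X_chaos_null:
  assumes "commuting_density \<longlonglongrightarrow> 0"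
  shows "null (X_chaos (Suc (Suc m)))"
proof (rule nullI[OF good_X_chaos])
  show "(\<lambda>n. (hs_norm n (X_chaos (Suc (Suc m)) n))\<^sup>2) \<longlonglongrightarrow> 0"
  proof (rule tendsto_sandwich[OF _ _ tendsto_const])
    show "(\<lambda>n. real (Suc (Suc m) ^ Suc (Suc m)) * commuting_density n) \<longlonglongrightarrow> 0"
      by (rule tendsto_mult_right_zero[OF assms])
    show "\<forall>\<^sub>F n in sequentially. (hs_norm n (X_chaos (Suc (Suc m)) n))\<^sup>2 \<le> real (Suc (Suc m) ^ Suc (Suc m)) * commuting_density n"
      using eventually_gt_at_top[of 0] by eventually_elim (rule hs_norm_X_chaos_le_density, simp)
  qed simp
qed

lemma contraction_null:
  assumes "commuting_density \<longlonglongrightarrow> 0"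
  shows "null (contraction (Suc l))"
proof -
  have "contraction (Suc l) = (\<lambda>n A. mul n (X_chaos (Suc (Suc l)) n) (X_chaos 1 n) A - X_chaos (Suc (Suc (Suc l))) n A)"
    unfolding X_chaos_mul_X1 by simp
  then show ?thesis
    using null_diff[OF null_mul_right[OF X_chaos_null[OF assms] good_X_chaos] X_chaos_null[OF assms]] by simp
qed

lemma qint_Suc_0: "qint q (Suc 0) = 1"
  by (simp add: qint_def)

lemma qint_eq_0_imp:
  assumes "-1 \<le> q" "q \<le> 1" "qint q (Suc l) = 0"
  shows "q = -1"
proof (rule ccontr)
  assume "q \<noteq> -1"
  moreover have "q \<noteq> 1" using assms(3) by (auto simp: qint_def)
  ultimately have "\<bar>q\<bar> < 1" using assms(1,2) by auto
  then have "\<bar>q\<bar> ^ Suc l < 1" using power_strict_mono[of "\<bar>q\<bar>" 1 "Suc l"] by simp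
  then have "q ^ Suc l \<noteq> 1" by (metis abs_one less_irrefl power_abs)
  then show False using assms(3) \<open>q \<noteq> 1\<close> by (simp add: qint_def)
qed

text \<open>The three cases: the empty tuple, where both sides agree exactly; nonvanishing \<open>[l+1]\<^sub>q\<close>, where the
  assumption on \<open>X - Y\<close> applies; and \<open>q = -1\<close> with \<open>l\<close> odd, where the contraction itself is small.\<close>

lemma contraction_minus_X_chaos_null:
  assumes q: "-1 \<le> q" "q \<le> 1"
    and XY: "\<And>l. 1 \<le> l \<Longrightarrow> null (\<lambda>n A. X_chaos l n A - Y_chaos q l n A)"
    and dens: "q = -1 \<Longrightarrow> commuting_density \<longlonglongrightarrow> 0"
  shows "null (\<lambda>n A. contraction l n A - of_real (qint q (Suc l)) * X_chaos l n A)"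
proof -
  consider "l = 0" | "1 \<le> l" "qint q (Suc l) \<noteq> 0" | l' where "l = Suc l'" "qint q (Suc l) = 0"
    by (cases l) auto
  then show ?thesis
  proof cases
    case 1
    show ?thesis
    proof (rule null_eventually_cong[OF null_zero good_diff[OF good_contraction good_scale[OF good_X_chaos]]])
      show "\<forall>\<^sub>F n in sequentially. (\<lambda>A. 0) = (\<lambda>A. contraction l n A - of_real (qint q (Suc l)) * X_chaos l n A)"
        using eventually_gt_at_top[of 0]
        by eventually_elim (simp add: 1 contraction_0 X_chaos_0 qint_Suc_0)
    qed
  next
    case 2
    have "contraction l n A - of_real (qint q (Suc l)) * X_chaos l n A = - of_real (qint q (Suc l)) * (X_chaos l n A - Y_chaos q l n A)" for n A
      using contraction_eq_Y_chaos[of q l n A] 2 by (simp add: right_diff_distrib flip: Suc_eq_plus1)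
    then show ?thesis using null_scale[OF XY[OF 2(1)], of "- of_real (qint q (Suc l))"] by simp
  next
    case 3
    have "q = -1" by (rule qint_eq_0_imp[OF q 3(2)])
    then show ?thesis using contraction_null[OF dens] 3 by simp
  qed
qed

section \<open>Convergence of joint moments\<close>

definition word_product :: "('i \<Rightarrow> nat \<Rightarrow> nat set vec) \<Rightarrow> 'i list \<Rightarrow> nat \<Rightarrow> nat set vec" where
  "word_product a w n = foldr (\<lambda>v x. mul n (a v n) x) w unit"

lemma word_product_simps:
  "word_product a [] = (\<lambda>n. unit)"
  "word_product a (v # w) = (\<lambda>n. mul n (a v n) (word_product a w n))"
  by (simp_all add: word_product_def fun_eq_iff)

lemma word_product_in_space [simp]: "word_product a w n \<in> space n"
  by (cases w) (simp_all add: word_product_simps)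

lemma good_word_product:
  assumes "\<And>v. v \<in> set w \<Longrightarrow> good (a v)"
  shows "good (word_product a w)"
  using assms by (induction w) (simp_all add: word_product_simps good_unit good_mul)

lemma null_word_product_diff:
  assumes "\<And>v. v \<in> set w \<Longrightarrow> good (a v) \<and> good (b v) \<and> null (\<lambda>n A. a v n A - b v n A)"
  shows "null (\<lambda>n A. word_product a w n A - word_product b w n A)"
  using assms
proof (induction w)
  case Nil
  then show ?case by (simp add: word_product_simps null_zero)
next
  case (Cons v w)
  then show ?case
    unfolding word_product_simps
    by (intro null_mul_diff good_word_product) auto
qed

lemma op_prod_word_product:
  assumes "\<And>v x. v \<in> set w \<Longrightarrow> x \<in> space n \<Longrightarrow> T v x = mul n (a v n) x"
  shows "op_prod T w unit = word_product a w n"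
  using assms by (induction w) (simp_all add: op_prod_def word_product_simps)

lemma op_poly_mul:
  assumes "x \<in> space n" "y \<in> space n"
  shows "op_poly p (mul n y) x = mul n (op_poly p (mul n y) unit) x"
proof -
  have "(mul n y ^^ i) x = mul n ((mul n y ^^ i) unit) x" for i
    using assms by (induction i) (simp_all add: mul_assoc)
  then show ?thesis
    unfolding op_poly_def op_sum_def baby_mult_sum_left by simp
qed

text \<open>Replacing every factor of a word in the \<open>X\<close> and \<open>Y\<close> by the Hermite polynomial in \<open>X\<^sub>1\<close> changes it by a
  null sequence, because null sequences are an ideal; what remains is a single polynomial in \<open>X\<^sub>1\<close>.\<close>

theorem joint_moments_tendsto:
  assumes q: "-1 \<le> q" "q \<le> 1"
    and XY: "\<And>l. 1 \<le> l \<Longrightarrow> null (\<lambda>n A. X_chaos l n A - Y_chaos q l n A)"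
    and m: "\<And>R. (\<lambda>n. op_poly R (mul n (X_chaos 1 n)) unit {}) \<longlonglongrightarrow> m R"
    and m0: "q = -1 \<Longrightarrow> m [:0, 0, -1, 0, 1:] = 0"
    and a: "\<And>v. v < length K \<Longrightarrow> a v = X_chaos (K ! v) \<or> a v = Y_chaos q (K ! v) \<and> 1 \<le> K ! v"
    and T: "\<And>n v x. v < length K \<Longrightarrow> x \<in> space n \<Longrightarrow> (T n ! v) x = mul n (a v n) x"
    and P: "P \<in> nc_polys (length K)"
  shows "(\<lambda>n. nc_eval_op P (T n) unit {}) \<longlonglongrightarrow> m (subst_poly P (map (q_hermite q) K))"
proof -
  have dens: "commuting_density \<longlonglongrightarrow> 0" if "q = -1"
  proof -
    have "(\<lambda>n. of_real (commuting_density n) :: complex) \<longlonglongrightarrow> of_real 0"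
      using m[of "[:0, 0, -1, 0, 1:]"] unfolding m0[OF that] of_real_0
    proof (rule Lim_transform_eventually)
      show "\<forall>\<^sub>F n in sequentially. op_poly [:0, 0, - 1, 0, 1:] (mul n (X_chaos 1 n)) unit {} = of_real (commuting_density n)"
        using eventually_gt_at_top[of 0] by eventually_elim (rule commuting_density_eq[symmetric], simp)
    qed
    then show ?thesis by (simp only: tendsto_of_real_iff)
  qed
  have XH: "null (\<lambda>n A. X_chaos k n A - hermite_X q k n A)" for k
    by (rule X_chaos_minus_hermite_X_null[OF contraction_minus_X_chaos_null[OF q XY dens]])
  define b where "b v = hermite_X q (K ! v)" for v
  have ab: "good (a v) \<and> good (b v) \<and> null (\<lambda>n A. a v n A - b v n A)" if "v < length K" for v
  proof -
    have "null (\<lambda>n A. Y_chaos q k n A - hermite_X q k n A)" if "1 \<le> k" for k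
      using null_diff[OF XH[of k] XY[OF that]] by simp
    then show ?thesis using a[OF that] XH by (auto simp: b_def good_X_chaos good_Y_chaos good_hermite_X)
  qed
  let ?ps = "map (q_hermite q) K"
  have w: "v < length K" if "w \<in> Poly_Mapping.keys P" "v \<in> set w" for w v
    using P that by (auto simp: nc_polys_def)
  have X: "nc_eval_op P (T n) unit {} =
      (\<Sum>w\<in>Poly_Mapping.keys P. Poly_Mapping.lookup P w * word_product a w n {})" for n
  proof -
    have "op_prod (\<lambda>v. T n ! v) w unit = word_product a w n" if "w \<in> Poly_Mapping.keys P" for w
      by (rule op_prod_word_product) (rule T[OF w[OF that]])
    then show ?thesis unfolding nc_eval_op_def op_sum_def by simp
  qed
  have H: "op_poly (subst_poly P ?ps) (mul n (X_chaos 1 n)) unit {} =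
      (\<Sum>w\<in>Poly_Mapping.keys P. Poly_Mapping.lookup P w * word_product b w n {})" for n
  proof -
    have "op_poly (subst_poly P ?ps) (mul n (X_chaos 1 n)) unit =
        nc_eval_op P (map (\<lambda>p. op_poly p (mul n (X_chaos 1 n))) ?ps) unit"
      using P by (subst nc_eval_op_poly[OF mul_linear unit_in_space]) simp_all
    moreover have "op_prod (\<lambda>v. map (\<lambda>p. op_poly p (mul n (X_chaos 1 n))) ?ps ! v) w unit = word_product b w n"
      if "w \<in> Poly_Mapping.keys P" for w
      using w[OF that] by (intro op_prod_word_product) (simp add: b_def hermite_X_def flip: op_poly_mul)
    ultimately show ?thesis unfolding nc_eval_op_def op_sum_def by simp
  qed
  have "(\<lambda>n. \<Sum>w\<in>Poly_Mapping.keys P. Poly_Mapping.lookup P w * (word_product a w n {} - word_product b w n {}))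
      \<longlonglongrightarrow> (\<Sum>w\<in>Poly_Mapping.keys P. Poly_Mapping.lookup P w * 0)"
    using ab w by (intro tendsto_intros null_vacuum_component[OF null_word_product_diff]) blast
  then have "(\<lambda>n. nc_eval_op P (T n) unit {} - op_poly (subst_poly P ?ps) (mul n (X_chaos 1 n)) unit {}) \<longlonglongrightarrow> 0"
    by (simp add: X H sum_subtractf right_diff_distrib)
  from tendsto_add[OF this m[of "subst_poly P ?ps"]] show ?thesis by simp
qed

end

text \<open>A random sign has equal second and fourth moments.\<close>

lemma q_gaussian_moment_minus_one:
  "q_gaussian_moment (-1) h [[:0, 1:]] (univariate [:0, 0, -1, 0, 1:]) = 0"
proof -
  let ?R = "[:0, 0, -1, 0, 1:] :: complex poly"
  let ?\<mu> = "measure_pmf (pmf_of_set {-1, 1 :: real})"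
  have eval: "nc_eval_scalar (univariate R) (map (\<lambda>p. poly p z) [[:0, 1:]]) = poly R z" for R z
    using nc_eval_scalar_subst_poly[of "univariate R" "[[:0, 1:]]" z] univariate_in_nc_polys[of R]
    by (simp add: subst_poly_univariate One_nat_def)
  have "q_gaussian_moment (-1) h [[:0, 1:]] (univariate ?R) =
      (LINT x|?\<mu>. nc_eval_scalar (univariate ?R) (map (\<lambda>p. poly p (of_real x)) [[:0, 1:]]))"
    by (simp add: q_gaussian_moment_def classical_gaussian_def)
  also have "\<dots> = (LINT x|?\<mu>. poly ?R (of_real x))" by (simp only: eval)
  also have "\<dots> = (LINT x|?\<mu>. 0)"
    by (rule integral_cong_AE) (auto simp: AE_measure_pmf_iff)
  finally show ?thesis by simp
qed

context baby_fock
begin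

lemma null_X_chaos_minus_Y_chaos:
  assumes l: "1 \<le> l"
    and lim: "(\<lambda>n. baby_norm {1..n} \<epsilon> 2 (op_diff (baby_X \<epsilon> n l) (baby_Y q \<epsilon> n l))) \<longlonglongrightarrow> 0"
  shows "null (\<lambda>n A. X_chaos l n A - Y_chaos q l n A)"
proof -
  have "baby_norm {1..n} \<epsilon> 2 (op_diff (baby_X \<epsilon> n l) (baby_Y q \<epsilon> n l)) = hs_norm n (\<lambda>A. X_chaos l n A - Y_chaos q l n A)" for n
  proof (rule baby_norm_2)
    show "(\<lambda>A. X_chaos l n A - Y_chaos q l n A) \<in> space n"
      using good_in_space[OF good_diff[OF good_X_chaos good_Y_chaos]] .
    show "op_diff (baby_X \<epsilon> n l) (baby_Y q \<epsilon> n l) x = mul n (\<lambda>A. X_chaos l n A - Y_chaos q l n A) x"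
      if "x \<in> space n" for x
      unfolding op_diff_def baby_X_mul[OF l that] baby_Y_mul[OF l that] baby_mult_diff_left ..
  qed
  then show ?thesis
    using lim good_diff[OF good_X_chaos good_Y_chaos] by (simp add: null_def)
qed

text \<open>This puts the moments of \<open>X\<^sub>1\<close> in the form in which they occur after the Hermite approximation.\<close>

lemma baby_tau_univariate:
  "baby_tau {1..n} \<epsilon> (nc_eval_op (univariate R) [baby_X \<epsilon> n 1]) = op_poly R (mul n (X_chaos 1 n)) unit {}"
proof -
  have X: "baby_X \<epsilon> n 1 x = mul n (X_chaos 1 n) x" if "x \<in> space n" for x
    using baby_X_mul[of 1 x n] that by simp
  have lin: "linear_on_subspace (space n) (baby_X \<epsilon> n 1)"
    using mul_linear[of n "X_chaos 1 n"] X unfolding linear_on_subspace_def lin_subspace_def by simp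
  have pow: "(baby_X \<epsilon> n 1 ^^ i) unit = (mul n (X_chaos 1 n) ^^ i) unit" for i
  proof (induction i)
    case (Suc i)
    moreover have "(mul n (X_chaos 1 n) ^^ i) unit \<in> space n"
      by (rule linear_on_subspace_funpow[OF mul_linear unit_in_space])
    ultimately show ?case by (simp add: X)
  qed simp
  have eval: "op_prod (\<lambda>v. [baby_X \<epsilon> n 1] ! v) w unit =
      op_prod (\<lambda>v. map (\<lambda>p. op_poly p (baby_X \<epsilon> n 1)) [[:0, 1:]] ! v) w unit" if "set w \<subseteq> {0}" for w
  proof -
    have "op_prod (\<lambda>v. map (\<lambda>p. op_poly p (baby_X \<epsilon> n 1)) [[:0, 1:]] ! v) w unit =
        op_prod (\<lambda>v. [baby_X \<epsilon> n 1] ! v) w unit \<and> op_prod (\<lambda>v. [baby_X \<epsilon> n 1] ! v) w unit \<in> space n"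
      using that
      by (induction w) (auto simp: op_prod_def op_poly_x[OF lin] X)
    then show ?thesis by simp
  qed
  have "nc_eval_op (univariate R) [baby_X \<epsilon> n 1] unit =
      nc_eval_op (univariate R) (map (\<lambda>p. op_poly p (baby_X \<epsilon> n 1)) [[:0, 1:]]) unit"
    unfolding nc_eval_op_def op_sum_def
  proof (intro ext sum.cong refl)
    fix A w assume "w \<in> Poly_Mapping.keys (univariate R)"
    then have "set w \<subseteq> {0}" by (auto simp: keys_univariate)
    then show "Poly_Mapping.lookup (univariate R) w * op_prod (\<lambda>v. [baby_X \<epsilon> n 1] ! v) w unit A =
      Poly_Mapping.lookup (univariate R) w *
        op_prod (\<lambda>v. map (\<lambda>p. op_poly p (baby_X \<epsilon> n 1)) [[:0, 1:]] ! v) w unit A"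
      by (simp only: eval)
  qed
  also have "\<dots> = op_poly (subst_poly (univariate R) [[:0, 1:]]) (baby_X \<epsilon> n 1) unit"
    by (rule nc_eval_op_poly[OF lin unit_in_space]) (simp add: univariate_in_nc_polys[unfolded One_nat_def])
  also have "\<dots> = op_poly R (mul n (X_chaos 1 n)) unit"
    unfolding subst_poly_univariate by (simp add: op_poly_def op_sum_def pow)
  finally show ?thesis by (simp add: baby_tau_vacuum_component)
qed

end

theorem theorem4p1:
  fixes q :: real and \<epsilon> :: "nat \<Rightarrow> nat \<Rightarrow> int" and h :: "'j \<Rightarrow> real" and k :: nat
  assumes "-1 \<le> q" "q \<le> 1"
    and "sign_function \<epsilon>"
    and unit_vector: "((\<lambda>j. (h j)\<^sup>2) has_sum 1) UNIV"
    and a: "\<And>Q. Q \<in> nc_polys 1 \<Longrightarrow>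
      (\<lambda>n. baby_tau {1..n} \<epsilon> (nc_eval_op Q [baby_X \<epsilon> n 1]))
        \<longlonglongrightarrow> q_gaussian_moment q h [[:0, 1:]] Q"
    and b: "\<And>l p. 1 \<le> l \<Longrightarrow> 1 \<le> p \<Longrightarrow>
      (\<lambda>n. baby_norm {1..n} \<epsilon> p (op_diff (baby_X \<epsilon> n l) (baby_Y q \<epsilon> n l))) \<longlonglongrightarrow> 0"
    and "1 \<le> k"
  shows "\<forall>P \<in> nc_polys (2 * k - 1).
    (\<lambda>n. baby_tau {1..n} \<epsilon>
           (nc_eval_op P (map (baby_X \<epsilon> n) [1..<k + 1] @ map (baby_Y q \<epsilon> n) [1..<k])))
      \<longlonglongrightarrow> q_gaussian_moment q h (map (q_hermite q) [1..<k + 1] @ map (q_hermite q) [1..<k]) P"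
proof
  fix P assume P: "P \<in> nc_polys (2 * k - 1)"
  interpret baby_fock \<epsilon> by unfold_locales (rule assms(3))
  (* The Hermite index of each variable; the variables at positions below k are the X. *)
  define K where "K = [1..<k + 1] @ [1..<k]"
  define v where "v i = (if i < k then X_chaos (K ! i) else Y_chaos q (K ! i))" for i
  define Ts where "Ts n = map (baby_X \<epsilon> n) [1..<k + 1] @ map (baby_Y q \<epsilon> n) [1..<k]" for n
  define m where "m R = q_gaussian_moment q h [[:0, 1:]] (univariate R)" for R
  have len: "length K = 2 * k - 1" using \<open>1 \<le> k\<close> by (simp add: K_def)
  have K_pos: "1 \<le> K ! i" if "i < length K" for i
  proof -
    have "K ! i \<in> set K" using that by (rule nth_mem)
    then show ?thesis by (auto simp: K_def)
  qed
  have XY: "null (\<lambda>n A. X_chaos l n A - Y_chaos q l n A)" if "1 \<le> l" for l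
    by (rule null_X_chaos_minus_Y_chaos[OF that]) (rule b[OF that], simp)
  have lim: "(\<lambda>n. op_poly R (mul n (X_chaos 1 n)) unit {}) \<longlonglongrightarrow> m R" for R
    using a[OF univariate_in_nc_polys[of R]] unfolding baby_tau_univariate m_def .
  have m0: "m [:0, 0, -1, 0, 1:] = 0" if "q = -1"
    using q_gaussian_moment_minus_one[of h] that by (simp add: m_def)
  have "(\<lambda>n. nc_eval_op P (Ts n) unit {}) \<longlonglongrightarrow> m (subst_poly P (map (q_hermite q) K))"
  proof (rule joint_moments_tendsto[OF assms(1,2) XY lim m0])
    show "P \<in> nc_polys (length K)" using P len by simp
    show "v i = X_chaos (K ! i) \<or> v i = Y_chaos q (K ! i) \<and> 1 \<le> K ! i" if "i < length K" for i
      using K_pos[OF that] by (simp add: v_def)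
    show "(Ts n ! i) x = mul n (v i n) x" if "i < length K" "x \<in> space n" for n i x
    proof (cases "i < k")
      case True
      then have "Ts n ! i = baby_X \<epsilon> n (K ! i)" by (simp add: Ts_def K_def nth_append del: upt_Suc)
      then show ?thesis using True baby_X_mul[OF K_pos that(2)] that(1) by (simp add: v_def)
    next
      case False
      then have "Ts n ! i = baby_Y q \<epsilon> n (K ! i)"
        using that(1) by (simp add: Ts_def K_def nth_append del: upt_Suc)
      then show ?thesis using False baby_Y_mul[OF K_pos that(2)] that(1) by (simp add: v_def)
    qed
  qed
  moreover have "m (subst_poly P (map (q_hermite q) K)) = q_gaussian_moment q h (map (q_hermite q) K) P"
    unfolding m_def using P len by (intro q_gaussian_moment_univariate[OF unit_vector, symmetric]) simp
  ultimately show "(\<lambda>n. baby_tau {1..n} \<epsilon>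
           (nc_eval_op P (map (baby_X \<epsilon> n) [1..<k + 1] @ map (baby_Y q \<epsilon> n) [1..<k])))
      \<longlonglongrightarrow> q_gaussian_moment q h (map (q_hermite q) [1..<k + 1] @ map (q_hermite q) [1..<k]) P"
    by (simp add: baby_tau_vacuum_component Ts_def K_def del: upt_Suc)
qed

end
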